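(* There exists an algorithm which, given a finite graph $G$, an independent set $S$ of $G$, and an integer $k$, runs in time $O^*(2^{\mathrm{mw}(G)})$ and outputs an independent set $S'$ of $G$ with $|S'|=\lambda(G,S,k)$ together with a $\mathsf{TAR}(k)$ reconfiguration sequence proving $S\leftrightsquigarrow_k S'$.
   Context: For a graph $G$, independent sets $S,S'$ and an integer $k$, write $S\leftrightarrow_k S'$ if $|S\triangle S'|\le 1$ and $\min\{|S|,|S'|\}\ge k$. Write $S\leftrightsquigarrow_k S'$ if there exist $\ell\ge 0$ and independent sets $S_0=S,\dots,S_\ell=S'$ of $G$ with $S_{i-1}\leftrightarrow_k S_i$ for all $i$; such a sequence is a $\mathsf{TAR}(k)$ reconfiguration sequence. $\lambda(G,S,k)$ is the largest size of an independent set $S'$ with $S\leftrightsquigarrow_k S'$. A module of $G=(V,E)$ is a set $M\subseteq V$ such that every vertex of $V\setminus M$ is adjacent to all or to none of the vertices of $M$. A graph has modular-width at most $k$ if either it has at most $k$ vertices, or its vertex set can be partitioned into at most $k$ modules $V_1,\dots,V_s$ such that each $G[V_i]$ has modular-width at most $k$; $\mathrm{mw}(G)$ is the minimum such $k$. $O^*(\cdot)$ suppresses factors polynomial in the input size. *)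

theory Defs
  imports "HOL-Library.Disjoint_Sets" "HOL-Computational_Algebra.Polynomial"
begin

section \<open>Graphs, independent sets and modular-width\<close>

definition finite_graph :: "'a set \<Rightarrow> 'a set set \<Rightarrow> bool" where
  "finite_graph V E \<longleftrightarrow> finite V \<and> (\<forall>e\<in>E. e \<subseteq> V \<and> card e = 2)"

definition independent_set :: "'a set \<Rightarrow> 'a set set \<Rightarrow> 'a set \<Rightarrow> bool" where
  "independent_set V E S \<longleftrightarrow> S \<subseteq> V \<and> (\<forall>u\<in>S. \<forall>v\<in>S. {u, v} \<notin> E)"

definition is_module :: "'a set \<Rightarrow> 'a set set \<Rightarrow> 'a set \<Rightarrow> bool" where
  "is_module V E M \<longleftrightarrow> M \<subseteq> V \<and>
     (\<forall>v \<in> V - M. (\<forall>u\<in>M. {u, v} \<in> E) \<or> (\<forall>u\<in>M. {u, v} \<notin> E))"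

definition induced_edges :: "'a set set \<Rightarrow> 'a set \<Rightarrow> 'a set set" where
  "induced_edges E W = {e \<in> E. e \<subseteq> W}"

inductive mw_at_most :: "nat \<Rightarrow> 'a set \<Rightarrow> 'a set set \<Rightarrow> bool" for k where
  small: "finite V \<Longrightarrow> card V \<le> k \<Longrightarrow> mw_at_most k V E"
| split: "partition_on V P \<Longrightarrow> finite P \<Longrightarrow> card P \<le> k \<Longrightarrow>
    (\<And>M. M \<in> P \<Longrightarrow> is_module V E M) \<Longrightarrow>
    (\<And>M. M \<in> P \<Longrightarrow> mw_at_most k M (induced_edges E M)) \<Longrightarrow>
    mw_at_most k V E"

definition modular_width :: "'a set \<Rightarrow> 'a set set \<Rightarrow> nat" where
  "modular_width V E = (LEAST k. mw_at_most k V E)"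


section \<open>Token addition and removal\<close>

definition tar_step :: "int \<Rightarrow> 'a set \<Rightarrow> 'a set \<Rightarrow> bool" where
  "tar_step k S S' \<longleftrightarrow> card (sym_diff S S') \<le> 1 \<and> int (min (card S) (card S')) \<ge> k"

definition tar_sequence ::
  "'a set \<Rightarrow> 'a set set \<Rightarrow> int \<Rightarrow> 'a set \<Rightarrow> 'a set \<Rightarrow> 'a set list \<Rightarrow> bool" where
  "tar_sequence V E k S S' Ss \<longleftrightarrow>
     Ss \<noteq> [] \<and> hd Ss = S \<and> last Ss = S' \<and>
     (\<forall>X \<in> set Ss. independent_set V E X) \<and> successively (tar_step k) Ss"

definition tar_reachable ::
  "'a set \<Rightarrow> 'a set set \<Rightarrow> int \<Rightarrow> 'a set \<Rightarrow> 'a set \<Rightarrow> bool" where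
  "tar_reachable V E k S S' \<longleftrightarrow> (\<exists>Ss. tar_sequence V E k S S' Ss)"

text \<open>For a finite graph and an independent set \<open>S\<close> the set below is finite and contains
  \<open>card S\<close> (one-element sequence), whatever the value of \<open>k\<close>.\<close>

definition tar_lambda :: "'a set \<Rightarrow> 'a set set \<Rightarrow> 'a set \<Rightarrow> int \<Rightarrow> nat" where
  "tar_lambda V E S k = Max {card S' | S'. tar_reachable V E k S S'}"


section \<open>Model of computation\<close>

text \<open>
  Algorithms are programs of a first-order, call-by-value language whose only data are binary
  trees with unlabelled leaves. A program is a finite list of function bodies; variables are
  de Bruijn indices into the current environment, and function \<open>0\<close> is the main function.
  There is no arithmetic and no comparison of trees other than the test for a leaf.

  Every evaluated construct costs one time unit. The unit cost is the one of pointer machines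
  and random access machines: trees are immutable, so that reading a variable and \<open>Cons\<close>
  only copy references to heap cells, and environments have a length bounded by the program text.
  A run of cost \<open>t\<close> on an input of size \<open>n\<close> is simulated by a random access machine in
  \<open>O(n + t)\<close> operations on words of \<open>O(log (n + t))\<close> bits.
\<close>

datatype tree = Leaf | Node tree tree

datatype exp =
    Var nat
  | Nil
  | Cons exp exp
  | Hd exp
  | Tl exp
  | If exp exp exp
  | Let exp exp
  | Call nat "exp list"

hide_const (open) Nil Cons If Let

type_synonym prog = "exp list"

fun head :: "tree \<Rightarrow> tree" where
  "head Leaf = Leaf"
| "head (Node a b) = a"

fun tail :: "tree \<Rightarrow> tree" where
  "tail Leaf = Leaf"
| "tail (Node a b) = b"

text \<open>\<open>eval P env e v t\<close>: in program \<open>P\<close> and environment \<open>env\<close>, the evaluation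
  of \<open>e\<close> terminates with value \<open>v\<close> after \<open>t\<close> time units.\<close>

inductive
  eval :: "prog \<Rightarrow> tree list \<Rightarrow> exp \<Rightarrow> tree \<Rightarrow> nat \<Rightarrow> bool" and
  evals :: "prog \<Rightarrow> tree list \<Rightarrow> exp list \<Rightarrow> tree list \<Rightarrow> nat \<Rightarrow> bool"
  for P
where
  eval_Var: "i < length env \<Longrightarrow> eval P env (Var i) (env ! i) 1"
| eval_Nil: "eval P env exp.Nil Leaf 1"
| eval_Cons: "eval P env e1 v1 t1 \<Longrightarrow> eval P env e2 v2 t2 \<Longrightarrow>
    eval P env (exp.Cons e1 e2) (Node v1 v2) (t1 + t2 + 1)"
| eval_Hd: "eval P env e v t \<Longrightarrow> eval P env (Hd e) (head v) (t + 1)"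
| eval_Tl: "eval P env e v t \<Longrightarrow> eval P env (Tl e) (tail v) (t + 1)"
| eval_If_Node: "eval P env c v t1 \<Longrightarrow> v \<noteq> Leaf \<Longrightarrow> eval P env e1 w t2 \<Longrightarrow>
    eval P env (exp.If c e1 e2) w (t1 + t2 + 1)"
| eval_If_Leaf: "eval P env c Leaf t1 \<Longrightarrow> eval P env e2 w t2 \<Longrightarrow>
    eval P env (exp.If c e1 e2) w (t1 + t2 + 1)"
| eval_Let: "eval P env e1 v t1 \<Longrightarrow> eval P (v # env) e2 w t2 \<Longrightarrow>
    eval P env (exp.Let e1 e2) w (t1 + t2 + 1)"
| eval_Call: "f < length P \<Longrightarrow> evals P env es vs t1 \<Longrightarrow> eval P vs (P ! f) w t2 \<Longrightarrow>
    eval P env (Call f es) w (t1 + t2 + 1)"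
| evals_Nil: "evals P env [] [] 0"
| evals_Cons: "eval P env e v t1 \<Longrightarrow> evals P env es vs t2 \<Longrightarrow>
    evals P env (e # es) (v # vs) (t1 + t2)"

inductive_cases eval_VarE: "eval P env (Var i) v t"
  and eval_NilE: "eval P env exp.Nil v t"
  and eval_ConsE: "eval P env (exp.Cons e1 e2) v t"
  and eval_HdE: "eval P env (Hd e) v t"
  and eval_TlE: "eval P env (Tl e) v t"
  and eval_IfE: "eval P env (exp.If c e1 e2) v t"
  and eval_LetE: "eval P env (exp.Let e1 e2) v t"
  and eval_CallE: "eval P env (Call f es) v t"
  and evals_NilE: "evals P env [] vs t"
  and evals_ConsE: "evals P env (e # es) vs t"

definition runs :: "prog \<Rightarrow> tree \<Rightarrow> tree \<Rightarrow> nat \<Rightarrow> bool" where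
  "runs P x y t \<longleftrightarrow> P \<noteq> [] \<and> eval P [x] (P ! 0) y t"

lemma eval_deterministic:
  "eval P env e v t \<Longrightarrow> eval P env e v' t' \<Longrightarrow> v' = v \<and> t' = t"
  "evals P env es vs t \<Longrightarrow> evals P env es vs' t' \<Longrightarrow> vs' = vs \<and> t' = t"
proof (induction arbitrary: v' t' and vs' t' rule: eval_evals.inducts)
  case (eval_Var i env)
  from eval_Var.prems show ?case by (rule eval_VarE) (simp_all)
next
  case (eval_Nil env)
  from eval_Nil.prems show ?case by (rule eval_NilE) (simp_all)
next
  case (eval_Cons env e1 v1 t1 e2 v2 t2)
  from eval_Cons.prems show ?case
    by (rule eval_ConsE) (use eval_Cons.IH in \<open>metis Suc_eq_plus1\<close>)+
next
  case (eval_Hd env e v t)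
  from eval_Hd.prems show ?case
    by (rule eval_HdE) (use eval_Hd.IH in \<open>metis Suc_eq_plus1\<close>)+
next
  case (eval_Tl env e v t)
  from eval_Tl.prems show ?case
    by (rule eval_TlE) (use eval_Tl.IH in \<open>metis Suc_eq_plus1\<close>)+
next
  case (eval_If_Node env c v t1 e1 w t2 e2)
  from eval_If_Node.prems show ?case
    by (rule eval_IfE) (use eval_If_Node in \<open>metis Suc_eq_plus1\<close>)+
next
  case (eval_If_Leaf env c t1 e2 w t2 e1)
  from eval_If_Leaf.prems show ?case
    by (rule eval_IfE) (use eval_If_Leaf.IH in \<open>metis Suc_eq_plus1\<close>)+
next
  case (eval_Let env e1 v t1 e2 w t2)
  from eval_Let.prems show ?case
    by (rule eval_LetE) (use eval_Let.IH in \<open>metis Suc_eq_plus1\<close>)+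
next
  case (eval_Call f env es vs t1 w t2)
  from eval_Call.prems show ?case
    by (rule eval_CallE) (use eval_Call.IH in \<open>metis Suc_eq_plus1\<close>)+
next
  case (evals_Nil env)
  from evals_Nil.prems show ?case by (rule evals_NilE) (simp_all)
next
  case (evals_Cons env e v t1 es vs t2)
  from evals_Cons.prems show ?case
    by (rule evals_ConsE) (use evals_Cons.IH in \<open>metis Suc_eq_plus1\<close>)+
qed

corollary runs_deterministic: "runs P x y t \<Longrightarrow> runs P x y' t' \<Longrightarrow> y' = y \<and> t' = t"
  unfolding runs_def using eval_deterministic(1) by blast


section \<open>Encodings\<close>

fun enc_bool :: "bool \<Rightarrow> tree" where
  "enc_bool True = Node Leaf Leaf"
| "enc_bool False = Leaf"

fun enc_list :: "tree list \<Rightarrow> tree" where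
  "enc_list [] = Leaf"
| "enc_list (x # xs) = Node x (enc_list xs)"

text \<open>Binary, least significant bit first.\<close>

fun enc_nat :: "nat \<Rightarrow> tree" where
  "enc_nat n = (if n = 0 then Leaf else Node (enc_bool (odd n)) (enc_nat (n div 2)))"

declare enc_nat.simps [simp del]

definition enc_int :: "int \<Rightarrow> tree" where
  "enc_int k = Node (enc_bool (k < 0)) (enc_nat (nat \<bar>k\<bar>))"

text \<open>A finite set is represented by a repetition-free list of its elements in any order, an edge
  by the pair of its endpoints in any order. Hence sets have several encodings; an algorithm
  has to cope with all of them. Every tree encodes at most one object of each kind.\<close>

definition encodes_list :: "('a \<Rightarrow> tree \<Rightarrow> bool) \<Rightarrow> 'a list \<Rightarrow> tree \<Rightarrow> bool" where
  "encodes_list R xs x \<longleftrightarrow> (\<exists>ys. list_all2 R xs ys \<and> x = enc_list ys)"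

definition encodes_set :: "('a \<Rightarrow> tree \<Rightarrow> bool) \<Rightarrow> 'a set \<Rightarrow> tree \<Rightarrow> bool" where
  "encodes_set R A x \<longleftrightarrow> (\<exists>xs. distinct xs \<and> set xs = A \<and> encodes_list R xs x)"

definition encodes_vertex :: "nat \<Rightarrow> tree \<Rightarrow> bool" where
  "encodes_vertex v x \<longleftrightarrow> x = enc_nat v"

definition encodes_edge :: "nat set \<Rightarrow> tree \<Rightarrow> bool" where
  "encodes_edge e x \<longleftrightarrow> (\<exists>u v. e = {u, v} \<and> x = Node (enc_nat u) (enc_nat v))"

definition encodes_input ::
  "nat set \<Rightarrow> nat set set \<Rightarrow> nat set \<Rightarrow> int \<Rightarrow> tree \<Rightarrow> bool" where
  "encodes_input V E S k x \<longleftrightarrow>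
     (\<exists>xV xE xS. encodes_set encodes_vertex V xV \<and> encodes_set encodes_edge E xE \<and>
        encodes_set encodes_vertex S xS \<and> x = Node (Node xV xE) (Node xS (enc_int k)))"

text \<open>The list cells of the output sequence are pairwise distinct heap cells, and each of its sets
  has at most \<open>card V\<close> elements; so sharing of subtrees hides at most a factor that is
  polynomial in the input size, compared with writing the output out in full. The size of an
  input, \<open>size x\<close>, is its number of \<open>Node\<close>s.\<close>

definition encodes_output :: "nat set \<Rightarrow> nat set list \<Rightarrow> tree \<Rightarrow> bool" where
  "encodes_output S' Ss y \<longleftrightarrow>
     (\<exists>yS ySs. encodes_set encodes_vertex S' yS \<and>
        encodes_list (encodes_set encodes_vertex) Ss ySs \<and> y = Node yS ySs)"

end

theory Submission
  imports Defs
begin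

text \<open>
  The program splits the graph recursively into maximal proper modules, at most
  \<open>modular_width V E\<close> of them at a time, and computes a maximum independent set \<open>A i\<close> of every
  module \<open>V i\<close>. It then enlarges the current set \<open>S\<close> as long as it can. At a node \<open>W\<close> with parts
  \<open>V i\<close> let \<open>C i = S \<inter> V i\<close> if this is nonempty and \<open>C i = A i\<close> otherwise, and consider the sets
  \<open>(S - W) \<union> (\<Union>i\<in>I. C i)\<close> that are independent and not below the threshold, two of them being
  adjacent if \<open>I\<close> changes by one index. A depth-first search from \<open>I = {i. S \<inter> V i \<noteq> {}}\<close> visits
  at most \<open>2 ^ modular_width V E\<close> states. It improves \<open>S\<close> if it meets a larger set, or a state
  avoiding some \<open>i\<close> with \<open>S \<inter> V i\<close> smaller than \<open>A i\<close> and nonempty: there \<open>C i\<close> can be exchanged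
  for \<open>A i\<close> and the path be walked back.

  If no node admits an improvement, \<open>S\<close> is optimal: along a reconfiguration sequence inside \<open>W\<close> the
  set of parts that are met follows a path of the search, and as long as part \<open>i\<close> has not been
  emptied the sequence restricted to \<open>V i\<close> respects the threshold of the node \<open>V i\<close>, so that it
  never has more than \<open>card (S \<inter> V i)\<close> elements in \<open>V i\<close> by induction.
\<close>

section \<open>Modules\<close>

text \<open>Edges between disjoint modules are all or nothing, so the independence of a union over
  parts depends only on which parts are met, as long as the set inside each part is independent.
  Hence index sets describe all that matters, and \<open>C i\<close> may be replaced by
  \<open>A i\<close> on the way back.

  The obstacle is that tokens gained in one part may be spent in another, so that a part taken alone
  could drop below its threshold. At a stable node this cannot happen before the part has been
  emptied: no visited state exceeds \<open>S\<close>, so the tokens outside \<open>V i\<close> never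
  outnumber those of \<open>S\<close> outside \<open>V i\<close>.

  The bound on the number of parts has two reasons. If the maximal proper modules are disjoint, each
  contains a block of any partition into at least two modules; if two of them overlap, two parts
  suffice.

  The factor \<open>2 ^ modular_width V E\<close> is not squared: visited states lie in a trie,
  stacked paths share their tails, and there are at most \<open>card V\<close> improvements, each
  adding \<open>O(2 ^ modular_width V E)\<close> sets.\<close>

lemma is_module_altdef:
  "is_module V E M \<longleftrightarrow> M \<subseteq> V \<and> (\<forall>v\<in>V - M. \<forall>u\<in>M. \<forall>u'\<in>M. {u, v} \<in> E \<longleftrightarrow> {u', v} \<in> E)"
  unfolding is_module_def by blast

lemma is_moduleD:
  "is_module V E M \<Longrightarrow> v \<in> V \<Longrightarrow> v \<notin> M \<Longrightarrow> u \<in> M \<Longrightarrow> u' \<in> M \<Longrightarrow> {u, v} \<in> E \<longleftrightarrow> {u', v} \<in> E"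
  unfolding is_module_altdef by blast

lemma is_module_subset: "is_module V E M \<Longrightarrow> M \<subseteq> V"
  unfolding is_module_def by blast

lemma is_module_Un:
  assumes "is_module W E A" "is_module W E B" "A \<inter> B \<noteq> {}"
  shows "is_module W E (A \<union> B)"
proof -
  obtain c where "c \<in> A" "c \<in> B" using assms(3) by blast
  then have "{u, v} \<in> E \<longleftrightarrow> {c, v} \<in> E" if "u \<in> A \<union> B" "v \<in> W - (A \<union> B)" for u v
    using that is_moduleD[OF assms(1), of v u c] is_moduleD[OF assms(2), of v u c] by blast
  then show ?thesis
    using is_module_subset[OF assms(1)] is_module_subset[OF assms(2)] unfolding is_module_altdef by blast
qed

text \<open>Only a \<open>v\<close> in the intersection is critical. To the vertices of
  \<open>A - B\<close> it is adjacent like a pivot \<open>b\<close> in \<open>B - A\<close>, because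
  \<open>B\<close> is a module; and \<open>b\<close>, lying outside \<open>A\<close>, cannot tell
  the vertices of \<open>A\<close> apart.\<close>

lemma is_module_Diff:
  assumes "is_module W E A" "is_module W E B" "B - A \<noteq> {}"
  shows "is_module W E (A - B)"
proof -
  obtain b where b: "b \<in> B" "b \<notin> A" using assms(3) by blast
  have AW: "A \<subseteq> W" and BW: "B \<subseteq> W" using assms(1,2) by (auto dest: is_module_subset)
  have "{u, v} \<in> E \<longleftrightarrow> {u', v} \<in> E" if v: "v \<in> W - (A - B)" and u: "u \<in> A - B" "u' \<in> A - B" for u u' v
  proof (cases "v \<in> A")
    case False
    then show ?thesis using is_moduleD[OF assms(1), of v u u'] v u by blast
  next
    case True
    then have "v \<in> B" using v by blast
    have "{v, u} \<in> E \<longleftrightarrow> {b, u} \<in> E" "{v, u'} \<in> E \<longleftrightarrow> {b, u'} \<in> E"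
      using is_moduleD[OF assms(2), of u v b] is_moduleD[OF assms(2), of u' v b] u b \<open>v \<in> B\<close> AW by blast+
    moreover have "{u, b} \<in> E \<longleftrightarrow> {u', b} \<in> E"
      using is_moduleD[OF assms(1), of b u u'] u b BW by blast
    ultimately show ?thesis by (simp add: insert_commute)
  qed
  then show ?thesis using AW unfolding is_module_altdef by blast
qed

lemma is_module_trans:
  assumes "is_module V E W" "is_module W E M"
  shows "is_module V E M"
proof -
  have "{u, v} \<in> E \<longleftrightarrow> {u', v} \<in> E" if "v \<in> V - M" "u \<in> M" "u' \<in> M" for u u' v
    using that is_moduleD[OF assms(1), of v u u'] is_moduleD[OF assms(2), of v u u']
      is_module_subset[OF assms(2)] by blast
  then show ?thesis
    using is_module_subset[OF assms(1)] is_module_subset[OF assms(2)] unfolding is_module_altdef by blast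
qed

lemma is_module_Int:
  assumes "is_module V E M" "U \<subseteq> V"
  shows "is_module U E (M \<inter> U)"
  unfolding is_module_altdef using is_moduleD[OF assms(1)] assms(2) by blast

lemma is_module_induced_edges [simp]: "is_module W (induced_edges E W) M \<longleftrightarrow> is_module W E M"
  unfolding is_module_def induced_edges_def by (auto 4 4)

lemma induced_edges_induced_edges: "U \<subseteq> W \<Longrightarrow> induced_edges (induced_edges E W) U = induced_edges E U"
  unfolding induced_edges_def by blast

section \<open>Modular width\<close>

lemma mw_at_most_induced:
  assumes "mw_at_most k V E" "U \<subseteq> V"
  shows "mw_at_most k U (induced_edges E U)"
  using assms
proof (induction arbitrary: U rule: mw_at_most.induct)
  case (small V E)
  then show ?case
    by (meson card_mono finite_subset mw_at_most.small order.trans)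
next
  case (split V P E)
  \<comment> \<open>Blocks that miss \<open>U\<close> leave the empty set, which a partition may not
    contain.\<close>
  define P' where "P' = (\<lambda>M. M \<inter> U) ` P - {{}}"
  have "\<Union>P' = U" unfolding P'_def using partition_onD1[OF split.hyps(1)] split.prems by blast
  moreover have "disjoint P'"
  proof (rule disjointI)
    fix A B assume "A \<in> P'" "B \<in> P'" "A \<noteq> B"
    then obtain M M' where "A = M \<inter> U" "B = M' \<inter> U" "M \<in> P" "M' \<in> P" "M \<noteq> M'"
      by (auto simp: P'_def)
    moreover from this have "M \<inter> M' = {}"
      using partition_onD2[OF split.hyps(1)] by (simp add: disjointD)
    ultimately show "A \<inter> B = {}" by blast
  qed
  ultimately have "partition_on U P'" unfolding partition_on_def by (simp add: P'_def)
  moreover have "finite P'" "card P' \<le> k"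
  proof -
    show "finite P'" using split.hyps(2) by (simp add: P'_def)
    have "card P' \<le> card ((\<lambda>M. M \<inter> U) ` P)"
      unfolding P'_def using split.hyps(2) by (intro card_mono) auto
    also have "\<dots> \<le> card P" using split.hyps(2) by (rule card_image_le)
    finally show "card P' \<le> k" using split.hyps(3) by simp
  qed
  moreover have "is_module U (induced_edges E U) M'" if "M' \<in> P'" for M'
    using that by (auto simp: P'_def intro!: is_module_Int split.hyps(4) subsetD[OF split.prems])
  moreover have "mw_at_most k M' (induced_edges (induced_edges E U) M')" if M': "M' \<in> P'" for M'
  proof -
    obtain M where M: "M \<in> P" "M' = M \<inter> U" using M' unfolding P'_def by blast
    show ?thesis using split.IH[OF M(1), of M'] by (simp add: M(2) induced_edges_induced_edges)
  qed
  ultimately show ?case by (rule mw_at_most.split)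
qed

text \<open>A derivation may use the trivial partition into one block. Following such steps down the
  derivation ends at a split into at least two blocks or at the small case, where the singletons
  serve.\<close>

lemma mw_at_most_partition:
  assumes "mw_at_most k W E" "card W \<ge> 2"
  shows "\<exists>P. partition_on W P \<and> finite P \<and> 2 \<le> card P \<and> card P \<le> k \<and> (\<forall>M\<in>P. is_module W E M)"
  using assms
proof (induction rule: mw_at_most.induct)
  case (small V E)
  let ?P = "(\<lambda>v. {v}) ` V"
  have "card ?P = card V" by (simp add: card_image)
  moreover have "partition_on V ?P" unfolding partition_on_def disjoint_def by auto
  ultimately show ?case using small by (intro exI[of _ ?P]) (auto simp: is_module_def)
next
  case (split V P E)
  show ?case
  proof (cases "card P \<ge> 2")
    case True
    then show ?thesis using split by blast
  next
    case False
    have V: "\<Union>P = V" "V \<noteq> {}" using split by (auto simp: partition_on_def)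
    then have "P \<noteq> {}" by auto
    with False split.hyps(2) have "card P = 1"
      by (metis One_nat_def Suc_1 card_0_eq le_antisym not_less_eq_eq not_less_zero less_one not_le)
    then obtain M where "P = {M}" by (auto simp: card_1_singleton_iff)
    with V have "V \<in> P" by simp
    then show ?thesis using split.IH[of V] split.prems by simp
  qed
qed

lemma mw_at_most_modular_width: "finite V \<Longrightarrow> mw_at_most (modular_width V E) V E"
  unfolding modular_width_def by (rule LeastI[of _ "card V"]) (simp add: mw_at_most.small)

section \<open>Maximal modules by closure\<close>

text \<open>Such a vertex distinguishes two vertices of \<open>M\<close> and therefore belongs to
  every module that contains \<open>M\<close>.\<close>

definition splitters :: "'a set set \<Rightarrow> 'a list \<Rightarrow> 'a list \<Rightarrow> 'a list" where
  "splitters E C M = filter (\<lambda>w. \<not> (\<forall>y\<in>set M. {w, y} \<notin> E) \<and> \<not> (\<forall>y\<in>set M. {w, y} \<in> E)) C"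

text \<open>The number is fuel: every round before the fixed point adds a vertex, so
  \<open>length W\<close> rounds reach the least module above \<open>M\<close>.\<close>

fun clos :: "'a set set \<Rightarrow> nat \<Rightarrow> 'a list \<Rightarrow> 'a list \<Rightarrow> 'a list" where
  "clos E 0 W M = M"
| "clos E (Suc n) W M = clos E n W (splitters E (filter (\<lambda>w. w \<notin> set M) W) M @ M)"

fun grow :: "'a set set \<Rightarrow> 'a list \<Rightarrow> 'a list \<Rightarrow> 'a list \<Rightarrow> 'a list" where
  "grow E W [] M = M"
| "grow E W (c # C) M =
    (if c \<in> set M then grow E W C M
     else let X = clos E (length W) W (c # M) in
       if set W \<subseteq> set X then grow E W C M else grow E W C X)"

text \<open>A part is what the list \<open>R\<close> still contains of the module grown from its
  first vertex. Intersecting with \<open>R\<close> matters when the grown modules overlap.\<close>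

fun parts :: "'a set set \<Rightarrow> 'a list \<Rightarrow> 'a list \<Rightarrow> 'a list list" where
  "parts E W [] = []"
| "parts E W (u # R) =
    (u # filter (\<lambda>v. v \<in> set (grow E W W [u])) R) #
      parts E W (filter (\<lambda>v. v \<notin> set (grow E W W [u])) R)"

lemma splitters_Nil_iff:
  assumes "set M \<subseteq> set W"
  shows "splitters E (filter (\<lambda>w. w \<notin> set M) W) M = [] \<longleftrightarrow> is_module (set W) E (set M)"
  using assms unfolding splitters_def is_module_def by (auto simp: filter_empty_conv insert_commute)

lemma distinct_step:
  "distinct M \<Longrightarrow> distinct W \<Longrightarrow> distinct (splitters E (filter (\<lambda>w. w \<notin> set M) W) M @ M)"
  unfolding splitters_def by auto

lemma clos_mono: "set M \<subseteq> set (clos E n W M)"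
  by (induction n arbitrary: M) (auto, fastforce)

lemma clos_distinct: "distinct M \<Longrightarrow> distinct W \<Longrightarrow> distinct (clos E n W M)"
  by (induction n arbitrary: M) (simp_all add: distinct_step del: distinct_append)

lemma clos_subset: "set M \<subseteq> set W \<Longrightarrow> set (clos E n W M) \<subseteq> set W"
  by (induction n arbitrary: M) (auto simp: splitters_def)

lemma clos_least:
  "set M \<subseteq> X \<Longrightarrow> is_module (set W) E X \<Longrightarrow> set (clos E n W M) \<subseteq> X"
proof (induction n arbitrary: M)
  case (Suc n)
  have "w \<in> X" if "w \<in> set (splitters E (filter (\<lambda>w. w \<notin> set M) W) M)" for w
  proof (rule ccontr)
    assume "w \<notin> X"
    have "w \<in> set W" "\<exists>y\<in>set M. {w, y} \<in> E" "\<exists>y\<in>set M. {w, y} \<notin> E"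
      using that by (auto simp: splitters_def)
    then obtain y y' where y: "y \<in> set M" "{w, y} \<in> E" "y' \<in> set M" "{w, y'} \<notin> E" "w \<in> set W"
      by blast
    then show False
      using is_moduleD[OF Suc.prems(2), of w y y'] \<open>w \<notin> X\<close> Suc.prems(1) by (auto simp: insert_commute)
  qed
  then have "set (splitters E (filter (\<lambda>w. w \<notin> set M) W) M @ M) \<subseteq> X" using Suc.prems(1) by auto
  from Suc.IH[OF this Suc.prems(2)] show ?case by simp
qed simp

lemma clos_fixed: "splitters E (filter (\<lambda>w. w \<notin> set M) W) M = [] \<Longrightarrow> clos E n W M = M"
  by (induction n) auto

lemma clos_module:
  "set M \<subseteq> set W \<Longrightarrow> distinct W \<Longrightarrow> distinct M \<Longrightarrow> length W \<le> n + length M \<Longrightarrow>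
    is_module (set W) E (set (clos E n W M))"
proof (induction n arbitrary: M)
  \<comment> \<open>Without fuel, \<open>M\<close> has at least as many elements as
    \<open>W\<close>, and \<open>W\<close> itself is a module.\<close>
  case 0
  then have "set M = set W"
    by (metis add_0 card_mono card_subset_eq distinct_card finite_set le_antisym clos.simps(1))
  then show ?case by (simp add: is_module_def)
next
  case (Suc n)
  show ?case
  proof (cases "splitters E (filter (\<lambda>w. w \<notin> set M) W) M = []")
    case True
    then show ?thesis using Suc.prems splitters_Nil_iff clos_fixed by (metis)
  next
    case False
    then have "length (splitters E (filter (\<lambda>w. w \<notin> set M) W) M) \<ge> 1"
      by (metis One_nat_def Suc_leI length_greater_0_conv)
    then show ?thesis
      unfolding clos.simps using Suc.prems distinct_step[OF Suc.prems(3,2)]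
      by (intro Suc.IH) (auto simp: splitters_def)
  qed
qed

lemma clos_Cons_module:
  assumes "set (c # M) \<subseteq> set W" "distinct W" "distinct M" "c \<notin> set M"
  shows "is_module (set W) E (set (clos E (length W) W (c # M)))"
  using assms by (intro clos_module) auto

text \<open>A rejection is final: if the closure of \<open>c # M\<close> is all of \<open>W\<close>,
  no proper module contains \<open>c\<close> together with \<open>M\<close>, let alone together with
  a later, larger set. Hence one pass over the candidates reaches a maximal proper module.\<close>

lemma grow_properties:
  assumes "distinct W" "set C \<subseteq> set W" "distinct M" "is_module (set W) E (set M)" "set M \<noteq> set W"
  shows "set M \<subseteq> set (grow E W C M) \<and> distinct (grow E W C M) \<and>
    is_module (set W) E (set (grow E W C M)) \<and> set (grow E W C M) \<noteq> set W \<and>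
    (\<forall>Y. is_module (set W) E Y \<longrightarrow> Y \<noteq> set W \<longrightarrow> set (grow E W C M) \<subseteq> Y \<longrightarrow>
       Y \<inter> set C \<subseteq> set (grow E W C M))"
  using assms(2-5)
proof (induction C arbitrary: M)
  case (Cons c C)
  have MW: "set M \<subseteq> set W" using Cons.prems is_module_subset by blast
  let ?X = "clos E (length W) W (c # M)"
  consider "c \<in> set M" | "c \<notin> set M" "set W \<subseteq> set ?X" | "c \<notin> set M" "\<not> set W \<subseteq> set ?X" by blast
  then show ?case
  proof cases
    case 1
    then show ?thesis using Cons.IH[of M] Cons.prems by auto
  next
    case 2
    have IH: "set M \<subseteq> set (grow E W C M)" using Cons.IH[of M] Cons.prems by auto
    have "c \<notin> Y" if "is_module (set W) E Y" "Y \<noteq> set W" "set (grow E W C M) \<subseteq> Y" for Y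
    proof
      assume "c \<in> Y"
      then have "set ?X \<subseteq> Y" using that IH by (intro clos_least) auto
      then show False using 2 that is_module_subset by blast
    qed
    then show ?thesis using 2 Cons.IH[of M] Cons.prems by auto
  next
    case 3
    have X: "distinct ?X" "is_module (set W) E (set ?X)" "set (c # M) \<subseteq> set ?X"
      using Cons.prems 3 assms(1) MW clos_mono[of "c # M" E "length W" W]
      by (auto intro!: clos_distinct clos_Cons_module)
    show ?thesis using 3 Cons.IH[of ?X] X Cons.prems(1) by (auto simp: Let_def)
  qed
qed auto

section \<open>The decomposition into modules\<close>

text \<open>\<open>M\<close> chooses one maximal proper module for every vertex. The choice need not
  be unique, and \<open>M u\<close> and \<open>M v\<close> may overlap without being equal.\<close>

locale max_modules =
  fixes W :: "'a set" and E :: "'a set set" and M :: "'a \<Rightarrow> 'a set"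
  assumes mem: "u \<in> W \<Longrightarrow> u \<in> M u"
    and module: "u \<in> W \<Longrightarrow> is_module W E (M u)"
    and proper: "u \<in> W \<Longrightarrow> M u \<noteq> W"
    and maximal: "u \<in> W \<Longrightarrow> is_module W E Y \<Longrightarrow> Y \<noteq> W \<Longrightarrow> M u \<subseteq> Y \<Longrightarrow> Y = M u"
begin

text \<open>The union is a module strictly above \<open>M u\<close>, so maximality makes it
  everything. This is the degenerate case of modular decomposition: \<open>M u\<close> and its
  complement are joined by all edges or by none, so the graph on \<open>W\<close> or its complement
  graph is disconnected.\<close>

lemma overlap_Un:
  assumes "u \<in> W" "is_module W E B" "B \<noteq> W" "M u \<inter> B \<noteq> {}" "\<not> B \<subseteq> M u"
  shows "M u \<union> B = W" and "is_module W E (W - M u)"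
proof -
  show eq: "M u \<union> B = W"
    using maximal[OF assms(1) is_module_Un[OF module[OF assms(1)] assms(2,4)]] assms(5) by blast
  have BW: "B \<subseteq> W" using assms(2) by (rule is_module_subset)
  have "M u - B \<noteq> {}" using eq assms(3) BW by blast
  then have "is_module W E (B - M u)" using is_module_Diff assms(2) module[OF assms(1)] by blast
  moreover have "B - M u = W - M u" using eq BW by blast
  ultimately show "is_module W E (W - M u)" by simp
qed

lemma subset_eq: "u \<in> W \<Longrightarrow> v \<in> W \<Longrightarrow> M u \<subseteq> M v \<Longrightarrow> M u = M v"
  using maximal module proper by blast

text \<open>Degeneracy does not depend on the vertex: unless \<open>M c\<close> equals
  \<open>M a\<close>, it is the complement of \<open>M a\<close> or overlaps \<open>M a\<close>, and
  then \<open>overlap_Un\<close> applies.\<close>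

lemma compl_module:
  assumes "a \<in> W" "is_module W E (W - M a)" "c \<in> W"
  shows "is_module W E (W - M c)"
proof (cases "M c = M a")
  case False
  show ?thesis
  proof (cases "M c \<inter> M a = {}")
    case True
    have "M c \<subseteq> W - M a" using True is_module_subset[OF module[OF assms(3)]] by blast
    moreover have "W - M a \<noteq> W" using mem[OF assms(1)] assms(1) by blast
    ultimately have "W - M a = M c" using maximal[OF assms(3) assms(2)] by blast
    then have "W - M c = M a" using is_module_subset[OF module[OF assms(1)]] by blast
    then show ?thesis using module[OF assms(1)] by simp
  next
    case ov: False
    show ?thesis
      using overlap_Un(2)[OF assms(3) module[OF assms(1)] proper[OF assms(1)] ov]
        subset_eq[OF assms(1,3)] False by blast
  qed
qed (use assms in simp)

text \<open>The reason why two parts suffice in the degenerate case: \<open>M v\<close> is either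
  the complement of \<open>M u\<close> or covers \<open>W\<close> together with
  \<open>M u\<close>.\<close>

lemma covers_complement:
  assumes "u \<in> W" "is_module W E (W - M u)" "v \<in> W - M u"
  shows "W - M u \<subseteq> M v"
proof (cases "M v \<inter> M u = {}")
  case True
  then have "M v \<subseteq> W - M u" using is_module_subset[OF module] assms by blast
  moreover have "W - M u \<noteq> W" using mem[OF assms(1)] assms(1) by blast
  ultimately show ?thesis using maximal[of v, OF _ assms(2)] assms by blast
next
  case False
  have "M v \<noteq> M u" using mem assms by blast
  then have "\<not> M u \<subseteq> M v" using subset_eq assms by blast
  then have "M v \<union> M u = W"
    using overlap_Un(1)[of v "M u"] assms False module proper by blast
  then show ?thesis by blast
qed

end

lemma max_modules_grow:
  assumes "distinct W" "length W \<ge> 2"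
  shows "max_modules (set W) E (\<lambda>u. set (grow E W W [u]))"
proof
  fix u Y assume u: "u \<in> set W"
  have "set [u] \<noteq> set W" using assms by (metis distinct_card distinct_singleton list.size(3,4) One_nat_def add_0 not_less_eq_eq Suc_1 le_refl)
  then have g: "u \<in> set (grow E W W [u])" "is_module (set W) E (set (grow E W W [u]))"
      "set (grow E W W [u]) \<noteq> set W"
      "\<And>Y. is_module (set W) E Y \<Longrightarrow> Y \<noteq> set W \<Longrightarrow> set (grow E W W [u]) \<subseteq> Y \<Longrightarrow>
        Y \<inter> set W \<subseteq> set (grow E W W [u])"
    using grow_properties[of W W "[u]" E] assms u by (auto simp: is_module_def)
  show "u \<in> set (grow E W W [u])" "is_module (set W) E (set (grow E W W [u]))"
      "set (grow E W W [u]) \<noteq> set W" by (fact g)+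
  show "Y = set (grow E W W [u])"
    if "is_module (set W) E Y" "Y \<noteq> set W" "set (grow E W W [u]) \<subseteq> Y"
    using g(4)[OF that] that is_module_subset[OF that(1)] by blast
qed

lemma parts_basic:
  "set (concat (parts E W R)) = set R"
  "distinct R \<Longrightarrow> distinct (concat (parts E W R))"
  "[] \<notin> set (parts E W R)"
  by (induction E W R rule: parts.induct) auto

text \<open>When the modules form a partition, the remaining list is always a union of whole
  classes, so nothing of a class is missing at its turn.\<close>

lemma parts_classes:
  assumes "max_modules (set W) E (\<lambda>u. set (grow E W W [u]))"
    and "\<And>u v. u \<in> set W \<Longrightarrow> v \<in> set W \<Longrightarrow> v \<in> set (grow E W W [u]) \<Longrightarrow>
      set (grow E W W [v]) = set (grow E W W [u])"
    and "set R \<subseteq> set W" "\<And>u. u \<in> set R \<Longrightarrow> set (grow E W W [u]) \<subseteq> set R"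
    and "P \<in> set (parts E W R)"
  shows "\<exists>u\<in>set P. set P = set (grow E W W [u])"
  using assms(3-)
proof (induction "length R" arbitrary: R rule: less_induct)
  case less
  interpret max_modules "set W" E "\<lambda>u. set (grow E W W [u])" by fact
  show ?case
  proof (cases R)
    case (Cons u R')
    let ?X = "set (grow E W W [u])"
    have u: "u \<in> set W" "?X \<subseteq> insert u (set R')" "u \<in> ?X"
      using less.prems(1) less.prems(2)[of u] mem[of u] Cons by auto
    show ?thesis
    proof (cases "P = u # filter (\<lambda>v. v \<in> ?X) R'")
      case True
      then show ?thesis using u by (intro bexI[of _ u]) auto
    next
      case False
      have cl: "set (grow E W W [w]) \<subseteq> set (filter (\<lambda>v. v \<notin> ?X) R')"
        if w: "w \<in> set (filter (\<lambda>v. v \<notin> ?X) R')" for w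
      proof
        fix z assume z: "z \<in> set (grow E W W [w])"
        have wW: "w \<in> set W" and sub: "set (grow E W W [w]) \<subseteq> insert u (set R')"
          using w less.prems(1) less.prems(2)[of w] Cons by auto
        have zW: "z \<in> set W" using z is_module_subset[OF module[OF wW]] by blast
        have "z \<notin> ?X"
        proof
          assume "z \<in> ?X"
          then have "?X = set (grow E W W [w])" using assms(2)[OF u(1) zW] assms(2)[OF wW zW z] by simp
          then show False using mem[OF wW] w by simp
        qed
        then show "z \<in> set (filter (\<lambda>v. v \<notin> ?X) R')" using z sub u(3) by auto
      qed
      show ?thesis
        using less.hyps[of "filter (\<lambda>v. v \<notin> ?X) R'"] less.prems(1,3) False Cons cl
        by (auto simp: le_imp_less_Suc)
    qed
  qed (use less in simp)
qed

lemma parts_correct: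
  assumes W: "distinct W" "length W \<ge> 2" and mw: "mw_at_most k (set W) (induced_edges E (set W))"
  shows "\<forall>P\<in>set (parts E W W). is_module (set W) E (set P)"
    and "2 \<le> length (parts E W W)" and "length (parts E W W) \<le> k"
proof -
  let ?M = "\<lambda>u. set (grow E W W [u])"
  interpret max_modules "set W" E ?M using W by (rule max_modules_grow)
  obtain Q where Q: "partition_on (set W) Q" "finite Q" "2 \<le> card Q" "card Q \<le> k"
      and Qm: "\<And>X. X \<in> Q \<Longrightarrow> is_module (set W) E X"
    using mw_at_most_partition[OF mw] W by (auto simp: distinct_card)
  obtain u R where WR: "W = u # R" using W by (cases W) auto
  then have uW: "u \<in> set W" by simp
  have "(\<forall>P\<in>set (parts E W W). is_module (set W) E (set P)) \<and> 2 \<le> length (parts E W W) \<and>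
    length (parts E W W) \<le> k"
  proof (cases "is_module (set W) E (set W - ?M u)")
    \<comment> \<open>Degenerate case: the second round absorbs everything the first one left. The
      two resulting parts stay within \<open>k\<close> because \<open>Q\<close> already has two
      blocks.\<close>
    case True
    let ?R = "filter (\<lambda>v. v \<notin> ?M u) R"
    have R: "set ?R = set W - ?M u" using mem[OF uW] by (auto simp: WR)
    have P1: "set (u # filter (\<lambda>v. v \<in> ?M u) R) = ?M u"
      using mem[OF uW] is_module_subset[OF module[OF uW]] by (auto simp: WR)
    have "set W - ?M u \<noteq> {}" using proper[OF uW] is_module_subset[OF module[OF uW]] by blast
    then have "set ?R \<noteq> {}" by (simp only: R) simp
    then obtain v R2 where vR: "?R = v # R2" by (cases ?R) auto
    have v: "v \<in> set W - ?M u" using R vR by auto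
    have "set ?R \<subseteq> ?M v" using covers_complement[OF uW True v] R by simp
    then have f: "filter (\<lambda>w. w \<in> ?M v) R2 = R2" "filter (\<lambda>w. w \<notin> ?M v) R2 = []"
      using vR by (auto simp: filter_id_conv filter_empty_conv)
    have "parts E W W = [u # filter (\<lambda>v. v \<in> ?M u) R, ?R]"
      using f vR by (subst WR, subst parts.simps) (simp add: WR)
    moreover have "is_module (set W) E (set ?R)" using True R by simp
    ultimately show ?thesis using Q(3,4) P1 module[OF uW] by auto
  next
    case False
    \<comment> \<open>Two different modules meeting in \<open>v\<close> would overlap, which makes
      the complement of \<open>?M a\<close>, and hence that of \<open>?M u\<close>, a
      module.\<close>
    have classes: "?M v = ?M a" if "a \<in> set W" "v \<in> set W" "v \<in> ?M a" for a v
    proof (rule ccontr)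
      assume ne: "?M v \<noteq> ?M a"
      have "is_module (set W) E (set W - ?M a)"
        using overlap_Un(2)[of a "?M v"] that ne mem module proper subset_eq by blast
      then show False using compl_module[OF that(1) _ uW] False by blast
    qed
    have P: "\<exists>u\<in>set P. set P = ?M u" if "P \<in> set (parts E W W)" for P
      using parts_classes[OF max_modules_axioms classes] that is_module_subset[OF module] by blast
    have Psub: "set P \<subseteq> set W" if "P \<in> set (parts E W W)" for P
      using that parts_basic(1)[of E W W] by auto
    have mod: "is_module (set W) E (set P)" "set P \<noteq> set W" if "P \<in> set (parts E W W)" for P
      using P[OF that] Psub[OF that] module proper by fastforce+
    have len2: "2 \<le> length (parts E W W)"
    proof (rule ccontr)
      assume "\<not> ?thesis"
      moreover have "parts E W W \<noteq> []" by (simp add: WR)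
      ultimately obtain P where "parts E W W = [P]" by (cases "parts E W W" rule: remdups_adj.cases) auto
      then show False using mod(2)[of P] parts_basic(1)[of E W W] by simp
    qed
    have dist: "distinct (map set (parts E W W))"
    proof -
      have d: "distinct (concat (parts E W W))" using parts_basic(2) W(1) by blast
      show ?thesis
        unfolding distinct_map
      proof
        show "distinct (parts E W W)"
          using d parts_basic(3)[of E W W] by (simp add: distinct_concat_iff removeAll_id)
        show "inj_on set (set (parts E W W))"
        proof (rule inj_onI, rule ccontr)
          fix P P' assume "P \<in> set (parts E W W)" "P' \<in> set (parts E W W)" "set P = set P'" "P \<noteq> P'"
          then show False using d parts_basic(3)[of E W W] unfolding distinct_concat_iff by (metis Int_absorb set_empty2)
        qed
      qed
    qed
    have "length (parts E W W) = card (set ` set (parts E W W))"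
      using distinct_card[OF dist] by simp
    \<comment> \<open>Each class contains a block of \<open>Q\<close>: the block of \<open>a\<close>
      cannot stick out of \<open>?M a\<close>, since such an overlap would be degenerate. Classes
      are disjoint, so they contain different blocks.\<close>
    also have "\<dots> \<le> card Q"
    proof -
      have "\<exists>f. \<forall>X\<in>set ` set (parts E W W). f X \<in> Q \<and> f X \<inter> X \<noteq> {} \<and> f X \<subseteq> X"
      proof (rule bchoice, rule ballI)
        fix X assume "X \<in> set ` set (parts E W W)"
        then obtain a where a: "a \<in> X" "X = ?M a" "a \<in> set W" using P Psub by fastforce
        then obtain q where q: "q \<in> Q" "a \<in> q" using partition_onD1[OF Q(1)] by blast
        have "q \<noteq> set W"
        proof
          assume "q = set W"
          have "q' = q" if "q' \<in> Q" for q'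
          proof (rule ccontr)
            assume "q' \<noteq> q"
            then have "q' \<inter> q = {}" using partition_onD2[OF Q(1)] that q(1) by (simp add: disjointD)
            moreover have "q' \<subseteq> q" using partition_onD1[OF Q(1)] that \<open>q = set W\<close> by blast
            ultimately show False using partition_onD3[OF Q(1)] that by (metis inf.absorb1)
          qed
          then have "Q = {q}" using q(1) by blast
          then show False using Q(3) by simp
        qed
        moreover have "\<not> is_module (set W) E (set W - ?M a)"
          using compl_module[OF a(3) _ uW] False by blast
        ultimately have "q \<subseteq> ?M a"
          using overlap_Un(2)[OF a(3) Qm[OF q(1)]] mem[OF a(3)] q by blast
        then show "\<exists>q. q \<in> Q \<and> q \<inter> X \<noteq> {} \<and> q \<subseteq> X" using q a by blast
      qed
      then obtain f where "\<forall>X\<in>set ` set (parts E W W). f X \<in> Q \<and> f X \<inter> X \<noteq> {} \<and> f X \<subseteq> X" ..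
      note f = this[rule_format]
      have disj: "X = Y" if XY: "X \<in> set ` set (parts E W W)" "Y \<in> set ` set (parts E W W)" "f X = f Y" for X Y
      proof -
        obtain z where z: "z \<in> X" "z \<in> Y" using f[OF XY(1)] f[OF XY(2)] XY(3) by blast
        have "\<exists>a\<in>set W. X = ?M a" if "X \<in> set ` set (parts E W W)" for X
          using that P Psub by fastforce
        then obtain a b where ab: "X = ?M a" "Y = ?M b" "a \<in> set W" "b \<in> set W"
          using XY(1,2) by meson
        have "z \<in> set W" using z(1) ab(1) is_module_subset[OF module[OF ab(3)]] by blast
        then show ?thesis using classes[OF ab(3), of z] classes[OF ab(4), of z] z ab(1,2) by metis
      qed
      show ?thesis
      proof (rule card_inj_on_le[OF _ _ Q(2)])
        show "inj_on f (set ` set (parts E W W))" by (rule inj_onI) (rule disj)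
        show "f ` set ` set (parts E W W) \<subseteq> Q" using f by blast
      qed
    qed
    finally show ?thesis using mod len2 Q(4) by auto
  qed
  then show "\<forall>P\<in>set (parts E W W). is_module (set W) E (set P)"
    and "2 \<le> length (parts E W W)" and "length (parts E W W) \<le> k" by auto
qed

section \<open>Reconfiguration by inclusion-comparable sets\<close>

definition indep :: "'a set set \<Rightarrow> 'a set \<Rightarrow> bool" where
  "indep E X \<longleftrightarrow> (\<forall>u\<in>X. \<forall>v\<in>X. {u, v} \<notin> E)"

lemma independent_set_iff: "independent_set V E X \<longleftrightarrow> X \<subseteq> V \<and> indep E X"
  unfolding independent_set_def indep_def ..

lemma indep_subset: "indep E Y \<Longrightarrow> X \<subseteq> Y \<Longrightarrow> indep E X"
  unfolding indep_def by blast

text \<open>The search records only sets comparable with their predecessors, latest first; \<open>interp\<close> inserts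
  the single steps in between.\<close>

definition coarse_set :: "'a set \<Rightarrow> 'a set set \<Rightarrow> nat \<Rightarrow> 'a list \<Rightarrow> bool" where
  "coarse_set V E kk X \<longleftrightarrow> distinct X \<and> set X \<subseteq> V \<and> indep E (set X) \<and> kk \<le> length X"

definition coarse :: "'a set \<Rightarrow> 'a set set \<Rightarrow> nat \<Rightarrow> 'a list \<Rightarrow> 'a list list \<Rightarrow> bool" where
  "coarse V E kk S acc \<longleftrightarrow> acc \<noteq> [] \<and> last acc = S \<and> (\<forall>X\<in>set acc. coarse_set V E kk X) \<and>
     successively (\<lambda>X Y. set X \<subseteq> set Y \<or> set Y \<subseteq> set X) acc"

fun downs :: "'a list \<Rightarrow> 'a list \<Rightarrow> 'a list list \<Rightarrow> 'a list list" where
  "downs B [] out = B # out"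
| "downs B (d # D) out = (B @ d # D) # downs B D out"

fun ups :: "'a list \<Rightarrow> 'a list \<Rightarrow> 'a list list \<Rightarrow> 'a list list" where
  "ups B [] out = B # out"
| "ups B (d # D) out = ups B D ((B @ d # D) # out)"

text \<open>\<open>B\<close> equals \<open>X\<close> or \<open>Y\<close> as a set, these being
  comparable, so passing through it never falls below the threshold; one of the two phases is
  trivial. The latest set comes first in the argument, hence the result is built from its
  end.\<close>

fun interp :: "'a list list \<Rightarrow> 'a list list \<Rightarrow> 'a list list" where
  "interp (X # Y # acc) out =
     (let B = filter (\<lambda>x. x \<in> set Y) X in
      interp (Y # acc)
        (downs B (filter (\<lambda>x. x \<notin> set X) Y) (ups B (filter (\<lambda>x. x \<notin> set Y) X) out)))"
| "interp acc out = out"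

lemma tar_sequence_Cons:
  "tar_sequence V E k X T Xs \<Longrightarrow> tar_step k Y X \<Longrightarrow> independent_set V E Y \<Longrightarrow>
    tar_sequence V E k Y T (Y # Xs)"
  unfolding tar_sequence_def by (cases Xs) auto

lemma tar_step_list:
  assumes "distinct X" "distinct Y" "k \<le> int (length X)" "k \<le> int (length Y)"
    "card (sym_diff (set X) (set Y)) \<le> 1"
  shows "tar_step k (set X) (set Y)"
  using assms by (simp add: tar_step_def distinct_card min_def)

lemma ups_correct:
  assumes "distinct (B @ D)" "set (B @ D) \<subseteq> V" "indep E (set (B @ D))" "k \<le> int (length B)"
    and "tar_sequence V E k H T (map set out)" "tar_step k (set (B @ D)) H" "\<forall>X\<in>set out. distinct X"
  shows "tar_sequence V E k (set B) T (map set (ups B D out)) \<and> (\<forall>X\<in>set (ups B D out). distinct X)"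
  using assms
proof (induction D arbitrary: out H)
  case Nil
  then show ?case by (auto intro!: tar_sequence_Cons simp: independent_set_iff)
next
  case (Cons d D)
  have "sym_diff (set (B @ D)) (set (B @ d # D)) = {d}" using Cons.prems(1) by auto
  then have "tar_step k (set (B @ D)) (set (B @ d # D))"
    using Cons.prems(1,4) by (intro tar_step_list) (auto simp del: set_append)
  moreover have "tar_sequence V E k (set (B @ d # D)) T (map set ((B @ d # D) # out))"
    unfolding list.map using Cons.prems by (intro tar_sequence_Cons) (auto simp: independent_set_iff)
  ultimately show ?case
    unfolding ups.simps using Cons.prems
    by (intro Cons.IH[of "set (B @ d # D)"]) (auto intro: indep_subset)
qed

lemma downs_correct:
  assumes "distinct (B @ D)" "set (B @ D) \<subseteq> V" "indep E (set (B @ D))" "k \<le> int (length B)"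
    and "tar_sequence V E k H T (map set out)" "tar_step k (set B) H" "\<forall>X\<in>set out. distinct X"
  shows "tar_sequence V E k (set (B @ D)) T (map set (downs B D out)) \<and>
    (\<forall>X\<in>set (downs B D out). distinct X)"
  using assms(1-3)
proof (induction D)
  case Nil
  then show ?case using assms(4-) by (auto intro!: tar_sequence_Cons simp: independent_set_iff)
next
  case (Cons d D)
  have IH: "tar_sequence V E k (set (B @ D)) T (map set (downs B D out)) \<and>
      (\<forall>X\<in>set (downs B D out). distinct X)"
    using Cons.prems by (intro Cons.IH) (auto intro: indep_subset)
  have "sym_diff (set (B @ d # D)) (set (B @ D)) = {d}" using Cons.prems(1) by auto
  then have "tar_step k (set (B @ d # D)) (set (B @ D))"
    using Cons.prems(1) assms(4) by (intro tar_step_list) (auto simp del: set_append)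
  then show ?case
    unfolding downs.simps list.map using IH Cons.prems
    by (auto intro!: tar_sequence_Cons simp: independent_set_iff simp del: set_append)
qed

lemma tar_step_refl: "k \<le> int (card X) \<Longrightarrow> tar_step k X X"
  by (simp add: tar_step_def)

lemma interp_correct:
  assumes "coarse V E kk S acc" "k \<le> int kk"
    and "tar_sequence V E k (set (hd acc)) T (map set out)" "\<forall>X\<in>set out. distinct X"
  shows "tar_sequence V E k (set S) T (map set (interp acc out)) \<and> (\<forall>X\<in>set (interp acc out). distinct X)"
  using assms
proof (induction acc out rule: interp.induct)
  case (1 X Y acc out)
  let ?B = "filter (\<lambda>x. x \<in> set Y) X"
  let ?D1 = "filter (\<lambda>x. x \<notin> set X) Y" and ?D2 = "filter (\<lambda>x. x \<notin> set Y) X"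
  have X: "coarse_set V E kk X" and Y: "coarse_set V E kk Y"
    and cmp: "set X \<subseteq> set Y \<or> set Y \<subseteq> set X" and rest: "coarse V E kk S (Y # acc)"
    using 1(2) by (auto simp: coarse_def)
  have sX: "set (?B @ ?D2) = set X" and sY: "set (?B @ ?D1) = set Y" by auto
  have "length ?B = length X \<or> length ?B = length Y"
    using cmp
  proof
    assume "set X \<subseteq> set Y"
    then have "?B = X" by (auto simp: filter_id_conv)
    then show ?thesis by simp
  next
    assume "set Y \<subseteq> set X"
    then have "set ?B = set Y" by auto
    then show ?thesis using X Y by (metis coarse_set_def distinct_card distinct_filter)
  qed
  then have kB: "k \<le> int (length ?B)" using X Y 1(3) by (auto simp: coarse_set_def)
  have kX: "k \<le> int (card (set X))" using X 1(3) by (auto simp: coarse_set_def distinct_card)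
  have stepX: "tar_step k (set (?B @ ?D2)) (set X)" unfolding sX by (rule tar_step_refl[OF kX])
  have dX: "distinct (?B @ ?D2)" and dY: "distinct (?B @ ?D1)" using X Y by (auto simp: coarse_set_def)
  have vX: "set (?B @ ?D2) \<subseteq> V" "indep E (set (?B @ ?D2))"
    unfolding sX using X by (auto simp: coarse_set_def)
  have vY: "set (?B @ ?D1) \<subseteq> V" "indep E (set (?B @ ?D1))"
    unfolding sY using Y by (auto simp: coarse_set_def)
  note u = ups_correct[OF dX vX kB 1(4)[unfolded list.sel] stepX 1(5)]
  have "k \<le> int (card (set ?B))" using kB dX distinct_card[of ?B] by simp
  then have stepB: "tar_step k (set ?B) (set ?B)" by (rule tar_step_refl)
  note d = downs_correct[OF dY vY kB conjunct1[OF u] stepB conjunct2[OF u], unfolded sY]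
  show ?case
    using 1(1)[OF refl rest 1(3)] d by (simp add: Let_def)
qed (auto simp: coarse_def)

section \<open>Local search at a node of the decomposition\<close>

definition maxind :: "'a set set \<Rightarrow> 'a set \<Rightarrow> 'a list \<Rightarrow> bool" where
  "maxind E W A \<longleftrightarrow> distinct A \<and> set A \<subseteq> W \<and> indep E (set A) \<and>
     (\<forall>X\<subseteq>W. indep E X \<longrightarrow> card X \<le> length A)"

definition node_ok :: "'a set \<Rightarrow> 'a set set \<Rightarrow> 'a list \<Rightarrow> ('a list \<times> 'a list) list \<Rightarrow> bool" where
  "node_ok V E W cs \<longleftrightarrow> distinct W \<and> is_module V E (set W) \<and>
     distinct (concat (map fst cs)) \<and> set (concat (map fst cs)) = set W \<and>
     (\<forall>(v, a)\<in>set cs. is_module (set W) E (set v) \<and> maxind E (set v) a)"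

fun sel :: "'a list list \<Rightarrow> bool list \<Rightarrow> 'a list \<Rightarrow> 'a list" where
  "sel (c # cs) (b # I) B = (if b then c @ sel cs I B else sel cs I B)"
| "sel _ _ B = B"

text \<open>The family for walking back from state \<open>I\<close>. A part avoided by
  \<open>I\<close> holds no token there and may be refilled differently; the parts met by
  \<open>I\<close> keep their content, so both families select the same set at
  \<open>I\<close>.\<close>

fun alt :: "'a list list \<Rightarrow> 'a list list \<Rightarrow> bool list \<Rightarrow> 'a list list" where
  "alt (c # cs) (a # As) (b # I) = (if b then c else a) # alt cs As I"
| "alt _ _ _ = []"

fun flips :: "bool list \<Rightarrow> bool list list" where
  "flips [] = []"
| "flips (b # I) = ((\<not> b) # I) # map ((#) b) (flips I)"

definition current :: "'a list \<Rightarrow> ('a list \<times> 'a list) list \<Rightarrow> 'a list list" where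
  "current S cs = map (\<lambda>(v, a). let X = filter (\<lambda>x. x \<in> set v) S in if X = [] then a else X) cs"

definition supp :: "'a set \<Rightarrow> ('a list \<times> 'a list) list \<Rightarrow> bool list" where
  "supp X cs = map (\<lambda>(v, a). X \<inter> set v \<noteq> {}) cs"

definition valid :: "'a set set \<Rightarrow> nat \<Rightarrow> 'a list list \<Rightarrow> 'a list \<Rightarrow> bool list \<Rightarrow> bool" where
  "valid E kk cs B I \<longleftrightarrow> indep E (set (sel cs I B)) \<and> kk \<le> length (sel cs I B)"

inductive reach :: "'a set set \<Rightarrow> nat \<Rightarrow> 'a list list \<Rightarrow> 'a list \<Rightarrow> bool list \<Rightarrow> bool list \<Rightarrow> bool"
  for E kk cs B I0 where
  start: "reach E kk cs B I0 I0"
| flip: "reach E kk cs B I0 I \<Longrightarrow> J \<in> set (flips I) \<Longrightarrow> valid E kk cs B J \<Longrightarrow> reach E kk cs B I0 J"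

text \<open>\<open>m\<close> counts the tokens outside \<open>W\<close>, regarded as frozen; with it
  the threshold \<open>kk\<close> is the same at all nodes.\<close>

definition tstep :: "'a set set \<Rightarrow> nat \<Rightarrow> 'a set \<Rightarrow> nat \<Rightarrow> 'a set \<Rightarrow> 'a set \<Rightarrow> bool" where
  "tstep E kk W m X Y \<longleftrightarrow> X \<subseteq> W \<and> Y \<subseteq> W \<and> indep E X \<and> indep E Y \<and>
     card (sym_diff X Y) \<le> 1 \<and> kk \<le> card X + m \<and> kk \<le> card Y + m"

text \<open>Independence from the tokens outside \<open>W\<close> is not demanded of
  \<open>X\<close>. For a module \<open>W\<close> met by \<open>S\<close> it is automatic, because
  these tokens have no neighbour in \<open>W\<close>.\<close>

definition opt :: "'a set set \<Rightarrow> nat \<Rightarrow> 'a set \<Rightarrow> 'a set \<Rightarrow> bool" where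
  "opt E kk S W \<longleftrightarrow>
     (\<forall>X. (tstep E kk W (card (S - W)))\<^sup>*\<^sup>* (S \<inter> W) X \<longrightarrow> card X \<le> card (S \<inter> W))"

definition stable :: "'a set set \<Rightarrow> nat \<Rightarrow> 'a list \<Rightarrow> 'a list \<Rightarrow> ('a list \<times> 'a list) list \<Rightarrow> bool" where
  "stable E kk S W cs \<longleftrightarrow>
    (let B = filter (\<lambda>x. x \<notin> set W) S; C = current S cs; I0 = supp (set S) cs in
     \<forall>I. reach E kk C B I0 I \<longrightarrow> length (sel C I B) \<le> length S \<and>
       length (sel (alt C (map snd cs) I) I0 B) \<le> length S)"

section \<open>Selections of parts by bit lists, and replacing the contents of modules\<close>

lemma flips_iff: "J \<in> set (flips I) \<longleftrightarrow> (\<exists>i<length I. J = I[i := \<not> I ! i])"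
proof (induction I arbitrary: J)
  case (Cons b I)
  have "(\<exists>i<length (b # I). J = (b # I)[i := \<not> (b # I) ! i]) \<longleftrightarrow>
      J = (\<not> b) # I \<or> (\<exists>i<length I. J = b # I[i := \<not> I ! i])"
    by (auto simp: less_Suc_eq_0_disj)
  then show ?case using Cons by auto
qed simp

lemma length_flips [simp]: "length (flips I) = length I"
  by (induction I) auto

lemma flips_length: "J \<in> set (flips I) \<Longrightarrow> length J = length I"
  by (auto simp: flips_iff)

lemma length_alt [simp]: "length cs = length I \<Longrightarrow> length As = length I \<Longrightarrow> length (alt cs As I) = length I"
  by (induction cs As I rule: alt.induct) auto

lemma nth_alt: "length cs = length I \<Longrightarrow> length As = length I \<Longrightarrow> i < length I \<Longrightarrow>
    alt cs As I ! i = (if I ! i then cs ! i else As ! i)"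
  by (induction cs As I arbitrary: i rule: alt.induct) (auto simp: nth_Cons split: nat.split)

lemma set_sel: "length cs = length I \<Longrightarrow> set (sel cs I B) = set B \<union> (\<Union>i\<in>{i. i < length I \<and> I ! i}. set (cs ! i))"
proof (induction cs I B rule: sel.induct)
  case (1 c cs b I B)
  have "{i. i < length (b # I) \<and> (b # I) ! i} = (if b then {0} else {}) \<union> Suc ` {i. i < length I \<and> I ! i}"
    by (auto simp: image_iff less_Suc_eq_0_disj)
  then show ?case using 1 by auto
qed auto

lemma length_sel: "length cs = length I \<Longrightarrow>
    length (sel cs I B) = length B + (\<Sum>i<length I. if I ! i then length (cs ! i) else 0)"
  by (induction cs I B rule: sel.induct) (auto simp: sum.lessThan_Suc_shift simp del: sum.lessThan_Suc cong: if_cong)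

lemma distinct_sel:
  assumes "length cs = length I" "distinct B" "\<And>c. c \<in> set cs \<Longrightarrow> distinct c \<and> set c \<inter> set B = {}"
    "\<And>i j. i < j \<Longrightarrow> j < length cs \<Longrightarrow> set (cs ! i) \<inter> set (cs ! j) = {}"
  shows "distinct (sel cs I B)"
  using assms
proof (induction cs arbitrary: I)
  case (Cons c cs)
  obtain b I' where I: "I = b # I'" "length cs = length I'" using Cons.prems(1) by (cases I) auto
  have disj: "set (cs ! i) \<inter> set (cs ! j) = {}" if "i < j" "j < length cs" for i j
    using Cons.prems(4)[of "Suc i" "Suc j"] that by simp
  have IH: "distinct (sel cs I' B)"
    using Cons.prems(2,3) by (intro Cons.IH I(2) disj) auto
  have "set c \<inter> set (cs ! i) = {}" if "i < length cs" for i
    using Cons.prems(4)[of 0 "Suc i"] that by simp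
  then have "set c \<inter> set (sel cs I' B) = {}" using I(2) Cons.prems(3)[of c] by (auto simp: set_sel)
  then show ?case using IH Cons.prems(3)[of c] by (auto simp: I)
qed auto

lemma indep_Un:
  "indep E X \<Longrightarrow> indep E Y \<Longrightarrow> (\<And>x y. x \<in> X \<Longrightarrow> y \<in> Y \<Longrightarrow> {x, y} \<notin> E) \<Longrightarrow> indep E (X \<union> Y)"
  unfolding indep_def by (metis Un_iff insert_commute)

text \<open>Seen from outside, all vertices of a module look alike. So an element of
  \<open>f i\<close> may stand for each element of \<open>g i\<close>, and only the edges inside the
  modules have to be checked anew.\<close>

lemma indep_transfer:
  assumes mod: "\<And>i. i \<in> J \<Longrightarrow> is_module V E (v i)"
    and disj: "\<And>i j. i \<in> J \<Longrightarrow> j \<in> J \<Longrightarrow> i \<noteq> j \<Longrightarrow> v i \<inter> v j = {}"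
    and B: "B \<subseteq> V" "\<And>i. i \<in> J \<Longrightarrow> B \<inter> v i = {}"
    and f: "indep E (B \<union> (\<Union>i\<in>J. f i))" "\<And>i. i \<in> J \<Longrightarrow> f i \<subseteq> v i"
    and g: "\<And>i. i \<in> J \<Longrightarrow> indep E (g i)" "\<And>i. i \<in> J \<Longrightarrow> g i \<subseteq> v i"
      "\<And>i. i \<in> J \<Longrightarrow> g i \<noteq> {} \<Longrightarrow> f i \<noteq> {}"
  shows "indep E (B \<union> (\<Union>i\<in>J. g i))"
proof -
  have fe: "{x, y} \<notin> E" if "x \<in> B \<union> (\<Union>i\<in>J. f i)" "y \<in> B \<union> (\<Union>i\<in>J. f i)" for x y
    using f(1) that unfolding indep_def by blast
  have Bg: "{x, y} \<notin> E" if x: "x \<in> B" and y: "y \<in> g j" "j \<in> J" for x y j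
  proof -
    obtain c where c: "c \<in> f j" using g(3)[OF y(2)] y(1) by blast
    have "x \<in> V" "x \<notin> v j" using x B y(2) by blast+
    moreover have "y \<in> v j" "c \<in> v j" using y c f(2) g(2) by blast+
    ultimately have "{y, x} \<in> E \<longleftrightarrow> {c, x} \<in> E" using is_moduleD[OF mod[OF y(2)]] by blast
    then show ?thesis using fe[of c x] x c y(2) by (auto simp: insert_commute)
  qed
  have gg: "{x, y} \<notin> E" if x: "x \<in> g i" "i \<in> J" and y: "y \<in> g j" "j \<in> J" for x y i j
  proof (cases "i = j")
    case True
    then show ?thesis using g(1) x y unfolding indep_def by blast
  next
    case False
    obtain c where c: "c \<in> f i" using g(3)[OF x(2)] x(1) by blast
    obtain d where d: "d \<in> f j" using g(3)[OF y(2)] y(1) by blast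
    have xc: "x \<in> v i" "c \<in> v i" using x c f(2) g(2) by blast+
    have yd: "y \<in> v j" "d \<in> v j" using y d f(2) g(2) by blast+
    have nin: "x \<notin> v j" "c \<notin> v j" "y \<notin> v i" "d \<notin> v i" using disj[OF x(2) y(2) False] xc yd by blast+
    have V: "c \<in> V" "y \<in> V" using xc yd is_module_subset mod x(2) y(2) by blast+
    have "{x, y} \<in> E \<longleftrightarrow> {c, y} \<in> E" using is_moduleD[OF mod[OF x(2)]] xc nin V by blast
    moreover have "{y, c} \<in> E \<longleftrightarrow> {d, c} \<in> E" using is_moduleD[OF mod[OF y(2)]] yd nin V by blast
    moreover have "{c, d} \<notin> E" using fe[of c d] c d x(2) y(2) by blast
    ultimately show ?thesis by (simp add: insert_commute)
  qed
  have BB: "{x, y} \<notin> E" if "x \<in> B" "y \<in> B" for x y using fe that by blast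
  have gB: "{y, x} \<notin> E" if "x \<in> B" "y \<in> g j" "j \<in> J" for x y j
    using Bg[OF that] by (simp add: insert_commute)
  show ?thesis
    unfolding indep_def
  proof (intro ballI)
    fix x y assume "x \<in> B \<union> (\<Union>i\<in>J. g i)" "y \<in> B \<union> (\<Union>i\<in>J. g i)"
    then consider "x \<in> B" "y \<in> B" | j where "x \<in> B" "y \<in> g j" "j \<in> J"
      | i where "x \<in> g i" "i \<in> J" "y \<in> B" | i j where "x \<in> g i" "i \<in> J" "y \<in> g j" "j \<in> J" by blast
    then show "{x, y} \<notin> E" by cases (rule BB Bg gB gg; assumption)+
  qed
qed

locale node_search =
  fixes V :: "'a set" and E S W cs kk
  assumes S: "coarse_set V E kk S" and node: "node_ok V E W cs"
begin

abbreviation "s \<equiv> length cs"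
definition "v i = set (fst (cs ! i))"
definition "A i = snd (cs ! i)"
definition "C = current S cs"
definition "As = map snd cs"
definition "B = filter (\<lambda>x. x \<notin> set W) S"
definition "I0 = supp (set S) cs"

lemma S': "distinct S" "set S \<subseteq> V" "indep E (set S)" "kk \<le> length S"
  using S by (auto simp: coarse_set_def)

lemma lengths [simp]: "length C = s" "length As = s" "length (supp X cs) = s" "length I0 = s"
  by (simp_all add: C_def current_def As_def I0_def supp_def)

lemma As_nth: "i < s \<Longrightarrow> As ! i = A i" by (simp add: As_def A_def)

lemma child: assumes "i < s"
  shows "is_module (set W) E (v i)" "maxind E (v i) (A i)" "is_module V E (v i)" "v i \<subseteq> set W"
proof -
  have "cs ! i \<in> set cs" using assms by simp
  then show "is_module (set W) E (v i)" "maxind E (v i) (A i)"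
    using node unfolding node_ok_def v_def A_def by (auto simp: case_prod_beta)
  then show "is_module V E (v i)" "v i \<subseteq> set W"
    using node is_module_trans is_module_subset unfolding node_ok_def by blast+
qed

lemma W_module: "is_module V E (set W)" and WV: "set W \<subseteq> V"
  using node is_module_subset unfolding node_ok_def by blast+

lemma A_props: assumes "i < s"
  shows "distinct (A i)" "set (A i) \<subseteq> v i" "indep E (set (A i))"
    "\<And>X. X \<subseteq> v i \<Longrightarrow> indep E X \<Longrightarrow> card X \<le> length (A i)"
  using child(2)[OF assms] unfolding maxind_def by auto

lemma v_union: "(\<Union>i<s. v i) = set W"
proof -
  have "set W = (\<Union>c\<in>set cs. set (fst c))" using node unfolding node_ok_def by auto
  also have "set cs = (\<lambda>i. cs ! i) ` {..<s}" by (auto simp: set_conv_nth)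
  finally show ?thesis unfolding v_def by simp
qed

lemma v_disjoint: assumes "i < s" "j < s" "i \<noteq> j" shows "v i \<inter> v j = {}"
proof -
  have "set (map fst cs ! i) \<inter> set (map fst cs ! j) = {}" if "i < j" "j < s" for i j
  proof -
    have d: "distinct (concat (take j (map fst cs) @ drop j (map fst cs)))"
      using node unfolding node_ok_def by simp
    have "map fst cs ! i \<in> set (take j (map fst cs))" "map fst cs ! j \<in> set (drop j (map fst cs))"
      using nth_mem[of i "take j (map fst cs)"] that by (auto simp: Cons_nth_drop_Suc[symmetric])
    then show ?thesis using d unfolding concat_append distinct_append by fastforce
  qed
  from this[of i j] this[of j i] show ?thesis
    using assms unfolding v_def by (cases "i < j") (auto simp: Int_commute)
qed

lemma fin_v: "finite (v i)" by (simp add: v_def)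

lemma C_nth: "i < s \<Longrightarrow> C ! i = (let X = filter (\<lambda>x. x \<in> v i) S in if X = [] then A i else X)"
  by (simp add: C_def current_def v_def A_def case_prod_beta Let_def cong: if_cong)

lemma supp_nth: "i < s \<Longrightarrow> supp X cs ! i \<longleftrightarrow> X \<inter> v i \<noteq> {}"
  by (simp add: supp_def v_def case_prod_beta)

lemma I0_nth: "i < s \<Longrightarrow> I0 ! i \<longleftrightarrow> set S \<inter> v i \<noteq> {}"
  unfolding I0_def by (rule supp_nth)

lemma C_supp: "i < s \<Longrightarrow> I0 ! i \<Longrightarrow> C ! i = filter (\<lambda>x. x \<in> v i) S \<and> set (C ! i) = set S \<inter> v i \<and> C ! i \<noteq> []"
  by (auto simp: C_nth I0_nth Let_def filter_empty_conv)

lemma C_free: "i < s \<Longrightarrow> \<not> I0 ! i \<Longrightarrow> C ! i = A i"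
  by (auto simp: C_nth I0_nth Let_def filter_empty_conv)

lemma C_props: assumes "i < s"
  shows "distinct (C ! i)" "set (C ! i) \<subseteq> v i" "indep E (set (C ! i))" "length (C ! i) \<le> length (A i)"
proof -
  show d: "distinct (C ! i)" and sub: "set (C ! i) \<subseteq> v i"
    using assms S' A_props by (auto simp: C_nth Let_def)
  show i: "indep E (set (C ! i))"
  proof (cases "I0 ! i")
    case True
    then show ?thesis using C_supp[OF assms] S'(3) by (auto intro: indep_subset)
  qed (use C_free A_props assms in simp)
  show "length (C ! i) \<le> length (A i)"
    using A_props(4)[OF assms sub i] d by (simp add: distinct_card)
qed

lemma B_props: "distinct B" "set B \<subseteq> V" "set B \<inter> set W = {}" "set B = set S - set W"
  using S' by (auto simp: B_def)

lemma B_v: "i < s \<Longrightarrow> set B \<inter> v i = {}" using B_props(3) child(4) by blast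

lemma card_W: assumes "X \<subseteq> set W"
  shows "card X = (\<Sum>i<s. card (X \<inter> v i))"
proof -
  have "X = (\<Union>i<s. X \<inter> v i)" using assms v_union by auto
  then have "card X = card (\<Union>i\<in>{..<s}. X \<inter> v i)" by simp
  also have "\<dots> = (\<Sum>i<s. card (X \<inter> v i))"
    using v_disjoint by (intro card_UN_disjoint) (auto simp: fin_v)
  finally show ?thesis .
qed

text \<open>Only the sets agree: \<open>sel\<close> regroups the elements of \<open>S\<close> by
  parts. This is harmless, as \<open>coarse\<close> compares sets.\<close>

lemma set_sel_I0: "set (sel C I0 B) = set S"
proof -
  have "(\<Union>i\<in>{i. i < s \<and> I0 ! i}. set (C ! i)) = set S \<inter> set W"
    using C_supp I0_nth by (auto simp: v_union[symmetric]) blast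
  then show ?thesis by (auto simp: set_sel B_props(4))
qed

text \<open>Stated for an arbitrary family \<open>D\<close>, since it serves both \<open>C\<close>
  and the exchanged family of the way back.\<close>

lemma family_props:
  assumes "length D = s" "\<And>i. i < s \<Longrightarrow> distinct (D ! i) \<and> set (D ! i) \<subseteq> v i" "length I = s"
  shows "distinct (sel D I B)" "set (sel D I B) \<subseteq> V"
proof -
  show "distinct (sel D I B)"
  proof (rule distinct_sel)
    show "distinct c \<and> set c \<inter> set B = {}" if "c \<in> set D" for c
      using that assms(1,2) B_v by (fastforce simp: in_set_conv_nth)
    show "set (D ! i) \<inter> set (D ! j) = {}" if "i < j" "j < length D" for i j
      using v_disjoint[of i j] assms(1) assms(2)[of i] assms(2)[of j] that by auto
  qed (use assms B_props in auto)
  have "set (D ! i) \<subseteq> V" if "i < s" for i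
    using assms(2)[OF that] is_module_subset[OF child(3)[OF that]] by blast
  then show "set (sel D I B) \<subseteq> V"
    using assms(1,3) B_props(2) by (auto simp: set_sel)
qed

lemma sel_C_props: "length I = s \<Longrightarrow> distinct (sel C I B)" "length I = s \<Longrightarrow> set (sel C I B) \<subseteq> V"
  using family_props[of C I] C_props by auto

lemma length_sel_I0: "length (sel C I0 B) = length S"
  using set_sel_I0 sel_C_props(1)[of I0] S'(1) by (metis distinct_card lengths(4))

lemma reach_props: "reach E kk C B I0 I \<Longrightarrow> length I = s \<and> valid E kk C B I"
proof (induction rule: reach.induct)
  case start
  then show ?case using S' set_sel_I0 length_sel_I0 by (simp add: valid_def)
next
  case (flip I J)
  then show ?case using flips_length by auto
qed

lemma alt_props:
  assumes "length I = s" "i < s"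
  shows "distinct (alt C As I ! i) \<and> set (alt C As I ! i) \<subseteq> v i" "indep E (set (alt C As I ! i))"
    "length (C ! i) \<le> length (alt C As I ! i)"
  using assms C_props A_props by (auto simp: nth_alt As_nth)

text \<open>The exchange never shrinks a part, so the threshold survives, and a selected part was
  nonempty before, so \<open>indep_transfer\<close> applies.\<close>

lemma alt_valid:
  assumes I: "length I = s" and J: "length J = s" "valid E kk C B J"
  shows "valid E kk (alt C As I) B J"
proof -
  have "indep E (set B \<union> (\<Union>i\<in>{i. i < s \<and> J ! i}. set (alt C As I ! i)))"
  proof (rule indep_transfer[where V = V and v = v and f = "\<lambda>i. set (C ! i)"])
    show "indep E (set B \<union> (\<Union>i\<in>{i. i < s \<and> J ! i}. set (C ! i)))"
      using J by (simp add: valid_def set_sel)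
    show "set (C ! i) \<noteq> {}" if "i \<in> {i. i < s \<and> J ! i}" "set (alt C As I ! i) \<noteq> {}" for i
      using that I C_supp[of i] C_free[of i] by (cases "I0 ! i") (auto simp: nth_alt As_nth split: if_splits)
  qed (use child v_disjoint B_props B_v C_props alt_props[OF I] in auto)
  moreover have "length (sel C J B) \<le> length (sel (alt C As I) J B)"
    using I J(1) alt_props(3)[OF I] by (auto simp: length_sel intro!: sum_mono)
  ultimately show ?thesis using I J by (auto simp: valid_def set_sel)
qed

section \<open>Walks of the search and their retraced versions\<close>

definition path :: "bool list list \<Rightarrow> bool" where
  "path p \<longleftrightarrow> p \<noteq> [] \<and> last p = I0 \<and> (\<forall>I\<in>set p. length I = s \<and> valid E kk C B I) \<and>
     successively (\<lambda>I J. I \<in> set (flips J)) p"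

text \<open>A flip fills or empties a whole part at once. This is the reason for recording
  comparable sets rather than single token moves.\<close>

lemma flip_comparable:
  assumes "length D = length J" "I \<in> set (flips J)"
  shows "set (sel D I B) \<subseteq> set (sel D J B) \<or> set (sel D J B) \<subseteq> set (sel D I B)"
proof -
  obtain i where i: "i < length J" "I = J[i := \<not> J ! i]" using assms(2) by (auto simp: flips_iff)
  have n: "I ! j \<longleftrightarrow> (if j = i then \<not> J ! i else J ! j)" if "j < length J" for j using that i by auto
  have "{j. j < length J \<and> I ! j} \<subseteq> {j. j < length J \<and> J ! j} \<or> {j. j < length J \<and> J ! j} \<subseteq> {j. j < length J \<and> I ! j}"
    using n by (cases "J ! i") (auto split: if_splits)
  then show ?thesis using assms i by (auto simp: set_sel)
qed

lemma path_comparable: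
  assumes "path p" "length D = s"
  shows "successively (\<lambda>I J. set (sel D I B) \<subseteq> set (sel D J B) \<or> set (sel D J B) \<subseteq> set (sel D I B)) p"
proof -
  have "successively (\<lambda>I J. I \<in> set (flips J)) p" using assms(1) by (simp add: path_def)
  then show ?thesis
  proof (rule successively_mono)
    fix I J assume "J \<in> set p" "I \<in> set (flips J)"
    then show "set (sel D I B) \<subseteq> set (sel D J B) \<or> set (sel D J B) \<subseteq> set (sel D I B)"
      using assms by (intro flip_comparable) (auto simp: path_def)
  qed
qed

lemma path_coarse:
  assumes "path p" "coarse V E kk S0 acc" "hd acc = S"
  shows "coarse V E kk S0 (map (\<lambda>I. sel C I B) p @ acc)"
proof -
  have "set (sel C (last p) B) = set S" using assms(1) set_sel_I0 by (simp add: path_def)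
  moreover note path_comparable[OF assms(1), of C]
  moreover have "coarse_set V E kk (sel C I B)" if "I \<in> set p" for I
    using assms(1) that sel_C_props by (auto simp: path_def coarse_set_def valid_def)
  ultimately show ?thesis
    using assms by (auto simp: coarse_def path_def successively_append_iff successively_map last_map)
qed

text \<open>At the turning point \<open>hd p\<close> the two families select the same set, so the
  walk may change family there and be retraced to the support of \<open>S\<close>.\<close>

lemma path_coarse_return:
  assumes "path p" "coarse V E kk S0 acc" "hd acc = S"
  shows "coarse V E kk S0 (rev (map (\<lambda>I. sel (alt C As (hd p)) I B) p) @ map (\<lambda>I. sel C I B) p @ acc)"
proof -
  let ?D = "alt C As (hd p)"
  have hd: "length (hd p) = s" using assms(1) by (auto simp: path_def)
  have "length ?D = s" using hd by simp
  have "set (sel ?D (hd p) B) = set (sel C (hd p) B)"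
    using hd by (auto simp: set_sel nth_alt)
  moreover from path_comparable[OF assms(1) \<open>length ?D = s\<close>]
  have "successively (\<lambda>J I. set (sel ?D I B) \<subseteq> set (sel ?D J B) \<or> set (sel ?D J B) \<subseteq> set (sel ?D I B)) p"
    by (rule successively_mono) auto
  moreover have "coarse_set V E kk (sel ?D I B)" if "I \<in> set p" for I
    using alt_valid[OF hd, of I] family_props[of ?D I] alt_props[OF hd] assms(1) that hd
    by (auto simp: path_def coarse_set_def valid_def)
  ultimately show ?thesis
    using path_coarse[OF assms] assms(1)
    by (auto simp: coarse_def path_def successively_append_iff successively_map successively_rev last_rev hd_append hd_map rev_map[symmetric])
qed

section \<open>Optimality at one node\<close>

definition stable_reach :: "bool list \<Rightarrow> bool" where
  "stable_reach I \<longleftrightarrow> length (sel C I B) \<le> length S \<and> length (sel (alt C As I) I0 B) \<le> length S"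

lemma stable_iff: "stable E kk S W cs \<longleftrightarrow> (\<forall>I. reach E kk C B I0 I \<longrightarrow> stable_reach I)"
  unfolding stable_def stable_reach_def Let_def C_def B_def I0_def As_def ..

text \<open>Otherwise the retraced walk would end with \<open>A i\<close> in place of the smaller
  \<open>C i\<close> and nothing else reduced, hence with more tokens than \<open>S\<close>.\<close>

lemma emptied_saturated:
  assumes "length I = s" "stable_reach I" "i < s" "I0 ! i" "\<not> I ! i"
  shows "length (A i) \<le> length (C ! i)"
proof (rule ccontr)
  assume less: "\<not> ?thesis"
  let ?D = "alt C As I"
  have "length (sel C I0 B) < length (sel ?D I0 B)"
    using assms less alt_props(3)[OF assms(1)]
    by (auto simp: length_sel nth_alt As_nth intro!: sum_strict_mono_ex1 bexI[of _ i])
  then show False using assms(2) length_sel_I0 by (simp add: stable_reach_def)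
qed

text \<open>The part has evolved by steps that are legal at the child, so the optimality of the
  child still bounds it. This can be lost only after the part has been emptied.\<close>

definition kept :: "'a set \<Rightarrow> nat \<Rightarrow> bool" where
  "kept X i \<longleftrightarrow> (tstep E kk (v i) (card (set S - v i)))\<^sup>*\<^sup>* (set S \<inter> v i) (X \<inter> v i)"

text \<open>Each case has its own reason: a kept part is bounded by the optimality of the child, a
  saturated one by the maximality of \<open>A i\<close>, and a part not met by \<open>S\<close> has
  \<open>C i = A i\<close>.\<close>

lemma part_bound:
  assumes "X \<subseteq> set W" "indep E X" "i < s"
    and "I0 ! i \<Longrightarrow> opt E kk (set S) (v i)"
    and "I0 ! i \<Longrightarrow> kept X i \<or> length (A i) \<le> length (C ! i)"
  shows "card (X \<inter> v i) \<le> length (C ! i)"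
proof -
  have le: "card (X \<inter> v i) \<le> length (A i)"
    using assms by (intro A_props(4)) (auto intro: indep_subset)
  show ?thesis
  proof (cases "I0 ! i")
    case True
    have "card (set S \<inter> v i) = length (C ! i)"
      using C_supp[OF assms(3) True] C_props(1)[OF assms(3)] by (metis distinct_card)
    then show ?thesis using assms(4,5)[OF True] le unfolding kept_def opt_def by force
  next
    case False
    then show ?thesis using le C_free assms(3) by simp
  qed
qed

lemma node_opt:
  assumes "stable E kk S W cs" and ne: "set S \<inter> set W \<noteq> {} \<or> S = []"
    and ch: "\<And>i. i < s \<Longrightarrow> set S \<inter> v i \<noteq> {} \<Longrightarrow> opt E kk (set S) (v i)"
  shows "opt E kk (set S) (set W)"
  unfolding opt_def
proof (intro allI impI)
  define m where "m = card (set S - set W)"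
  have mB: "m = length B" using B_props distinct_card[of B] by (simp add: m_def)
  have st: "stable_reach I" if "reach E kk C B I0 I" for I using assms(1) that stable_iff by blast
  have chI: "opt E kk (set S) (v i)" if "i < s" "I0 ! i" for i using ch that I0_nth by blast
  \<comment> \<open>The invariant along a sequence inside \<open>W\<close>. The disjunction is what
    survives when a part is emptied: from then on nothing is known about its history, but stability
    has made it saturated.\<close>
  let ?P = "\<lambda>X. X \<subseteq> set W \<and> indep E X \<and> reach E kk C B I0 (supp X cs) \<and>
    (\<forall>i<s. I0 ! i \<longrightarrow> kept X i \<or> length (A i) \<le> length (C ! i))"
  have bound: "card X + m \<le> length (sel C (supp X cs) B)"
    if "X \<subseteq> set W" "\<And>i. i < s \<Longrightarrow> card (X \<inter> v i) \<le> length (C ! i)" for X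
  proof -
    have "card X \<le> (\<Sum>i<s. if supp X cs ! i then length (C ! i) else 0)"
      unfolding card_W[OF that(1)] using that(2) by (intro sum_mono) (auto simp: supp_nth)
    then show ?thesis by (simp add: length_sel mB)
  qed
  have parts: "card (X \<inter> v i) \<le> length (C ! i)" if "?P X" "i < s" for X i
    using that chI by (intro part_bound) auto
  fix X assume "(tstep E kk (set W) (card (set S - set W)))\<^sup>*\<^sup>* (set S \<inter> set W) X"
  then have "?P X"
  proof (induction rule: rtranclp_induct)
    case base
    have "supp (set S \<inter> set W) cs = I0"
      using child(4) by (intro nth_equalityI) (auto simp: supp_nth I0_nth)
    moreover have "set S \<inter> set W \<inter> v i = set S \<inter> v i" if "i < s" for i using child(4)[OF that] by blast
    ultimately show ?case using S'(3) by (auto intro: indep_subset reach.start simp: kept_def)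
  next
    case (step X Y)
    let ?I = "supp X cs"
    have X: "X \<subseteq> set W" "indep E X" "kk \<le> card X + m" and Y: "Y \<subseteq> set W" "indep E Y" "kk \<le> card Y + m"
      and XY: "card (sym_diff X Y) \<le> 1"
      using step.hyps(2) by (auto simp: tstep_def m_def)
    have "finite (sym_diff X Y)" using X(1) Y(1) by (meson finite_Diff finite_UnI finite_set finite_subset)
    show ?case
    proof (cases "X = Y")
      case False
      then have "card (sym_diff X Y) = 1" using XY \<open>finite (sym_diff X Y)\<close>
        by (metis Diff_eq_empty_iff Un_empty card_0_eq le_antisym less_one not_le subset_antisym)
      then obtain x where x: "sym_diff X Y = {x}" by (auto simp: card_1_singleton_iff)
      then have "x \<in> set W" using X(1) Y(1) by blast
      then obtain j where j: "j < s" "x \<in> v j" using v_union by blast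
      have XY_iff: "z \<in> Y \<longleftrightarrow> z \<in> X" if "z \<noteq> x" for z
        using x that by (metis Diff_iff Un_iff singletonD)
      have same: "Y \<inter> v i = X \<inter> v i" if "i < s" "i \<noteq> j" for i
      proof -
        have "x \<notin> v i" using v_disjoint[OF that(1) j(1) that(2)] j(2) by blast
        then show ?thesis using XY_iff by (intro set_eqI) (metis Int_iff)
      qed
      have reachX: "reach E kk C B I0 ?I" using step.IH by blast
      have kept_j: "kept Y j \<or> length (A j) \<le> length (C ! j)" if jS: "I0 ! j"
      proof (cases "?I ! j \<and> kept X j")
        \<comment> \<open>Either \<open>X\<close> avoids the part, and stability of the current
          state saturates it, or the part is not kept and was saturated before.\<close>
        case False
        then show ?thesis using step.IH emptied_saturated[OF _ st[OF reachX] j(1) jS] j(1) jS by auto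
      next
        case True
        have Cj: "length (C ! j) = card (set S \<inter> v j)"
          using C_supp[OF j(1) jS] C_props(1)[OF j(1)] by (metis distinct_card)
        \<comment> \<open>Apply the bound of every other part and compare with the current state:
          its selection has at most \<open>length S\<close> elements and includes
          \<open>C ! j\<close>, which is then cancelled against the tokens of \<open>S\<close> in
          \<open>v j\<close>.\<close>
        have rest: "card (Z - v j) + m \<le> card (set S - v j)"
          if Z: "Z \<subseteq> set W" "\<And>i. i < s \<Longrightarrow> i \<noteq> j \<Longrightarrow> Z \<inter> v i = X \<inter> v i" for Z
        proof -
          have "card (Z - v j) = (\<Sum>i<s. card ((Z - v j) \<inter> v i))"
            using Z(1) by (intro card_W) auto
          also have "\<dots> = (\<Sum>i\<in>{..<s} - {j}. card (X \<inter> v i))"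
          proof -
            have "(Z - v j) \<inter> v i = (if i = j then {} else X \<inter> v i)" if "i < s" for i
              using Z(2)[OF that] v_disjoint[OF that j(1)] by auto
            then have "(\<Sum>i<s. card ((Z - v j) \<inter> v i)) = (\<Sum>i<s. if i = j then 0 else card (X \<inter> v i))"
              by (intro sum.cong) auto
            also have "\<dots> = (\<Sum>i\<in>{..<s} - {j}. card (X \<inter> v i))"
              by (subst sum.remove[of _ j]) (use j(1) in \<open>auto intro!: sum.cong\<close>)
            finally show ?thesis .
          qed
          also have "\<dots> \<le> (\<Sum>i\<in>{..<s} - {j}. if ?I ! i then length (C ! i) else 0)"
            using parts[OF step.IH] by (intro sum_mono) (auto simp: supp_nth)
          finally have "card (Z - v j) + length (C ! j) \<le> (\<Sum>i<s. if ?I ! i then length (C ! i) else 0)"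
            using True j(1) by (subst sum.remove[of _ j]) auto
          also have "\<dots> + m \<le> length S"
            using st[OF reachX] by (simp add: stable_reach_def length_sel mB)
          finally have "card (Z - v j) + m + card (set S \<inter> v j) \<le> card (set S)"
            using S'(1) Cj by (simp add: distinct_card)
          moreover have "card (set S) = card (set S \<inter> v j) + card (set S - v j)"
            by (metis card_Int_Diff finite_set)
          ultimately show ?thesis by simp
        qed
        have split: "card Z = card (Z \<inter> v j) + card (Z - v j)" if "Z \<subseteq> set W" for Z
          using that by (metis card_Int_Diff finite_set finite_subset)
        \<comment> \<open>By \<open>rest\<close>, replacing the tokens outside \<open>v j\<close> by
          those of \<open>S\<close> can only raise the count, so the threshold of \<open>W\<close>
          implies that of the child.\<close>
        have "tstep E kk (v j) (card (set S - v j)) (X \<inter> v j) (Y \<inter> v j)"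
          unfolding tstep_def
        proof (intro conjI)
          have "sym_diff (X \<inter> v j) (Y \<inter> v j) \<subseteq> sym_diff X Y" by blast
          then show "card (sym_diff (X \<inter> v j) (Y \<inter> v j)) \<le> 1"
            using XY card_mono[OF \<open>finite (sym_diff X Y)\<close>] by (meson order.trans)
          show "kk \<le> card (X \<inter> v j) + card (set S - v j)"
            using rest[of X] X split[of X] by simp
          show "kk \<le> card (Y \<inter> v j) + card (set S - v j)"
            using rest[of Y] Y split[of Y] same by simp
        qed (use X Y in \<open>auto intro: indep_subset\<close>)
        then have "kept Y j" using True unfolding kept_def by (meson rtranclp.rtrancl_into_rtrancl)
        then show ?thesis ..
      qed
      have inv: "\<forall>i<s. I0 ! i \<longrightarrow> kept Y i \<or> length (A i) \<le> length (C ! i)"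
        using step.IH kept_j same unfolding kept_def by metis
      have "reach E kk C B I0 (supp Y cs)"
      proof (cases "supp Y cs = ?I")
        case False
        have n: "supp Y cs ! i = ?I ! i" if "i < s" "i \<noteq> j" for i
          using same[OF that] that by (simp add: supp_nth)
        have "supp Y cs = ?I[j := \<not> ?I ! j]"
        proof (rule nth_equalityI)
          have "supp Y cs ! j \<noteq> ?I ! j"
          proof
            assume "supp Y cs ! j = ?I ! j"
            then have "supp Y cs = ?I" using n by (intro nth_equalityI) (simp, metis lengths(3))
            then show False using False by simp
          qed
          then show "supp Y cs ! i = ?I[j := \<not> ?I ! j] ! i" if "i < length (supp Y cs)" for i
            using n that by (cases "i = j") auto
        qed simp
        then have fl: "supp Y cs \<in> set (flips ?I)" using j(1) by (auto simp: flips_iff)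
        have "card (Y \<inter> v i) \<le> length (C ! i)" if "i < s" for i
          using part_bound[OF Y(1,2) that] inv chI that by blast
        then have "kk \<le> length (sel C (supp Y cs) B)" using bound[OF Y(1)] Y(3) by fastforce
        moreover have "indep E (set (sel C (supp Y cs) B))"
        proof -
          \<comment> \<open>A vertex of \<open>B\<close> is adjacent to all of \<open>W\<close> or
            to none of it. As it is not adjacent to a token of \<open>S\<close> inside
            \<open>W\<close>, the second holds; if \<open>S\<close> is empty, so is
            \<open>B\<close>.\<close>
          have "indep E (set B \<union> Y)"
          proof -
            have "{x, y} \<notin> E" if x: "x \<in> set B" and y: "y \<in> Y" for x y
            proof -
              have xS: "x \<in> set S" "x \<notin> set W" "x \<in> V" using x B_props S'(2) by auto
              then obtain z where z: "z \<in> set S" "z \<in> set W" using ne by auto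
              have "{y, x} \<in> E \<longleftrightarrow> {z, x} \<in> E"
                using is_moduleD[OF W_module xS(3,2)] y z Y(1) by blast
              moreover have "{z, x} \<notin> E" using S'(3) z xS unfolding indep_def by blast
              ultimately show ?thesis by (simp add: insert_commute)
            qed
            moreover have "indep E (set B)" using S'(3) by (rule indep_subset) (auto simp: B_props(4))
            ultimately show ?thesis using Y(2) by (intro indep_Un) auto
          qed
          moreover have "Y = (\<Union>i\<in>{i. i < s \<and> supp Y cs ! i}. Y \<inter> v i)"
          proof
            show "Y \<subseteq> (\<Union>i\<in>{i. i < s \<and> supp Y cs ! i}. Y \<inter> v i)"
            proof
              fix y assume "y \<in> Y"
              then obtain i where "i < s" "y \<in> v i" using Y(1) v_union by blast
              then show "y \<in> (\<Union>i\<in>{i. i < s \<and> supp Y cs ! i}. Y \<inter> v i)"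
                using \<open>y \<in> Y\<close> supp_nth[of i Y] by blast
            qed
          qed blast
          ultimately have "indep E (set B \<union> (\<Union>i\<in>{i. i < s \<and> supp Y cs ! i}. Y \<inter> v i))" by simp
          then have "indep E (set B \<union> (\<Union>i\<in>{i. i < s \<and> supp Y cs ! i}. set (C ! i)))"
            by (rule indep_transfer[where V = V and v = v, rotated 4])
              (use child v_disjoint B_props B_v C_props in \<open>auto simp: supp_nth\<close>)
          then show ?thesis by (simp add: set_sel)
        qed
        ultimately show ?thesis using reach.flip[OF reachX fl] by (simp add: valid_def)
      qed (use reachX in simp)
      then show ?thesis using Y inv by blast
    qed (use step.IH in blast)
  qed
  then have "card X + m \<le> length (sel C (supp X cs) B)" using bound parts by blast
  also have "\<dots> \<le> length S" using st \<open>?P X\<close> by (auto simp: stable_reach_def)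
  also have "length S = card (set S \<inter> set W) + m"
    using S'(1) card_Int_Diff[of "set S" "set W"] by (simp add: m_def distinct_card)
  finally show "card X \<le> card (set S \<inter> set W)" by simp
qed

end

section \<open>Optimality from local stability\<close>

text \<open>The decomposition tree with its nodes in preorder. A leaf is a node whose single part is
  itself, so the search treats leaves like all other nodes; without it nothing would refill an unmet
  graph of one vertex.\<close>

inductive decomp :: "'a set \<Rightarrow> 'a set set \<Rightarrow> nat \<Rightarrow> 'a list \<Rightarrow> 'a list \<Rightarrow>
    ('a list \<times> ('a list \<times> 'a list) list) list \<Rightarrow> bool" for V E m where
  leaf: "distinct W \<Longrightarrow> is_module V E (set W) \<Longrightarrow> length W \<le> 1 \<Longrightarrow> decomp V E m W W [(W, [(W, W)])]"
| split: "distinct W \<Longrightarrow> is_module V E (set W) \<Longrightarrow> length Ps \<le> m \<Longrightarrow> 2 \<le> length Ps \<Longrightarrow>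
    distinct (concat Ps) \<Longrightarrow> set (concat Ps) = set W \<Longrightarrow> [] \<notin> set Ps \<Longrightarrow>
    (\<forall>P\<in>set Ps. is_module (set W) E (set P)) \<Longrightarrow>
    list_all2 (\<lambda>P r. decomp V E m P (fst r) (snd r)) Ps rs \<Longrightarrow> maxind E (set W) A \<Longrightarrow>
    decomp V E m W A ((W, zip Ps (map fst rs)) # concat (map snd rs))"

lemma indep_small:
  assumes "\<And>x. {x} \<notin> E" "card X \<le> 1" "finite X"
  shows "indep E X"
proof -
  consider "X = {}" | x where "X = {x}"
    using assms(2,3) by (metis One_nat_def card_0_eq card_1_singletonE le_Suc_eq le_zero_eq)
  then show ?thesis using assms(1) by cases (auto simp: indep_def)
qed

lemma maxind_small:
  assumes "\<And>x. {x} \<notin> E" "distinct W" "length W \<le> 1"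
  shows "maxind E (set W) W"
proof -
  have c: "card (set W) = length W" by (rule distinct_card[OF assms(2)])
  have "card X \<le> length W" if "X \<subseteq> set W" for X using card_mono[OF _ that] c by simp
  then show ?thesis using indep_small[OF assms(1), of "set W"] assms(2,3) c by (simp add: maxind_def)
qed

lemma decomp_maxind:
  assumes "decomp V E m W A ns" "\<And>x. {x} \<notin> E"
  shows "maxind E (set W) A"
  using assms by cases (auto intro: maxind_small)

lemma length_concat_distinct: "distinct (concat xss) \<Longrightarrow> [] \<notin> set xss \<Longrightarrow> length xss \<le> length (concat xss)"
proof (induction xss)
  case (Cons x xss)
  then show ?case by (cases x) auto
qed simp

lemma length_le_concat: "xs \<in> set xss \<Longrightarrow> length xs \<le> length (concat xss)"
  by (induction xss) auto

text \<open>The additional 1 accounts for leaves: they have one part even if \<open>m\<close> is 0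
  or \<open>W\<close> is empty, as in the empty graph.\<close>

lemma decomp_nodes:
  assumes "decomp V E m W A ns" "\<And>x. {x} \<notin> E" "(W', cs) \<in> set ns"
  shows "node_ok V E W' cs \<and> length cs \<le> m + 1 \<and> length cs \<le> length W + 1"
  using assms(1,3)
proof (induction arbitrary: W' cs rule: decomp.induct)
  case (leaf W)
  then show ?case using maxind_small[OF assms(2)] by (auto simp: node_ok_def is_module_def)
next
  case (split W Ps rs A)
  have len: "length Ps = length rs" using split.IH by (rule list_all2_lengthD)
  have lW: "length (concat Ps) = length W"
    using split.hyps by (metis distinct_card)
  show ?case
  proof (cases "(W', cs) = (W, zip Ps (map fst rs))")
    case True
    have "is_module (set W) E (set v) \<and> maxind E (set v) a" if va: "(v, a) \<in> set (zip Ps (map fst rs))" for v a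
    proof -
      obtain i where i: "i < length Ps" "v = Ps ! i" "a = fst (rs ! i)"
        using va len by (auto simp: in_set_zip)
      then have "decomp V E m v a (snd (rs ! i))" using split.IH by (auto simp: list_all2_conv_all_nth)
      then show ?thesis using decomp_maxind[OF _ assms(2)] split.hyps(8) i by auto
    qed
    then show ?thesis
      using True split.hyps length_concat_distinct[OF split.hyps(5,7)] len lW
      by (auto simp: node_ok_def)
  next
    case False
    then obtain r where "r \<in> set rs" "(W', cs) \<in> set (snd r)" using split.prems by auto
    then obtain i where i: "i < length Ps" "(W', cs) \<in> set (snd (rs ! i))"
      using len by (metis in_set_conv_nth)
    then have "node_ok V E W' cs \<and> length cs \<le> m + 1 \<and> length cs \<le> length (Ps ! i) + 1"
      using split.IH by (auto simp: list_all2_conv_all_nth)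
    moreover have "length (Ps ! i) \<le> length (concat Ps)"
      using nth_mem[OF i(1)] by (rule length_le_concat)
    ultimately show ?thesis using lW by simp
  qed
qed

text \<open>Every inner node has at least two children and no leaf is empty, so there are fewer
  inner nodes than leaves and at most \<open>length W\<close> leaves.\<close>

lemma decomp_length: "decomp V E m W A ns \<Longrightarrow> W \<noteq> [] \<Longrightarrow> length ns + 1 \<le> 2 * length W"
proof (induction rule: decomp.induct)
  case (split W Ps rs A)
  have "length Ps + length (concat (map snd rs)) \<le> 2 * length (concat Ps)"
    using split.IH split.hyps(7)
  proof (induction Ps rs rule: list_all2_induct)
    case (Cons P Ps r rs)
    then show ?case by auto
  qed simp
  moreover have "length (concat Ps) = length W" using split.hyps by (metis distinct_card)
  ultimately show ?case using split.hyps(4) by simp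
next
  case (leaf W)
  then show ?case by (cases W) auto
qed

lemma opt_small:
  assumes "finite W" "card W \<le> 1" "S \<inter> W \<noteq> {}"
  shows "opt E kk S W"
  unfolding opt_def
proof (intro allI impI)
  fix X assume "(tstep E kk W (card (S - W)))\<^sup>*\<^sup>* (S \<inter> W) X"
  then have "X \<subseteq> W" by (induction rule: rtranclp_induct) (auto simp: tstep_def)
  then have "card X \<le> 1" using assms card_mono[of W X] by linarith
  moreover have "card (S \<inter> W) \<ge> 1" using assms by (metis One_nat_def Suc_leI card_gt_0_iff finite_Int)
  ultimately show "card X \<le> card (S \<inter> W)" by simp
qed

text \<open>The induction descends only into parts met by \<open>S\<close>. These are the parts that
  \<open>node_opt\<close> asks about, and they inherit the last hypothesis.\<close>

lemma decomp_opt: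
  assumes "decomp V E m W A ns" "\<And>x. {x} \<notin> E" "coarse_set V E kk S"
    "\<And>W' cs. (W', cs) \<in> set ns \<Longrightarrow> stable E kk S W' cs" "set S \<inter> set W \<noteq> {} \<or> S = []"
  shows "opt E kk (set S) (set W)"
  using assms(1,4,5)
proof (induction rule: decomp.induct)
  case (leaf W)
  have n: "node_ok V E W [(W, W)]"
    using leaf.hyps maxind_small[OF assms(2)] by (auto simp: node_ok_def is_module_def)
  interpret node_search V E S W "[(W, W)]" kk by unfold_locales (use n assms(3) in auto)
  show ?case
  proof (rule node_opt)
    show "opt E kk (set S) (v i)" if "i < length [(W, W)]" "set S \<inter> v i \<noteq> {}" for i
      using that leaf.hyps by (intro opt_small) (auto simp: v_def distinct_card)
  qed (use leaf.prems in auto)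
next
  case (split W Ps rs A)
  let ?cs = "zip Ps (map fst rs)"
  have len: "length Ps = length rs" using split.IH by (rule list_all2_lengthD)
  have "decomp V E m W A ((W, ?cs) # concat (map snd rs))"
    using split.hyps split.IH by (intro decomp.split) (auto elim: list_all2_mono)
  from decomp_nodes[OF this assms(2)] have n: "node_ok V E W ?cs" by simp
  interpret node_search V E S W ?cs kk by unfold_locales (use n assms(3) in auto)
  show ?case
  proof (rule node_opt)
    fix i assume i: "i < length ?cs" "set S \<inter> v i \<noteq> {}"
    then have i': "i < length Ps" "v i = set (Ps ! i)" "rs ! i \<in> set rs" using len by (auto simp: v_def)
    have "stable E kk S W' cs'" if "(W', cs') \<in> set (snd (rs ! i))" for W' cs'
      using split.prems(1)[of W' cs'] i'(3) that by auto
    then show "opt E kk (set S) (v i)"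
      using list_all2_nthD[OF split.IH i'(1)] i i'(2) by simp
  qed (use split.prems in auto)
qed

section \<open>From single steps to \<open>tar_lambda\<close>\<close>

lemma tar_sequence_tstep:
  assumes "tar_sequence V E k X Y Xs" "k \<le> int (card X)"
  shows "(tstep E (nat k) V 0)\<^sup>*\<^sup>* X Y"
  using assms
proof (induction Xs arbitrary: X)
  case (Cons Z Zs)
  show ?case
  proof (cases Zs)
    case Nil
    then show ?thesis using Cons.prems by (auto simp: tar_sequence_def)
  next
    case (Cons Z' Zs')
    have st: "tar_step k X Z'" "independent_set V E X" "independent_set V E Z'" "tar_sequence V E k Z' Y Zs"
      using Cons.prems Cons by (auto simp: tar_sequence_def)
    then have "(tstep E (nat k) V 0)\<^sup>*\<^sup>* Z' Y" by (intro Cons.IH) (auto simp: tar_step_def)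
    moreover have "tstep E (nat k) V 0 X Z'"
      using st by (auto simp: tstep_def tar_step_def independent_set_iff)
    ultimately show ?thesis by (rule converse_rtranclp_into_rtranclp[rotated])
  qed
qed (simp add: tar_sequence_def)

lemma symp_tstep: "symp (tstep E kk W m)"
  by (rule sympI) (auto simp: tstep_def Un_commute)

text \<open>Steps are reversible, so everything reachable from \<open>X\<close> is reachable from
  the final set \<open>Y\<close>, where optimality bounds it. At the root no token lies outside,
  hence the 0.\<close>

lemma tar_lambda_opt:
  assumes "finite V" "k \<le> int (card X)" "tar_sequence V E k X Y Ss" "opt E (nat k) Y V" "Y \<subseteq> V"
  shows "card Y = tar_lambda V E X k"
proof -
  let ?R = "(tstep E (nat k) V 0)\<^sup>*\<^sup>*"
  have "Y \<inter> V = Y" "Y - V = {}" using assms(5) by auto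
  then have opt: "?R Y Z \<Longrightarrow> card Z \<le> card Y" for Z using assms(4) unfolding opt_def by (metis card.empty)
  have YX: "?R Y X"
    using tar_sequence_tstep[OF assms(3,2)] sympD[OF symp_rtranclp[OF symp_tstep]] by blast
  have le: "c \<le> card Y" if c: "c \<in> {card S' |S'. tar_reachable V E k X S'}" for c
  proof -
    obtain S' Ss' where "c = card S'" "tar_sequence V E k X S' Ss'" using c by (auto simp: tar_reachable_def)
    then show ?thesis using opt tar_sequence_tstep[OF _ assms(2)] YX by (meson rtranclp_trans)
  qed
  moreover have "finite {card S' |S'. tar_reachable V E k X S'}"
    by (rule finite_subset[of _ "{..card Y}"]) (use le in auto)
  moreover have "card Y \<in> {card S' |S'. tar_reachable V E k X S'}"
    using assms(3) by (auto simp: tar_reachable_def)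
  ultimately show ?thesis unfolding tar_lambda_def by (intro Max_eqI[symmetric]) auto
qed

text \<open>A step requires both its sets to reach the threshold, so no step leaves
  \<open>X\<close>.\<close>

lemma tar_lambda_trivial:
  assumes "\<not> k \<le> int (card X)" "independent_set V E X"
  shows "card X = tar_lambda V E X k" "tar_sequence V E k X X [X]"
proof -
  show t: "tar_sequence V E k X X [X]" using assms by (simp add: tar_sequence_def)
  have "S' = X" if "tar_sequence V E k X S' Ss" for S' Ss
  proof (cases Ss rule: remdups_adj.cases)
    case (3 x y xs)
    then show ?thesis using that assms(1) by (auto simp: tar_sequence_def tar_step_def)
  qed (use that in \<open>auto simp: tar_sequence_def\<close>)
  then have "{card S' |S'. tar_reachable V E k X S'} = {card X}"
    using t by (auto simp: tar_reachable_def)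
  then show "card X = tar_lambda V E X k" by (simp add: tar_lambda_def)
qed

section \<open>Running the program\<close>

text \<open>One terminating run is demanded; by determinism of the language it is the only one.
  Result and cost are handled together.\<close>

definition wp :: "prog \<Rightarrow> tree list \<Rightarrow> exp \<Rightarrow> (tree \<Rightarrow> nat \<Rightarrow> bool) \<Rightarrow> bool" where
  "wp P env e Q \<longleftrightarrow> (\<exists>v t. eval P env e v t \<and> Q v t)"

definition wps :: "prog \<Rightarrow> tree list \<Rightarrow> exp list \<Rightarrow> (tree list \<Rightarrow> nat \<Rightarrow> bool) \<Rightarrow> bool" where
  "wps P env es Q \<longleftrightarrow> (\<exists>vs t. evals P env es vs t \<and> Q vs t)"

lemma wp_simps:
  "wp P env (Var i) Q \<longleftrightarrow> i < length env \<and> Q (env ! i) 1"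
  "wp P env exp.Nil Q \<longleftrightarrow> Q Leaf 1"
  "wp P env (exp.Cons e1 e2) Q \<longleftrightarrow>
    wp P env e1 (\<lambda>v1 t1. wp P env e2 (\<lambda>v2 t2. Q (Node v1 v2) (t1 + t2 + 1)))"
  "wp P env (Hd e) Q \<longleftrightarrow> wp P env e (\<lambda>v t. Q (head v) (t + 1))"
  "wp P env (Tl e) Q \<longleftrightarrow> wp P env e (\<lambda>v t. Q (tail v) (t + 1))"
  "wp P env (exp.If c e1 e2) Q \<longleftrightarrow>
    wp P env c (\<lambda>v t1. if v = Leaf then wp P env e2 (\<lambda>w t2. Q w (t1 + t2 + 1))
      else wp P env e1 (\<lambda>w t2. Q w (t1 + t2 + 1)))"
  "wp P env (exp.Let e1 e2) Q \<longleftrightarrow>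
    wp P env e1 (\<lambda>v t1. wp P (v # env) e2 (\<lambda>w t2. Q w (t1 + t2 + 1)))"
  "wps P env [] R \<longleftrightarrow> R [] 0"
  "wps P env (e # es) R \<longleftrightarrow>
    wp P env e (\<lambda>v t1. wps P env es (\<lambda>vs t2. R (v # vs) (t1 + t2)))"
  unfolding wp_def wps_def
  by (fastforce intro: eval_evals.intros
      elim: eval_VarE eval_NilE eval_ConsE eval_HdE eval_TlE eval_IfE eval_LetE evals_NilE evals_ConsE
      split: if_splits)+

section \<open>The program\<close>

text \<open>The names of the arguments are listed next to every function; \<open>Let\<close> shifts the de Bruijn
  indices by one.\<close>

abbreviation (input) "f_main \<equiv> 0 :: nat"
abbreviation (input) "f_finish \<equiv> Suc 0"
abbreviation (input) "f_eq \<equiv> 2 :: nat"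
abbreviation (input) "f_mem \<equiv> 3 :: nat"
abbreviation (input) "f_adj \<equiv> 4 :: nat"
abbreviation (input) "f_app \<equiv> 5 :: nat"
abbreviation (input) "f_diff \<equiv> 6 :: nat"
abbreviation (input) "f_inter \<equiv> 7 :: nat"
abbreviation (input) "f_shorter \<equiv> 8 :: nat"
abbreviation (input) "f_nonadj \<equiv> 9 :: nat"
abbreviation (input) "f_alladj \<equiv> 10 :: nat"
abbreviation (input) "f_indep \<equiv> 11 :: nat"
abbreviation (input) "f_splitters \<equiv> 12 :: nat"
abbreviation (input) "f_clos \<equiv> 13 :: nat"
abbreviation (input) "f_grow \<equiv> 14 :: nat"
abbreviation (input) "f_parts \<equiv> 15 :: nat"
abbreviation (input) "f_best \<equiv> 16 :: nat"
abbreviation (input) "f_solve \<equiv> 17 :: nat"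
abbreviation (input) "f_solves \<equiv> 18 :: nat"
abbreviation (input) "f_sel \<equiv> 19 :: nat"
abbreviation (input) "f_consall \<equiv> 20 :: nat"
abbreviation (input) "f_flips \<equiv> 21 :: nat"
abbreviation (input) "f_push \<equiv> 22 :: nat"
abbreviation (input) "f_tmem \<equiv> 23 :: nat"
abbreviation (input) "f_tins \<equiv> 24 :: nat"
abbreviation (input) "f_alt \<equiv> 25 :: nat"
abbreviation (input) "f_maps \<equiv> 26 :: nat"
abbreviation (input) "f_mapsrev \<equiv> 27 :: nat"
abbreviation (input) "f_search \<equiv> 28 :: nat"
abbreviation (input) "f_current \<equiv> 29 :: nat"
abbreviation (input) "f_supp \<equiv> 30 :: nat"
abbreviation (input) "f_snds \<equiv> 31 :: nat"
abbreviation (input) "f_improve \<equiv> 32 :: nat"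
abbreviation (input) "f_climb \<equiv> 33 :: nat"
abbreviation (input) "f_down \<equiv> 34 :: nat"
abbreviation (input) "f_up \<equiv> 35 :: nat"
abbreviation (input) "f_interp \<equiv> 36 :: nat"
abbreviation (input) "f_inc \<equiv> 37 :: nat"
abbreviation (input) "f_binlen \<equiv> 38 :: nat"
abbreviation (input) "f_thresh \<equiv> 39 :: nat"

text \<open>The same tree is also the pair of two empty lists, as at the end of
  \<open>solves_body\<close>, and the successful threshold 0, as for negative \<open>k\<close> in
  \<open>main_body\<close>.\<close>

abbreviation (input) "true_exp \<equiv> exp.Cons exp.Nil exp.Nil"

definition main_body :: exp where \<comment> \<open>x\<close>
  "main_body = exp.Let (exp.If (Hd (Tl (Tl (Var 0)))) true_exp (Call f_thresh [Tl (Tl (Tl (Var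
    0))), Hd (Tl (Var 0))])) (exp.If (Var 0) (Call f_finish [Call f_climb [Tl (Hd (Var 1)), Hd
    (Var 0), Tl (Call f_solve [Hd (Hd (Var 1)), Tl (Hd (Var 1)), Hd (Hd (Var 1))]), exp.Cons (Hd
    (Tl (Var 1))) exp.Nil]]) (exp.Cons (Hd (Tl (Var 1))) (exp.Cons (Hd (Tl (Var 1))) exp.Nil)))"

definition finish_body :: exp where \<comment> \<open>acc\<close>
  "finish_body = exp.Cons (Hd (Var 0)) (Call f_interp [Var 0, exp.Cons (Hd (Var 0)) exp.Nil])"

definition eq_body :: exp where \<comment> \<open>x, y\<close>
  "eq_body = exp.If (Var 0) (exp.If (Var 1) (exp.If (Call f_eq [Hd (Var 0), Hd (Var 1)]) (Call
    f_eq [Tl (Var 0), Tl (Var 1)]) exp.Nil) exp.Nil) (exp.If (Var 1) exp.Nil true_exp)"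

definition mem_body :: exp where \<comment> \<open>x, ys\<close>
  "mem_body = exp.If (Var 1) (exp.If (Call f_eq [Var 0, Hd (Var 1)]) true_exp (Call f_mem [Var 0,
    Tl (Var 1)])) exp.Nil"

definition adj_body :: exp where \<comment> \<open>E, u, v\<close>
  "adj_body = exp.If (Call f_mem [exp.Cons (Var 1) (Var 2), Var 0]) true_exp (Call f_mem [exp.Cons
    (Var 2) (Var 1), Var 0])"

definition app_body :: exp where \<comment> \<open>xs, ys\<close>
  "app_body = exp.If (Var 0) (exp.Cons (Hd (Var 0)) (Call f_app [Tl (Var 0), Var 1])) (Var 1)"

definition diff_body :: exp where \<comment> \<open>xs, ys\<close>
  "diff_body = exp.If (Var 0) (exp.If (Call f_mem [Hd (Var 0), Var 1]) (Call f_diff [Tl (Var 0),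
    Var 1]) (exp.Cons (Hd (Var 0)) (Call f_diff [Tl (Var 0), Var 1]))) exp.Nil"

definition inter_body :: exp where \<comment> \<open>xs, ys\<close>
  "inter_body = exp.If (Var 0) (exp.If (Call f_mem [Hd (Var 0), Var 1]) (exp.Cons (Hd (Var 0))
    (Call f_inter [Tl (Var 0), Var 1])) (Call f_inter [Tl (Var 0), Var 1])) exp.Nil"

definition shorter_body :: exp where \<comment> \<open>xs, ys\<close>
  "shorter_body = exp.If (Var 1) (exp.If (Var 0) (Call f_shorter [Tl (Var 0), Tl (Var 1)])
    true_exp) exp.Nil"

definition nonadj_body :: exp where \<comment> \<open>E, u, ys\<close>
  "nonadj_body = exp.If (Var 2) (exp.If (Call f_adj [Var 0, Var 1, Hd (Var 2)]) exp.Nil (Call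
    f_nonadj [Var 0, Var 1, Tl (Var 2)])) true_exp"

definition alladj_body :: exp where \<comment> \<open>E, u, ys\<close>
  "alladj_body = exp.If (Var 2) (exp.If (Call f_adj [Var 0, Var 1, Hd (Var 2)]) (Call f_alladj
    [Var 0, Var 1, Tl (Var 2)]) exp.Nil) true_exp"

definition indep_body :: exp where \<comment> \<open>E, xs\<close>
  "indep_body = exp.If (Var 1) (exp.If (Call f_nonadj [Var 0, Hd (Var 1), Tl (Var 1)]) (Call
    f_indep [Var 0, Tl (Var 1)]) exp.Nil) true_exp"

definition splitters_body :: exp where \<comment> \<open>E, C, M\<close>
  "splitters_body = exp.If (Var 1) (exp.If (Call f_nonadj [Var 0, Hd (Var 1), Var 2]) (Call
    f_splitters [Var 0, Tl (Var 1), Var 2]) (exp.If (Call f_alladj [Var 0, Hd (Var 1), Var 2])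
    (Call f_splitters [Var 0, Tl (Var 1), Var 2]) (exp.Cons (Hd (Var 1)) (Call f_splitters [Var 0,
    Tl (Var 1), Var 2])))) exp.Nil"

definition clos_body :: exp where \<comment> \<open>f, E, W, M\<close>
  "clos_body = exp.If (Var 0) (Call f_clos [Tl (Var 0), Var 1, Var 2, Call f_app [Call f_splitters
    [Var 1, Call f_diff [Var 2, Var 3], Var 3], Var 3]]) (Var 3)"

definition grow_body :: exp where \<comment> \<open>E, W, C, M\<close>
  "grow_body = exp.If (Var 2) (exp.If (Call f_mem [Hd (Var 2), Var 3]) (Call f_grow [Var 0, Var 1,
    Tl (Var 2), Var 3]) (exp.Let (Call f_clos [Var 1, Var 0, Var 1, exp.Cons (Hd (Var 2)) (Var
    3)]) (exp.If (Call f_diff [Var 2, Var 0]) (Call f_grow [Var 1, Var 2, Tl (Var 3), Var 0])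
    (Call f_grow [Var 1, Var 2, Tl (Var 3), Var 4])))) (Var 3)"

definition parts_body :: exp where \<comment> \<open>E, W, R\<close>
  "parts_body = exp.If (Var 2) (exp.Let (Call f_grow [Var 0, Var 1, Var 1, exp.Cons (Hd (Var 2))
    exp.Nil]) (exp.Cons (exp.Cons (Hd (Var 3)) (Call f_inter [Tl (Var 3), Var 0])) (Call f_parts
    [Var 1, Var 2, Call f_diff [Tl (Var 3), Var 0]]))) exp.Nil"

definition best_body :: exp where \<comment> \<open>E, cs, X\<close>
  "best_body = exp.If (Var 1) (exp.Let (Call f_best [Var 0, Tl (Var 1), Var 2]) (exp.Let (Call
    f_best [Var 1, Tl (Var 2), Call f_app [Tl (Hd (Var 2)), Var 3]]) (exp.If (Call f_shorter [Var
    1, Var 0]) (Var 0) (Var 1)))) (exp.If (Call f_indep [Var 0, Var 2]) (Var 2) exp.Nil)"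

definition solve_body :: exp where \<comment> \<open>f, E, W\<close>
  "solve_body = exp.If (Var 0) (exp.If (Tl (Var 2)) (exp.Let (Call f_solves [Tl (Var 0), Var 1,
    Call f_parts [Var 1, Var 2, Var 2]]) (exp.Cons (Call f_best [Var 2, Hd (Var 0), exp.Nil])
    (exp.Cons (exp.Cons (Var 3) (Hd (Var 0))) (Tl (Var 0))))) (exp.Cons (Var 2) (exp.Cons
    (exp.Cons (Var 2) (exp.Cons (exp.Cons (Var 2) (Var 2)) exp.Nil)) exp.Nil))) (exp.Cons (Var 2)
    (exp.Cons (exp.Cons (Var 2) (exp.Cons (exp.Cons (Var 2) (Var 2)) exp.Nil)) exp.Nil))"

definition solves_body :: exp where \<comment> \<open>f, E, Ps\<close>
  "solves_body = exp.If (Var 2) (exp.Let (Call f_solve [Var 0, Var 1, Hd (Var 2)]) (exp.Let (Call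
    f_solves [Var 1, Var 2, Tl (Var 3)]) (exp.Cons (exp.Cons (exp.Cons (Hd (Var 4)) (Hd (Var 1)))
    (Hd (Var 0))) (Call f_app [Tl (Var 1), Tl (Var 0)])))) true_exp"

definition sel_body :: exp where \<comment> \<open>cs, I, B\<close>
  "sel_body = exp.If (Var 1) (exp.If (Hd (Var 1)) (Call f_app [Hd (Var 0), Call f_sel [Tl (Var 0),
    Tl (Var 1), Var 2]]) (Call f_sel [Tl (Var 0), Tl (Var 1), Var 2])) (Var 2)"

definition consall_body :: exp where \<comment> \<open>b, Js\<close>
  "consall_body = exp.If (Var 1) (exp.Cons (exp.Cons (Var 0) (Hd (Var 1))) (Call f_consall [Var 0,
    Tl (Var 1)])) exp.Nil"

definition flips_body :: exp where \<comment> \<open>I\<close>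
  "flips_body = exp.If (Var 0) (exp.Cons (exp.Cons (exp.If (Hd (Var 0)) exp.Nil true_exp) (Tl (Var
    0))) (Call f_consall [Hd (Var 0), Call f_flips [Tl (Var 0)]])) exp.Nil"

definition push_body :: exp where \<comment> \<open>E, kk, B, cs, Js, p, st\<close>
  "push_body = exp.If (Var 4) (exp.Let (Call f_sel [Var 3, Hd (Var 4), Var 2]) (exp.If (Call
    f_shorter [Var 0, Var 2]) (Call f_push [Var 1, Var 2, Var 3, Var 4, Tl (Var 5), Var 6, Var 7])
    (exp.If (Call f_indep [Var 1, Var 0]) (Call f_push [Var 1, Var 2, Var 3, Var 4, Tl (Var 5),
    Var 6, exp.Cons (exp.Cons (Hd (Var 5)) (Var 6)) (Var 7)]) (Call f_push [Var 1, Var 2, Var 3,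
    Var 4, Tl (Var 5), Var 6, Var 7])))) (Var 6)"

definition tmem_body :: exp where \<comment> \<open>I, T\<close>
  "tmem_body = exp.If (Var 0) (Call f_tmem [Tl (Var 0), exp.If (Hd (Var 0)) (Tl (Var 1)) (Hd (Var
    1))]) (Var 1)"

definition tins_body :: exp where \<comment> \<open>I, T\<close>
  "tins_body = exp.If (Var 0) (exp.If (Hd (Var 0)) (exp.Cons (Hd (Var 1)) (Call f_tins [Tl (Var
    0), Tl (Var 1)])) (exp.Cons (Call f_tins [Tl (Var 0), Hd (Var 1)]) (Tl (Var 1)))) true_exp"

definition alt_body :: exp where \<comment> \<open>cs, As, I\<close>
  "alt_body = exp.If (Var 2) (exp.Cons (exp.If (Hd (Var 2)) (Hd (Var 0)) (Hd (Var 1))) (Call f_alt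
    [Tl (Var 0), Tl (Var 1), Tl (Var 2)])) exp.Nil"

definition maps_body :: exp where \<comment> \<open>B, cs, p, acc\<close>
  "maps_body = exp.If (Var 2) (exp.Cons (Call f_sel [Var 1, Hd (Var 2), Var 0]) (Call f_maps [Var
    0, Var 1, Tl (Var 2), Var 3])) (Var 3)"

definition mapsrev_body :: exp where \<comment> \<open>B, cs, p, acc\<close>
  "mapsrev_body = exp.If (Var 2) (Call f_mapsrev [Var 0, Var 1, Tl (Var 2), exp.Cons (Call f_sel
    [Var 1, Hd (Var 2), Var 0]) (Var 3)]) (Var 3)"

definition search_body :: exp where \<comment> \<open>E, kk, B, cs, As, I0, acc, st, vis\<close>
  "search_body = exp.If (Var 7) (exp.If (Call f_tmem [Hd (Hd (Var 7)), Var 8]) (Call f_search [Var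
    0, Var 1, Var 2, Var 3, Var 4, Var 5, Var 6, Tl (Var 7), Var 8]) (exp.If (Call f_shorter [Hd
    (Var 6), Call f_sel [Var 3, Hd (Hd (Var 7)), Var 2]]) (Call f_maps [Var 2, Var 3, Hd (Var 7),
    Var 6]) (exp.Let (Call f_alt [Var 3, Var 4, Hd (Hd (Var 7))]) (exp.If (Call f_shorter [Hd (Var
    7), Call f_sel [Var 0, Var 6, Var 3]]) (Call f_mapsrev [Var 3, Var 0, Hd (Var 8), Call f_maps
    [Var 3, Var 4, Hd (Var 8), Var 7]]) (Call f_search [Var 1, Var 2, Var 3, Var 4, Var 5, Var 6,
    Var 7, Call f_push [Var 1, Var 2, Var 3, Var 4, Call f_flips [Hd (Hd (Var 8))], Hd (Var 8), Tl
    (Var 8)], Call f_tins [Hd (Hd (Var 8)), Var 9]]))))) exp.Nil"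

definition current_body :: exp where \<comment> \<open>S, cs\<close>
  "current_body = exp.If (Var 1) (exp.Let (Call f_inter [Var 0, Hd (Hd (Var 1))]) (exp.Cons
    (exp.If (Var 0) (Var 0) (Tl (Hd (Var 2)))) (Call f_current [Var 1, Tl (Var 2)]))) exp.Nil"

definition supp_body :: exp where \<comment> \<open>S, cs\<close>
  "supp_body = exp.If (Var 1) (exp.Cons (exp.If (Call f_inter [Var 0, Hd (Hd (Var 1))]) true_exp
    exp.Nil) (Call f_supp [Var 0, Tl (Var 1)])) exp.Nil"

definition snds_body :: exp where \<comment> \<open>cs\<close>
  "snds_body = exp.If (Var 0) (exp.Cons (Tl (Hd (Var 0))) (Call f_snds [Tl (Var 0)])) exp.Nil"

definition improve_body :: exp where \<comment> \<open>E, kk, ns, acc\<close>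
  "improve_body = exp.If (Var 2) (exp.Let (Call f_supp [Hd (Var 3), Tl (Hd (Var 2))]) (exp.Let
    (Call f_search [Var 1, Var 2, Call f_diff [Hd (Var 4), Hd (Hd (Var 3))], Call f_current [Hd
    (Var 4), Tl (Hd (Var 3))], Call f_snds [Tl (Hd (Var 3))], Var 0, Var 4, exp.Cons (exp.Cons
    (Var 0) exp.Nil) exp.Nil, exp.Nil]) (exp.If (Var 0) (Var 0) (Call f_improve [Var 2, Var 3, Tl
    (Var 4), Var 5])))) exp.Nil"

definition climb_body :: exp where \<comment> \<open>E, kk, ns, acc\<close>
  "climb_body = exp.Let (Call f_improve [Var 0, Var 1, Var 2, Var 3]) (exp.If (Var 0) (Call
    f_climb [Var 1, Var 2, Var 3, Var 0]) (Var 4))"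

definition down_body :: exp where \<comment> \<open>B, D, out\<close>
  "down_body = exp.If (Var 1) (exp.Cons (Call f_app [Var 0, Var 1]) (Call f_down [Var 0, Tl (Var
    1), Var 2])) (exp.Cons (Var 0) (Var 2))"

definition up_body :: exp where \<comment> \<open>B, D, out\<close>
  "up_body = exp.If (Var 1) (Call f_up [Var 0, Tl (Var 1), exp.Cons (Call f_app [Var 0, Var 1])
    (Var 2)]) (exp.Cons (Var 0) (Var 2))"

definition interp_body :: exp where \<comment> \<open>acc, out\<close>
  "interp_body = exp.If (Tl (Var 0)) (exp.Let (Call f_inter [Hd (Var 0), Hd (Tl (Var 0))]) (Call
    f_interp [Tl (Var 1), Call f_down [Var 0, Call f_diff [Hd (Tl (Var 1)), Hd (Var 1)], Call f_up
    [Var 0, Call f_diff [Hd (Var 1), Hd (Tl (Var 1))], Var 2]]])) (Var 1)"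

definition inc_body :: exp where \<comment> \<open>n\<close>
  "inc_body = exp.If (Var 0) (exp.If (Hd (Var 0)) (exp.Cons exp.Nil (Call f_inc [Tl (Var 0)]))
    (exp.Cons true_exp (Tl (Var 0)))) (exp.Cons true_exp exp.Nil)"

definition binlen_body :: exp where \<comment> \<open>xs\<close>
  "binlen_body = exp.If (Var 0) (Call f_inc [Call f_binlen [Tl (Var 0)]]) exp.Nil"

definition thresh_body :: exp where \<comment> \<open>m, S\<close>
  "thresh_body = exp.If (Call f_eq [Var 0, Call f_binlen [Var 1]]) (exp.Cons (Var 1) exp.Nil)
    (exp.If (Var 1) (Call f_thresh [Var 0, Tl (Var 1)]) exp.Nil)"

definition prog :: prog where
  "prog = [main_body, finish_body, eq_body, mem_body, adj_body, app_body, diff_body, inter_body,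
    shorter_body, nonadj_body, alladj_body, indep_body, splitters_body, clos_body, grow_body,
    parts_body, best_body, solve_body, solves_body, sel_body, consall_body, flips_body, push_body,
    tmem_body, tins_body, alt_body, maps_body, mapsrev_body, search_body, current_body, supp_body,
    snds_body, improve_body, climb_body, down_body, up_body, interp_body, inc_body, binlen_body,
    thresh_body]"

text \<open>Calls get a constant of their own so that symbolic execution stops at them; a
  specification is applied there instead of unfolding the body.\<close>

definition call :: "nat \<Rightarrow> tree list \<Rightarrow> (tree \<Rightarrow> nat \<Rightarrow> bool) \<Rightarrow> bool" where
  "call f vs Q \<longleftrightarrow> f < length prog \<and> wp prog vs (prog ! f) Q"

lemma wp_Call: "wp prog env (Call f es) Q \<longleftrightarrow>
    wps prog env es (\<lambda>vs t1. call f vs (\<lambda>w t2. Q w (t1 + t2 + 1)))"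
  unfolding wp_def wps_def call_def by (fastforce intro: eval_Call elim: eval_CallE)

lemma call_unfold:
  "call f_main vs Q \<longleftrightarrow> wp prog vs main_body Q"
  "call f_finish vs Q \<longleftrightarrow> wp prog vs finish_body Q"
  "call f_eq vs Q \<longleftrightarrow> wp prog vs eq_body Q"
  "call f_mem vs Q \<longleftrightarrow> wp prog vs mem_body Q"
  "call f_adj vs Q \<longleftrightarrow> wp prog vs adj_body Q"
  "call f_app vs Q \<longleftrightarrow> wp prog vs app_body Q"
  "call f_diff vs Q \<longleftrightarrow> wp prog vs diff_body Q"
  "call f_inter vs Q \<longleftrightarrow> wp prog vs inter_body Q"
  "call f_shorter vs Q \<longleftrightarrow> wp prog vs shorter_body Q"
  "call f_nonadj vs Q \<longleftrightarrow> wp prog vs nonadj_body Q"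
  "call f_alladj vs Q \<longleftrightarrow> wp prog vs alladj_body Q"
  "call f_indep vs Q \<longleftrightarrow> wp prog vs indep_body Q"
  "call f_splitters vs Q \<longleftrightarrow> wp prog vs splitters_body Q"
  "call f_clos vs Q \<longleftrightarrow> wp prog vs clos_body Q"
  "call f_grow vs Q \<longleftrightarrow> wp prog vs grow_body Q"
  "call f_parts vs Q \<longleftrightarrow> wp prog vs parts_body Q"
  "call f_best vs Q \<longleftrightarrow> wp prog vs best_body Q"
  "call f_solve vs Q \<longleftrightarrow> wp prog vs solve_body Q"
  "call f_solves vs Q \<longleftrightarrow> wp prog vs solves_body Q"
  "call f_sel vs Q \<longleftrightarrow> wp prog vs sel_body Q"
  "call f_consall vs Q \<longleftrightarrow> wp prog vs consall_body Q"
  "call f_flips vs Q \<longleftrightarrow> wp prog vs flips_body Q"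
  "call f_push vs Q \<longleftrightarrow> wp prog vs push_body Q"
  "call f_tmem vs Q \<longleftrightarrow> wp prog vs tmem_body Q"
  "call f_tins vs Q \<longleftrightarrow> wp prog vs tins_body Q"
  "call f_alt vs Q \<longleftrightarrow> wp prog vs alt_body Q"
  "call f_maps vs Q \<longleftrightarrow> wp prog vs maps_body Q"
  "call f_mapsrev vs Q \<longleftrightarrow> wp prog vs mapsrev_body Q"
  "call f_search vs Q \<longleftrightarrow> wp prog vs search_body Q"
  "call f_current vs Q \<longleftrightarrow> wp prog vs current_body Q"
  "call f_supp vs Q \<longleftrightarrow> wp prog vs supp_body Q"
  "call f_snds vs Q \<longleftrightarrow> wp prog vs snds_body Q"
  "call f_improve vs Q \<longleftrightarrow> wp prog vs improve_body Q"
  "call f_climb vs Q \<longleftrightarrow> wp prog vs climb_body Q"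
  "call f_down vs Q \<longleftrightarrow> wp prog vs down_body Q"
  "call f_up vs Q \<longleftrightarrow> wp prog vs up_body Q"
  "call f_interp vs Q \<longleftrightarrow> wp prog vs interp_body Q"
  "call f_inc vs Q \<longleftrightarrow> wp prog vs inc_body Q"
  "call f_binlen vs Q \<longleftrightarrow> wp prog vs binlen_body Q"
  "call f_thresh vs Q \<longleftrightarrow> wp prog vs thresh_body Q"
  by (simp_all add: call_def prog_def)

lemmas unfold = call_unfold main_body_def finish_body_def eq_body_def mem_body_def adj_body_def
  app_body_def diff_body_def inter_body_def shorter_body_def nonadj_body_def alladj_body_def
  indep_body_def splitters_body_def clos_body_def grow_body_def parts_body_def best_body_def
  solve_body_def solves_body_def sel_body_def consall_body_def flips_body_def push_body_def
  tmem_body_def tins_body_def alt_body_def maps_body_def mapsrev_body_def search_body_def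
  current_body_def supp_body_def snds_body_def improve_body_def climb_body_def down_body_def
  up_body_def interp_body_def inc_body_def binlen_body_def thresh_body_def

section \<open>Specifications of the basic functions\<close>

text \<open>A mapped \<open>enc_list\<close> (see \<open>encl_eq\<close>), as a recursion of its own
  so that head and tail simplify without exposing \<open>map\<close>.\<close>

fun encl :: "('a \<Rightarrow> tree) \<Rightarrow> 'a list \<Rightarrow> tree" where
  "encl f [] = Leaf"
| "encl f (x # xs) = Node (f x) (encl f xs)"

abbreviation "nl \<equiv> encl enc_nat"

lemma encl_eq: "encl f xs = enc_list (map f xs)"
  by (induction xs) auto

lemma encl_eq_Leaf [simp]: "encl f xs = Leaf \<longleftrightarrow> xs = []"
  by (cases xs) auto

lemma Leaf_eq_encl [simp]: "Leaf = encl f xs \<longleftrightarrow> xs = []"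
  by (cases xs) auto

lemma tail_encl [simp]: "tail (encl f xs) = encl f (tl xs)"
  by (cases xs) auto

lemma head_encl [simp]: "xs \<noteq> [] \<Longrightarrow> head (encl f xs) = f (hd xs)"
  by (cases xs) auto

lemma enc_bool_eq_Leaf [simp]: "enc_bool b = Leaf \<longleftrightarrow> \<not> b" "Leaf = enc_bool b \<longleftrightarrow> \<not> b"
  by (cases b; simp)+

lemma enc_nat_inject [simp]: "enc_nat m = enc_nat n \<longleftrightarrow> m = n"
proof (induction m arbitrary: n rule: less_induct)
  case (less m)
  show ?case
  proof (cases "m = 0 \<or> n = 0")
    case True
    then show ?thesis by (auto simp: enc_nat.simps[of m] enc_nat.simps[of n])
  next
    case False
    have inj: "enc_bool a = enc_bool b \<longleftrightarrow> a = b" for a b by (cases a; cases b) auto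
    have "enc_nat m = enc_nat n \<longleftrightarrow> odd m = odd n \<and> m div 2 = n div 2"
      using False less[of "m div 2" "n div 2"] by (simp add: inj enc_nat.simps[of m] enc_nat.simps[of n])
    also have "\<dots> \<longleftrightarrow> m = n" by presburger
    finally show ?thesis .
  qed
qed

lemmas run = wp_simps wp_Call

declare One_nat_def [simp del]

text \<open>The form of all specifications: an arbitrary postcondition \<open>Q\<close> holds if it
  holds for every result and cost within the bounds. Such rules chain along the program text, since
  \<open>Q\<close> is whatever remains to be executed.\<close>

lemma call_eq:
  assumes "\<And>v t. v = enc_bool (x = y) \<Longrightarrow> t \<le> 40 * size x + 20 \<Longrightarrow> Q v t"
  shows "call f_eq [x, y] Q"
  using assms
proof (induction x arbitrary: y Q)
  case Leaf
  show ?case unfolding unfold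
    by (cases y) (auto simp: run intro!: Leaf)
next
  case (Node a b)
  show ?case unfolding unfold
    by (cases y) (auto simp: run intro!: Node)
qed

lemma call_app:
  assumes "\<And>v t. v = encl f (xs @ ys) \<Longrightarrow> t \<le> 20 * length xs + 20 \<Longrightarrow> Q v t"
  shows "call f_app [encl f xs, encl f ys] Q"
  using assms
proof (induction xs arbitrary: Q)
  case Nil
  show ?case unfolding unfold by (auto simp: run intro!: Nil)
next
  case (Cons x xs)
  show ?case unfolding unfold by (auto simp: run intro!: Cons)
qed

lemma call_shorter:
  assumes "\<And>v t. v = enc_bool (length xs < length ys) \<Longrightarrow> t \<le> 20 * length ys + 20 \<Longrightarrow> Q v t"
  shows "call f_shorter [encl f xs, encl g ys] Q"
  using assms
proof (induction ys arbitrary: xs Q)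
  case Nil
  show ?case unfolding unfold by (auto simp: run intro!: Nil)
next
  case (Cons y ys)
  show ?case unfolding unfold
    by (cases xs) (auto simp: run intro!: Cons)
qed

lemma call_mem_aux:
  assumes "inj f"
    and "\<And>v t. v = enc_bool (x \<in> set ys) \<Longrightarrow> t \<le> (length ys + 1) * (40 * size (f x) + 50) \<Longrightarrow> Q v t"
  shows "call f_mem [f x, encl f ys] Q"
  using assms(2)
proof (induction ys arbitrary: Q)
  case Nil
  show ?case unfolding unfold by (auto simp: run intro!: Nil)
next
  case (Cons y ys)
  show ?case unfolding unfold
    by (auto simp: run algebra_simps inj_eq[OF assms(1)] intro!: Cons call_eq)
qed

text \<open>Costs are bounded by powers of \<open>N\<close>; a loop over a list of vertices raises the exponent by
  two (see \<open>loop_cost\<close>).\<close>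

locale graph_instance =
  fixes V :: "nat set" and E :: "nat set set" and xE :: tree and N :: nat
  assumes graph: "finite_graph V E"
    and xE: "encodes_set encodes_edge E xE"
    and N_ge: "1000 \<le> N"
    and V_size: "v \<in> V \<Longrightarrow> size (enc_nat v) \<le> N"
    and card_V: "card V + 1 < N"
    and card_E: "card E < N"
begin

lemma pow_Suc: "1000 * N ^ a \<le> N ^ Suc a"
  using N_ge by simp

lemma pow_ge_1: "1 \<le> N ^ a"
  using N_ge by simp

lemma pow_mono: "a \<le> b \<Longrightarrow> N ^ a \<le> N ^ b"
  using N_ge by (intro power_increasing) auto

text \<open>One factor \<open>N\<close> pays for the number of rounds, the other one absorbs the
  constant 1000.\<close>

lemma loop_cost:
  assumes "n < N" "K \<le> 1000 * N ^ a"
  shows "(n + 1) * K \<le> N ^ (a + 2)"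
proof -
  have "(n + 1) * K \<le> N * (1000 * N ^ a)" using assms by (intro mult_mono) auto
  also have "\<dots> \<le> N * N ^ Suc a" using pow_Suc by (intro mult_left_mono) auto
  finally show ?thesis by simp
qed

lemma small_cost: "c \<le> 900 \<Longrightarrow> N ^ a + c \<le> 1000 * N ^ a"
  using pow_ge_1[of a] by linarith

lemma pow_ge: "0 < a \<Longrightarrow> 1000 \<le> N ^ a"
  using N_ge pow_mono[of 1 a] by simp

lemma no_loop: "{x} \<notin> E"
  using graph by (auto simp: finite_graph_def)

lemma fin_V: "finite V" using graph by (simp add: finite_graph_def)

definition vlist :: "nat list \<Rightarrow> bool" where
  "vlist xs \<longleftrightarrow> distinct xs \<and> set xs \<subseteq> V"

lemma vlist_simps [simp]:
  "vlist []"
  "vlist (x # xs) \<longleftrightarrow> x \<in> V \<and> x \<notin> set xs \<and> vlist xs"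
  by (auto simp: vlist_def)

lemma vlist_filter [simp]: "vlist xs \<Longrightarrow> vlist (filter P xs)"
  by (auto simp: vlist_def)

lemma vlist_append [simp]: "vlist (xs @ ys) \<longleftrightarrow> vlist xs \<and> vlist ys \<and> set xs \<inter> set ys = {}"
  by (auto simp: vlist_def)

lemma vlist_length_Suc: "vlist xs \<Longrightarrow> length xs + 1 < N"
  using card_mono[OF fin_V, of "set xs"] distinct_card[of xs] card_V by (simp add: vlist_def)

lemma vlist_length: "vlist xs \<Longrightarrow> length xs < N"
  using vlist_length_Suc[of xs] by simp

lemma call_mem:
  assumes "x \<in> V" "vlist ys" "\<And>v t. v = enc_bool (x \<in> set ys) \<Longrightarrow> t \<le> N ^ 3 \<Longrightarrow> Q v t"
  shows "call f_mem [enc_nat x, nl ys] Q"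
proof (rule call_mem_aux)
  have "(length ys + 1) * (40 * size (enc_nat x) + 50) \<le> N ^ (1 + 2)"
    using vlist_length[OF assms(2)] V_size[OF assms(1)] N_ge by (intro loop_cost) auto
  then show "Q v t" if "v = enc_bool (x \<in> set ys)" "t \<le> (length ys + 1) * (40 * size (enc_nat x) + 50)" for v t
    using assms(3) that by simp
qed (auto intro: injI)

lemma call_adj:
  assumes "u \<in> V" "v \<in> V" "\<And>w t. w = enc_bool ({u, v} \<in> E) \<Longrightarrow> t \<le> N ^ 4 \<Longrightarrow> Q w t"
  shows "call f_adj [xE, enc_nat u, enc_nat v] Q"
proof -
  obtain es ys where E: "distinct es" "set es = E" "list_all2 encodes_edge es ys" "xE = enc_list ys"
    using xE by (auto simp: encodes_set_def encodes_list_def)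
  have len: "length ys < N"
    using E card_E by (metis distinct_card list_all2_lengthD)
  have mem: "call f_mem [Node (enc_nat a) (enc_nat b), xE] R"
    if ab: "a \<in> V" "b \<in> V" and R: "\<And>w t. w = enc_bool (Node (enc_nat a) (enc_nat b) \<in> set ys) \<Longrightarrow> t \<le> N ^ 3 \<Longrightarrow> R w t"
    for a b R
  proof -
    let ?x = "Node (enc_nat a) (enc_nat b)"
    have "(length ys + 1) * (40 * size ?x + 50) \<le> N ^ (1 + 2)"
      using len V_size[OF ab(1)] V_size[OF ab(2)] N_ge by (intro loop_cost) auto
    then have "call f_mem [?x, encl (\<lambda>x. x) ys] R"
      using R by (intro call_mem_aux) (auto intro: injI)
    then show ?thesis by (simp add: E(4) encl_eq)
  qed
  \<comment> \<open>An edge is stored in one orientation only, and either one may occur; hence the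
    two lookups.\<close>
  have iff: "Node (enc_nat u) (enc_nat v) \<in> set ys \<or> Node (enc_nat v) (enc_nat u) \<in> set ys \<longleftrightarrow> {u, v} \<in> E"
  proof
    assume "{u, v} \<in> E"
    then obtain i where "i < length es" "es ! i = {u, v}" using E(2) by (metis in_set_conv_nth)
    then have "encodes_edge {u, v} (ys ! i)" "ys ! i \<in> set ys"
      using E(3) by (auto simp: list_all2_conv_all_nth)
    then show "Node (enc_nat u) (enc_nat v) \<in> set ys \<or> Node (enc_nat v) (enc_nat u) \<in> set ys"
      by (auto simp: encodes_edge_def doubleton_eq_iff)
  next
    have *: "{a, b} \<in> E" if ab: "Node (enc_nat a) (enc_nat b) \<in> set ys" for a b
    proof -
      obtain i where "i < length ys" "ys ! i = Node (enc_nat a) (enc_nat b)" using ab by (metis in_set_conv_nth)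
      then have "encodes_edge (es ! i) (Node (enc_nat a) (enc_nat b))" "es ! i \<in> E"
        using E(2,3) by (auto simp: list_all2_conv_all_nth)
      then show ?thesis by (auto simp: encodes_edge_def)
    qed
    show "Node (enc_nat u) (enc_nat v) \<in> set ys \<or> Node (enc_nat v) (enc_nat u) \<in> set ys \<Longrightarrow> {u, v} \<in> E"
      using *[of u v] *[of v u] by (auto simp: insert_commute)
  qed
  show ?thesis unfolding unfold
    using pow_Suc[of 3] pow_ge[of 3] assms(1,2) iff
    by (auto simp: run intro!: mem assms(3))
qed

text \<open>The pattern of all loops: the cost of a round is an opaque \<open>K\<close>, which keeps
  the induction linear; powers of \<open>N\<close> are compared afterwards by
  \<open>loop_cost\<close>.\<close>

lemma call_diff_aux:
  assumes "N ^ 3 + 100 \<le> K" "vlist xs" "vlist ys"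
    and "\<And>v t. v = nl (filter (\<lambda>x. x \<notin> set ys) xs) \<Longrightarrow> t \<le> (length xs + 1) * K \<Longrightarrow> Q v t"
  shows "call f_diff [nl xs, nl ys] Q"
  using assms(2,4)
proof (induction xs arbitrary: Q)
  case Nil
  show ?case unfolding unfold using assms(1) by (auto simp: run intro!: Nil)
next
  case (Cons x xs)
  show ?case unfolding unfold using Cons.prems(1) assms(1,3)
    by (auto simp: run intro!: Cons.IH Cons.prems(2) call_mem)
qed

lemma call_diff:
  assumes "vlist xs" "vlist ys" "\<And>v t. v = nl (filter (\<lambda>x. x \<notin> set ys) xs) \<Longrightarrow> t \<le> N ^ 5 \<Longrightarrow> Q v t"
  shows "call f_diff [nl xs, nl ys] Q"
proof -
  have "(length xs + 1) * (N ^ 3 + 100) \<le> N ^ (3 + 2)"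
    by (intro loop_cost small_cost vlist_length assms(1)) simp
  then show ?thesis using assms by (intro call_diff_aux[OF order.refl]) auto
qed

lemma call_inter_aux:
  assumes "N ^ 3 + 100 \<le> K" "vlist xs" "vlist ys"
    and "\<And>v t. v = nl (filter (\<lambda>x. x \<in> set ys) xs) \<Longrightarrow> t \<le> (length xs + 1) * K \<Longrightarrow> Q v t"
  shows "call f_inter [nl xs, nl ys] Q"
  using assms(2,4)
proof (induction xs arbitrary: Q)
  case Nil
  show ?case unfolding unfold using assms(1) by (auto simp: run intro!: Nil)
next
  case (Cons x xs)
  show ?case unfolding unfold using Cons.prems(1) assms(1,3)
    by (auto simp: run intro!: Cons.IH Cons.prems(2) call_mem)
qed

lemma call_inter:
  assumes "vlist xs" "vlist ys" "\<And>v t. v = nl (filter (\<lambda>x. x \<in> set ys) xs) \<Longrightarrow> t \<le> N ^ 5 \<Longrightarrow> Q v t"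
  shows "call f_inter [nl xs, nl ys] Q"
proof -
  have "(length xs + 1) * (N ^ 3 + 100) \<le> N ^ (3 + 2)"
    by (intro loop_cost small_cost vlist_length assms(1)) simp
  then show ?thesis using assms by (intro call_inter_aux[OF order.refl]) auto
qed

lemma call_nonadj_aux:
  assumes "N ^ 4 + 100 \<le> K" "u \<in> V" "vlist ys"
    and "\<And>v t. v = enc_bool (\<forall>y\<in>set ys. {u, y} \<notin> E) \<Longrightarrow> t \<le> (length ys + 1) * K \<Longrightarrow> Q v t"
  shows "call f_nonadj [xE, enc_nat u, nl ys] Q"
  using assms(3,4)
proof (induction ys arbitrary: Q)
  case Nil
  show ?case unfolding unfold using assms(1) by (auto simp: run intro!: Nil)
next
  case (Cons y ys)
  show ?case unfolding unfold using Cons.prems(1) assms(1,2)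
    by (auto simp: run intro!: Cons.IH Cons.prems(2) call_adj)
qed

lemma call_nonadj:
  assumes "u \<in> V" "vlist ys" "\<And>v t. v = enc_bool (\<forall>y\<in>set ys. {u, y} \<notin> E) \<Longrightarrow> t \<le> N ^ 6 \<Longrightarrow> Q v t"
  shows "call f_nonadj [xE, enc_nat u, nl ys] Q"
proof -
  have "(length ys + 1) * (N ^ 4 + 100) \<le> N ^ (4 + 2)"
    by (intro loop_cost small_cost vlist_length assms(2)) simp
  then show ?thesis using assms by (intro call_nonadj_aux[OF order.refl]) auto
qed

lemma call_alladj_aux:
  assumes "N ^ 4 + 100 \<le> K" "u \<in> V" "vlist ys"
    and "\<And>v t. v = enc_bool (\<forall>y\<in>set ys. {u, y} \<in> E) \<Longrightarrow> t \<le> (length ys + 1) * K \<Longrightarrow> Q v t"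
  shows "call f_alladj [xE, enc_nat u, nl ys] Q"
  using assms(3,4)
proof (induction ys arbitrary: Q)
  case Nil
  show ?case unfolding unfold using assms(1) by (auto simp: run intro!: Nil)
next
  case (Cons y ys)
  show ?case unfolding unfold using Cons.prems(1) assms(1,2)
    by (auto simp: run intro!: Cons.IH Cons.prems(2) call_adj)
qed

lemma call_alladj:
  assumes "u \<in> V" "vlist ys" "\<And>v t. v = enc_bool (\<forall>y\<in>set ys. {u, y} \<in> E) \<Longrightarrow> t \<le> N ^ 6 \<Longrightarrow> Q v t"
  shows "call f_alladj [xE, enc_nat u, nl ys] Q"
proof -
  have "(length ys + 1) * (N ^ 4 + 100) \<le> N ^ (4 + 2)"
    by (intro loop_cost small_cost vlist_length assms(2)) simp
  then show ?thesis using assms by (intro call_alladj_aux[OF order.refl]) auto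
qed

lemma indep_Cons: "indep E (set (x # xs)) \<longleftrightarrow> (\<forall>y\<in>set xs. {x, y} \<notin> E) \<and> indep E (set xs)"
  using no_loop[of x] unfolding indep_def by (auto simp: insert_commute)

lemma call_indep_aux:
  assumes "N ^ 6 + 100 \<le> K" "vlist xs"
    and "\<And>v t. v = enc_bool (indep E (set xs)) \<Longrightarrow> t \<le> (length xs + 1) * K \<Longrightarrow> Q v t"
  shows "call f_indep [xE, nl xs] Q"
  using assms(2,3)
proof (induction xs arbitrary: Q)
  case Nil
  show ?case unfolding unfold using assms(1) by (auto simp: run indep_def intro!: Nil)
next
  case (Cons x xs)
  show ?case unfolding unfold using Cons.prems(1) assms(1)
    by (auto simp: run indep_Cons simp del: list.set(2) intro!: Cons.IH Cons.prems(2) call_nonadj)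
qed

lemma call_indep:
  assumes "vlist xs" "\<And>v t. v = enc_bool (indep E (set xs)) \<Longrightarrow> t \<le> N ^ 8 \<Longrightarrow> Q v t"
  shows "call f_indep [xE, nl xs] Q"
proof -
  have "(length xs + 1) * (N ^ 6 + 100) \<le> N ^ (6 + 2)"
    by (intro loop_cost small_cost vlist_length assms(1)) simp
  then show ?thesis using assms by (intro call_indep_aux[OF order.refl]) auto
qed

end

section \<open>Specification of the decomposition\<close>

context graph_instance
begin

lemma call_splitters_aux:
  assumes "N ^ 7 \<le> K" "vlist C" "vlist M"
    and "\<And>v t. v = nl (splitters E C M) \<Longrightarrow> t \<le> (length C + 1) * K \<Longrightarrow> Q v t"
  shows "call f_splitters [xE, nl C, nl M] Q"
  using assms(2,4)
proof (induction C arbitrary: Q)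
  case Nil
  show ?case unfolding unfold using assms(1) pow_ge[of 7]
    by (auto simp: run splitters_def intro!: Nil)
next
  case (Cons c C)
  have "2 * N ^ 6 + 100 \<le> K" using assms(1) pow_Suc[of 6] pow_ge[of 6] by simp
  then show ?case unfolding unfold using Cons.prems(1) assms(3)
    by (auto simp: run splitters_def intro!: Cons.IH Cons.prems(2) call_nonadj call_alladj)
qed

lemma call_splitters:
  assumes "vlist C" "vlist M" "\<And>v t. v = nl (splitters E C M) \<Longrightarrow> t \<le> N ^ 9 \<Longrightarrow> Q v t"
  shows "call f_splitters [xE, nl C, nl M] Q"
proof -
  have "(length C + 1) * N ^ 7 \<le> N ^ (7 + 2)"
    by (intro loop_cost vlist_length assms(1)) simp
  then show ?thesis using assms by (intro call_splitters_aux[OF order.refl]) auto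
qed

lemma vlist_clos_step:
  "vlist W \<Longrightarrow> vlist M \<Longrightarrow> vlist (splitters E (filter (\<lambda>w. w \<notin> set M) W) M)"
  "set (splitters E (filter (\<lambda>w. w \<notin> set M) W) M) \<inter> set M = {}"
  by (auto simp: splitters_def)

text \<open>Only the length of the fuel list counts. In the absence of numbers the program passes
  \<open>W\<close> itself.\<close>

lemma call_clos_aux:
  assumes "N ^ 10 \<le> K" "vlist W" "vlist M"
    and "\<And>v t. v = nl (clos E (length fs) W M) \<Longrightarrow> t \<le> (length fs + 1) * K \<Longrightarrow> Q v t"
  shows "call f_clos [encl g fs, xE, nl W, nl M] Q"
  using assms(3,4)
proof (induction fs arbitrary: M Q)
  case Nil
  show ?case unfolding unfold using assms(1) pow_ge[of 10]
    by (auto simp: run intro!: Nil)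
next
  case (Cons f fs)
  let ?X = "splitters E (filter (\<lambda>w. w \<notin> set M) W) M"
  have "20 * length ?X \<le> 20 * N" using vlist_length[OF vlist_clos_step(1)[OF assms(2) Cons.prems(1)]] by simp
  then have "N ^ 5 + N ^ 9 + 20 * length ?X + 100 \<le> K"
    using assms(1) pow_Suc[of 9] pow_ge[of 9] pow_mono[of 5 9] pow_mono[of 1 9] by simp
  then show ?case unfolding unfold
    using Cons.prems(1) assms(2) vlist_clos_step(1)[of W M] vlist_clos_step(2)[of M W]
    by (auto simp: run intro!: Cons.IH Cons.prems(2) call_diff call_splitters call_app)
qed

lemma call_clos:
  assumes "length fs < N" "vlist W" "vlist M"
    and "\<And>v t. v = nl (clos E (length fs) W M) \<Longrightarrow> t \<le> N ^ 12 \<Longrightarrow> Q v t"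
  shows "call f_clos [encl g fs, xE, nl W, nl M] Q"
proof -
  have "(length fs + 1) * N ^ 10 \<le> N ^ (10 + 2)" by (intro loop_cost assms(1)) simp
  then show ?thesis using assms by (intro call_clos_aux[OF order.refl]) auto
qed

lemma vlist_clos: "vlist W \<Longrightarrow> vlist M \<Longrightarrow> set M \<subseteq> set W \<Longrightarrow> vlist (clos E n W M)"
  using clos_distinct[of M W E n] clos_subset[of M W E n] by (auto simp: vlist_def)

lemma call_grow_aux:
  assumes "N ^ 13 \<le> K" "vlist W" "set C \<subseteq> set W" "vlist M" "set M \<subseteq> set W"
    and "\<And>v t. v = nl (grow E W C M) \<Longrightarrow> t \<le> (length C + 1) * K \<Longrightarrow> Q v t"
  shows "call f_grow [xE, nl W, nl C, nl M] Q"
  using assms(3-)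
proof (induction C arbitrary: M Q)
  case Nil
  show ?case unfolding unfold using assms(1) pow_ge[of 13]
    by (auto simp: run intro!: Nil)
next
  case (Cons c C)
  have K: "N ^ 3 + N ^ 12 + N ^ 5 + 100 \<le> K"
    using assms(1) pow_Suc[of 12] pow_ge[of 12] pow_mono[of 5 12] pow_mono[of 3 12] by simp
  have c: "c \<in> V" "c \<in> set W" "set C \<subseteq> set W" using Cons.prems(1) assms(2) by (auto simp: vlist_def)
  show ?case
  proof (cases "c \<in> set M")
    case True
    then show ?thesis unfolding unfold using Cons.prems c K
      by (auto simp: run intro!: Cons.IH Cons.prems(4) call_mem)
  next
    case False
    let ?X = "clos E (length W) W (c # M)"
    have vX: "vlist ?X" "set ?X \<subseteq> set W"
      using vlist_clos[OF assms(2), of "c # M"] clos_subset[of "c # M" W] Cons.prems c False by auto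
    have e: "(filter (\<lambda>x. x \<notin> set ?X) W = []) = (set W \<subseteq> set ?X)"
      by (auto simp: filter_empty_conv)
    have cl: "call f_clos [nl W, xE, nl W, Node (enc_nat c) (nl M)] R"
      if "\<And>v t. v = nl ?X \<Longrightarrow> t \<le> N ^ 12 \<Longrightarrow> R v t" for R
      using call_clos[OF vlist_length[OF assms(2)] assms(2), of "c # M" R enc_nat] that Cons.prems c False by simp
    show ?thesis unfolding unfold
      using Cons.prems c K False vX assms(2) e
      by (auto simp: run Let_def intro!: Cons.IH Cons.prems(4) call_mem cl call_diff)
  qed
qed

lemma call_grow:
  assumes "vlist W" "u \<in> set W"
    and "\<And>v t. v = nl (grow E W W [u]) \<Longrightarrow> t \<le> N ^ 15 \<Longrightarrow> Q v t"
  shows "call f_grow [xE, nl W, nl W, Node (enc_nat u) Leaf] Q"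
proof -
  have "(length W + 1) * N ^ 13 \<le> N ^ (13 + 2)"
    by (intro loop_cost vlist_length assms(1)) simp
  moreover have "u \<in> V" using assms(1,2) by (auto simp: vlist_def)
  ultimately have "call f_grow [xE, nl W, nl W, nl [u]] Q"
    using assms by (intro call_grow_aux[OF order.refl]) auto
  then show ?thesis by simp
qed

lemma vlist_grow:
  assumes "vlist W" "set C \<subseteq> set W" "vlist M" "set M \<subseteq> set W"
  shows "vlist (grow E W C M)"
  using assms(2-)
proof (induction C arbitrary: M)
  case (Cons c C)
  have "c \<in> V" using Cons.prems(1) assms(1) by (auto simp: vlist_def)
  then show ?case
    using Cons vlist_clos[OF assms(1), of "c # M"] clos_subset[of "c # M" W] by (auto simp: Let_def)
qed simp

lemma call_parts_aux:
  assumes "N ^ 16 \<le> K" "vlist W" "vlist R" "set R \<subseteq> set W"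
    and "\<And>v t. v = encl nl (parts E W R) \<Longrightarrow> t \<le> (length R + 1) * K \<Longrightarrow> Q v t"
  shows "call f_parts [xE, nl W, nl R] Q"
  using assms(3-)
proof (induction "length R" arbitrary: R Q rule: less_induct)
  case less
  show ?case
  proof (cases R)
    case Nil
    show ?thesis unfolding unfold using assms(1) pow_ge[of 16]
      by (auto simp: run Nil intro!: less.prems(3))
  next
    case (Cons u R')
    let ?X = "grow E W W [u]"
    have u: "u \<in> V" "u \<in> set W" "vlist R'" "set R' \<subseteq> set W" using Cons less.prems(1,2) by auto
    have X: "vlist ?X" by (rule vlist_grow) (use assms(2) u in auto)
    let ?R = "filter (\<lambda>x. x \<notin> set ?X) R'"
    have K: "N ^ 15 + 2 * N ^ 5 + 100 \<le> K"
      using assms(1) pow_Suc[of 15] pow_ge[of 15] pow_mono[of 5 15] by simp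
    have le: "length ?R \<le> length R'" by simp
    then have leK: "(length ?R + 1) * K \<le> (length R' + 1) * K" by (intro mult_right_mono) auto
    have eqK: "(length R + 1) * K = K + (length R' + 1) * K" using Cons by simp
    have bound: "t1 + t2 + (t3 + t4) + 100 \<le> (length R + 1) * K"
      if "t1 \<le> N ^ 15" "t2 \<le> N ^ 5" "t3 \<le> N ^ 5" "t4 \<le> (length ?R + 1) * K" for t1 t2 t3 t4
      using that K leK eqK by linarith
    have IH: "call f_parts [xE, nl W, nl ?R] R"
      if "\<And>v t. v = encl nl (parts E W ?R) \<Longrightarrow> t \<le> (length ?R + 1) * K \<Longrightarrow> R v t" for R
      by (rule less.hyps) (use u Cons that le in \<open>auto simp: le_imp_less_Suc\<close>)
    show ?thesis unfolding unfold using u X assms(2)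
      apply (simp add: Cons run)
      apply (rule call_grow, assumption+)
      apply simp
      apply (rule call_inter, assumption+)
      apply simp
      apply (rule call_diff, assumption+)
      apply simp
      apply (rule IH)
      apply (rule less.prems(3))
       apply (simp add: Cons)
      subgoal for v t va ta vb tb vc tc using bound[of t ta tb tc] by simp
      done
  qed
qed

lemma call_parts:
  assumes "vlist W" "\<And>v t. v = encl nl (parts E W W) \<Longrightarrow> t \<le> N ^ 18 \<Longrightarrow> Q v t"
  shows "call f_parts [xE, nl W, nl W] Q"
proof -
  have "(length W + 1) * N ^ 16 \<le> N ^ (16 + 2)"
    by (intro loop_cost vlist_length assms(1)) simp
  then show ?thesis using assms by (intro call_parts_aux[OF order.refl]) auto
qed

end

section \<open>Maximum independent sets assembled from those of the parts\<close>

fun best :: "'a set set \<Rightarrow> ('a list \<times> 'a list) list \<Rightarrow> 'a list \<Rightarrow> 'a list" where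
  "best E [] X = (if indep E (set X) then X else [])"
| "best E (c # cs) X =
    (let p = best E cs X; q = best E cs (snd c @ X) in if length p < length q then q else p)"

lemma best_subset: "set (best E cs X) \<subseteq> set X \<union> set (concat (map snd cs))"
proof (induction cs arbitrary: X)
  case (Cons c cs)
  show ?case using Cons[of X] Cons[of "snd c @ X"] by (auto simp: Let_def)
qed auto

lemma best_distinct: "distinct (concat (map snd cs) @ X) \<Longrightarrow> distinct (best E cs X)"
proof (induction cs arbitrary: X)
  case (Cons c cs)
  have "distinct (concat (map snd cs) @ X)" "distinct (concat (map snd cs) @ snd c @ X)"
    using Cons.prems by auto
  then show ?case using Cons.IH by (simp add: Let_def)
qed auto

lemma concat_snd:
  assumes "distinct (concat (map fst cs))" "\<forall>(v, a)\<in>set cs. distinct a \<and> set a \<subseteq> set v"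
  shows "distinct (concat (map snd cs)) \<and> set (concat (map snd cs)) \<subseteq> set (concat (map fst cs))"
  using assms
proof (induction cs)
  case (Cons c cs)
  have c: "distinct (snd c)" "set (snd c) \<subseteq> set (fst c)" using Cons.prems(2) by (auto split: prod.splits)
  have IH: "distinct (concat (map snd cs))" "set (concat (map snd cs)) \<subseteq> set (concat (map fst cs))"
    using Cons by simp_all
  have "set (fst c) \<inter> set (concat (map fst cs)) = {}" using Cons.prems(1) by simp
  then have "set (snd c) \<inter> set (concat (map snd cs)) = {}" using c(2) IH(2) by blast
  moreover have "set (snd c) \<union> set (concat (map snd cs)) \<subseteq> set (fst c) \<union> set (concat (map fst cs))"
    using c(2) IH(2) by (rule Un_mono)
  ultimately show ?case using c(1) IH(1) by simp
qed simp

lemma node_ok_concat_snd: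
  assumes "node_ok V E W cs"
  shows "distinct (concat (map snd cs))" "set (concat (map snd cs)) \<subseteq> set W"
proof -
  have "distinct (concat (map fst cs))" "\<forall>(v, a)\<in>set cs. distinct a \<and> set a \<subseteq> set v"
    using assms by (auto simp: node_ok_def maxind_def)
  from concat_snd[OF this] show "distinct (concat (map snd cs))" "set (concat (map snd cs)) \<subseteq> set W"
    using assms by (simp_all add: node_ok_def)
qed

lemma best_indep: "indep E (set (best E cs X))"
  by (induction cs arbitrary: X) (auto simp: Let_def indep_def)

lemma best_length:
  assumes "length I = length cs" "indep E (set (sel (map snd cs) I X))"
  shows "length (sel (map snd cs) I X) \<le> length (best E cs X)"
  using assms
proof (induction cs arbitrary: I X)
  case (Cons c cs)
  obtain b I' where I: "I = b # I'" "length I' = length cs" using Cons.prems(1) by (cases I) auto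
  show ?case
  proof (cases b)
    case False
    then show ?thesis using Cons.IH[of I' X] Cons.prems(2) I by (auto simp: Let_def)
  next
    case True
    have "set (sel (map snd cs) I' (snd c @ X)) = set (snd c) \<union> set (sel (map snd cs) I' X)"
      "length (sel (map snd cs) I' (snd c @ X)) = length (snd c) + length (sel (map snd cs) I' X)"
      using I(2) by (auto simp: set_sel length_sel)
    then show ?thesis using Cons.IH[of I' "snd c @ X"] Cons.prems(2) I True by (auto simp: Let_def)
  qed
qed auto

text \<open>In each part that \<open>X\<close> meets, \<open>X\<close> may be replaced by the
  maximum set of that part without losing independence or elements; so some union of such maxima is
  a maximum, and \<open>best\<close> tries all of them. The locale is instantiated with the empty
  set just for its facts about parts.\<close>

lemma maxind_best:
  assumes ok: "node_ok V E W cs"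
  shows "maxind E (set W) (best E cs [])"
proof -
  interpret node_search V E "[]" W cs 0
    by unfold_locales (auto simp: ok coarse_set_def indep_def)
  have "card X \<le> length (best E cs [])" if X: "X \<subseteq> set W" "indep E X" for X
  proof -
    let ?I = "supp X cs"
    have "indep E (set [] \<union> (\<Union>i\<in>{i. i < s \<and> ?I ! i}. set (As ! i)))"
    proof (rule indep_transfer[where V = V and v = v and f = "\<lambda>i. X \<inter> v i"])
      show "indep E (set [] \<union> (\<Union>i\<in>{i. i < s \<and> ?I ! i}. X \<inter> v i))"
        using X(2) by (rule indep_subset) auto
    qed (use child v_disjoint A_props As_nth in \<open>auto simp: supp_nth\<close>)
    then have "indep E (set (sel As ?I []))" by (simp add: set_sel)
    then have "length (sel As ?I []) \<le> length (best E cs [])"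
      unfolding As_def by (intro best_length) simp_all
    moreover have "card X \<le> length (sel As ?I [])"
    proof -
      have "card (X \<inter> v i) \<le> (if ?I ! i then length (As ! i) else 0)" if "i < s" for i
        using A_props(4)[OF that, of "X \<inter> v i"] X(2) As_nth[OF that] supp_nth[OF that, of X]
        by (auto intro: indep_subset)
      then show ?thesis unfolding card_W[OF X(1)] by (auto simp: length_sel intro!: sum_mono)
    qed
    ultimately show ?thesis by simp
  qed
  moreover have "set (best E cs []) \<subseteq> set W"
    using best_subset[of E cs "[]"] node_ok_concat_snd(2)[OF ok] by auto
  ultimately show ?thesis
    using best_indep best_distinct[of cs "[]"] node_ok_concat_snd(1)[OF ok] by (auto simp: maxind_def)
qed

fun enc_child :: "nat list \<times> nat list \<Rightarrow> tree" where
  "enc_child (v, a) = Node (nl v) (nl a)"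

fun enc_node :: "nat list \<times> (nat list \<times> nat list) list \<Rightarrow> tree" where
  "enc_node (W, cs) = Node (nl W) (encl enc_child cs)"

context graph_instance
begin

lemma linear_cost: "40 * N + 200 \<le> N ^ (a + 2)"
proof -
  have "40 * N + 200 \<le> 1000 * N ^ 1" using N_ge by simp
  also have "\<dots> \<le> N ^ Suc 1" by (rule pow_Suc)
  also have "\<dots> \<le> N ^ (a + 2)" by (rule pow_mono) simp
  finally show ?thesis .
qed

lemma vlist_best: "vlist (concat (map snd cs) @ X) \<Longrightarrow> vlist (best E cs X)"
  using best_subset[of E cs X] best_distinct[of cs X E] unfolding vlist_def
  by (auto simp del: set_concat)

text \<open>The recurrence is \<open>T (s + 1) = 2 * T s + overhead\<close>. In the bound
  \<open>(2 ^ (s + 1) - 1) * N ^ 9\<close> the doubled subtrahend leaves one \<open>N ^ 9\<close>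
  for the overhead.\<close>

lemma call_best:
  assumes "vlist (concat (map snd cs) @ X)"
    and "\<And>v t. v = nl (best E cs X) \<Longrightarrow> t + N ^ 9 \<le> 2 ^ (length cs + 1) * N ^ 9 \<Longrightarrow> Q v t"
  shows "call f_best [xE, encl enc_child cs, nl X] Q"
  using assms
proof (induction cs arbitrary: X Q)
  case Nil
  then show ?case unfolding unfold using pow_Suc[of 8] pow_ge[of 8]
    by (auto simp: run intro!: Nil.prems(2) call_indep)
next
  case (Cons c cs)
  obtain v a where c: "c = (v, a)" by (cases c)
  have vl: "vlist (concat (map snd cs) @ X)" "vlist (concat (map snd cs) @ a @ X)"
    using Cons.prems(1) c by auto
  have la: "20 * length a \<le> 20 * N" using Cons.prems(1) c by (auto dest!: vlist_length)
  have lq: "20 * length (best E cs (a @ X)) \<le> 20 * N"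
    using vlist_length[OF vlist_best[OF vl(2)]] by simp
  have K: "40 * N + 200 \<le> N ^ 9"
    using linear_cost[of 7] by simp
  show ?case unfolding unfold
    apply (simp add: run c)
    apply (rule Cons.IH[OF vl(1)])
    apply simp
    apply (rule call_app)
    apply simp
    apply (rule Cons.IH[OF vl(2)])
    apply simp
    apply (rule call_shorter)
    apply simp
    apply (intro conjI impI; rule Cons.prems(2))
    using la lq K by (auto simp: c Let_def)
qed

definition width :: nat where "width = modular_width V E"

definition solve_cost :: nat where "solve_cost = 2 ^ width * N ^ 19"

lemma solve_cost_ge: "2 ^ a * N ^ 19 \<le> solve_cost" if "a \<le> width"
  unfolding solve_cost_def using that by (intro mult_right_mono power_increasing) auto

lemma solve_cost_ge_pow: "N ^ 19 \<le> solve_cost"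
  using solve_cost_ge[of 0] by simp

text \<open>The bound for one part is \<open>(4 * length P - 3) * solve_cost\<close> without
  subtraction. The loop adds one unit per part, which leaves -2 for each; with at least two parts
  that is -4, and the node's own work brings it back to -3.\<close>

lemma call_solves:
  assumes IH: "\<And>P R. P \<in> set Ps \<Longrightarrow>
      (\<And>v t A ns. decomp V E width P A ns \<Longrightarrow> v = Node (nl A) (encl enc_node ns) \<Longrightarrow>
        t + 3 * solve_cost \<le> 4 * length P * solve_cost \<Longrightarrow> R v t) \<Longrightarrow>
      call f_solve [fuel, xE, nl P] R"
    and "\<And>P. P \<in> set Ps \<Longrightarrow> P \<noteq> [] \<and> vlist P"
    and "\<And>v t rs. list_all2 (\<lambda>P r. decomp V E width P (fst r) (snd r)) Ps rs \<Longrightarrow>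
      v = Node (encl enc_child (zip Ps (map fst rs))) (encl enc_node (concat (map snd rs))) \<Longrightarrow>
      t + 2 * length Ps * solve_cost \<le> 4 * length (concat Ps) * solve_cost + 10 \<Longrightarrow> Q v t"
  shows "call f_solves [fuel, xE, encl nl Ps] Q"
  using assms
proof (induction Ps arbitrary: Q)
  case Nil
  show ?case unfolding unfold
    by (auto simp: run intro!: Nil.prems(3)[of "[]"])
next
  case (Cons P Ps)
  have P: "P \<noteq> []" "vlist P" using Cons.prems(2)[of P] by auto
  have K: "40 * N + 200 \<le> solve_cost"
    using solve_cost_ge_pow linear_cost[of 17] by simp
  show ?case unfolding unfold
    apply (simp add: run)
    apply (rule Cons.prems(1)[of P], simp)
    subgoal premises prems1 for v t A ns
      apply (simp add: prems1(2))
      apply (rule Cons.IH)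
        apply (rule Cons.prems(1); simp)
       apply (rule Cons.prems(2), simp)
      subgoal premises prems2 for rs v' t'
        apply (simp add: prems2(2))
        apply (rule call_app)
        apply (rule Cons.prems(3)[of "(A, ns) # rs"])
          apply (simp add: prems1(1) prems2(1))
         apply simp
        using prems1(3) prems2(3) decomp_length[OF prems1(1) P(1)] vlist_length[OF P(2)] K
        by (simp add: algebra_simps)
      done
    done
qed

lemma length_part: "P \<in> set Ps \<Longrightarrow> 2 \<le> length Ps \<Longrightarrow> [] \<notin> set Ps \<Longrightarrow> length P < length (concat Ps)"
proof -
  assume P: "P \<in> set Ps" "2 \<le> length Ps" "[] \<notin> set Ps"
  then obtain xs ys where Ps: "Ps = xs @ P # ys" by (meson split_list)
  then have "xs \<noteq> [] \<or> ys \<noteq> []" using P(2) by auto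
  then have "concat xs \<noteq> [] \<or> concat ys \<noteq> []" using P(3) Ps by (cases xs; cases ys) auto
  then show ?thesis using Ps by auto
qed

lemma solve_cost_leaf:
  assumes "c \<le> 1000"
  shows "c + 3 * solve_cost \<le> 4 * max 1 n * solve_cost"
proof -
  have "1000 \<le> solve_cost" using solve_cost_ge_pow pow_ge[of 19] by simp
  moreover have "4 * 1 * solve_cost \<le> 4 * max 1 n * solve_cost" by (intro mult_right_mono) auto
  ultimately show ?thesis using assms by linarith
qed

text \<open>The fuel suffices because parts are strictly shorter than \<open>W\<close>. The
  \<open>max 1\<close> provides for the empty graph; parts are never empty.\<close>

lemma call_solve:
  assumes "vlist W" "is_module V E (set W)" "length W \<le> length fs"
    and "\<And>v t A ns. decomp V E width W A ns \<Longrightarrow> v = Node (nl A) (encl enc_node ns) \<Longrightarrow>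
      t + 3 * solve_cost \<le> 4 * max 1 (length W) * solve_cost \<Longrightarrow> Q v t"
  shows "call f_solve [encl g fs, xE, nl W] Q"
  using assms
proof (induction fs arbitrary: W Q)
  case Nil
  have "decomp V E width W W [(W, [(W, W)])]"
    using Nil.prems by (intro decomp.leaf) (auto simp: vlist_def)
  then show ?case unfolding unfold
    by (auto simp: run intro!: Nil.prems(4) solve_cost_leaf)
next
  case (Cons f fs)
  have W: "distinct W" "set W \<subseteq> V" using Cons.prems(1) by (auto simp: vlist_def)
  show ?case
  proof (cases "tl W = []")
    case True
    then have "length W \<le> 1" by (cases W) auto
    then have "decomp V E width W W [(W, [(W, W)])]"
      using Cons.prems W by (intro decomp.leaf) auto
    then show ?thesis unfolding unfold using True
      by (auto simp: run intro!: Cons.prems(4) solve_cost_leaf)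
  next
    case False
    then have len: "2 \<le> length W" by (cases W rule: remdups_adj.cases) auto
    \<comment> \<open>Modular width does not grow in induced subgraphs, so the width of the whole
      graph bounds the number of parts at every node.\<close>
    have mw: "mw_at_most width (set W) (induced_edges E (set W))"
      unfolding width_def by (rule mw_at_most_induced[OF mw_at_most_modular_width[OF fin_V] W(2)])
    let ?Ps = "parts E W W"
    note Ps = parts_correct[OF W(1) len mw]
    have basic: "distinct (concat ?Ps)" "set (concat ?Ps) = set W" "[] \<notin> set ?Ps"
      using parts_basic(2)[OF W(1)] parts_basic(1)[of E W W] parts_basic(3)[of E W W] by auto
    have lenW: "length (concat ?Ps) = length W" using basic W by (metis distinct_card)
    have vP: "P \<noteq> [] \<and> vlist P" if "P \<in> set ?Ps" for P
    proof -
      have "set P \<subseteq> set W" "distinct P" using basic that by (auto simp: distinct_concat_iff)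
      then show ?thesis using basic(3) that W(2) by (auto simp: vlist_def)
    qed
    have IH: "call f_solve [encl g fs, xE, nl P] R" if P: "P \<in> set ?Ps"
      and R: "\<And>v t A ns. decomp V E width P A ns \<Longrightarrow> v = Node (nl A) (encl enc_node ns) \<Longrightarrow>
        t + 3 * solve_cost \<le> 4 * length P * solve_cost \<Longrightarrow> R v t" for P R
    proof (rule Cons.IH)
      show "length P \<le> length fs" using length_part[OF P Ps(2) basic(3)] lenW Cons.prems(3) by simp
      show "is_module V E (set P)" using is_module_trans[OF Cons.prems(2)] Ps(1) P by blast
      have "max 1 (length P) = length P" using vP[OF P] by (cases P) auto
      then show "R v t" if "decomp V E width P A ns" "v = Node (nl A) (encl enc_node ns)"
        "t + 3 * solve_cost \<le> 4 * max 1 (length P) * solve_cost" for v t A ns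
        using R[OF that(1,2)] that(3) by simp
    qed (use vP P in auto)
    show ?thesis unfolding unfold
      apply (simp add: run False)
      apply (rule call_parts[OF Cons.prems(1)])
      apply simp
      apply (rule call_solves[OF IH vP], assumption+)
      subgoal premises prems for v1 t1 v2 t2 rs
      proof -
        let ?cs = "zip ?Ps (map fst rs)"
        have lrs: "length ?Ps = length rs" using prems(3) by (rule list_all2_lengthD)
        have "is_module (set W) E (set v) \<and> maxind E (set v) a" if va: "(v, a) \<in> set ?cs" for v a
        proof -
          obtain i where i: "i < length ?Ps" "v = ?Ps ! i" "a = fst (rs ! i)"
            using va lrs by (auto simp: in_set_zip)
          have "decomp V E width v a (snd (rs ! i))"
            using list_all2_nthD[OF prems(3) i(1)] by (simp add: i)
          from decomp_maxind[OF this no_loop] show ?thesis using Ps(1) i by simp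
        qed
        then have ok: "node_ok V E W ?cs"
          using W Cons.prems(2) basic lrs by (auto simp: node_ok_def)
        have dec: "decomp V E width W (best E ?cs []) ((W, ?cs) # concat (map snd rs))"
          using W Cons.prems(2) Ps basic prems(3) maxind_best[OF ok] by (intro decomp.split) auto
        have vl: "vlist (concat (map snd ?cs) @ [])"
          using node_ok_concat_snd[OF ok] W(2) by (auto simp: vlist_def)
        have "2 ^ length ?Ps * N ^ 19 \<le> solve_cost" using Ps(3) by (rule solve_cost_ge)
        moreover have "N ^ 18 + 2 * (2 ^ length ?Ps * N ^ 9) + 1000 \<le> 2 ^ length ?Ps * N ^ 19"
        proof -
          have "2 ^ length ?Ps * (N ^ 18 + 2 * N ^ 9 + 1000) \<le> 2 ^ length ?Ps * N ^ 19"
            using pow_Suc[of 18] pow_mono[of 9 18] pow_ge[of 18] by (intro mult_left_mono) auto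
          moreover have "N ^ 18 + 1000 \<le> 2 ^ length ?Ps * (N ^ 18 + 1000)" by simp
          ultimately show ?thesis by (simp add: algebra_simps)
        qed
        moreover have "2 ^ (length ?Ps + 1) * N ^ 9 = 2 * (2 ^ length ?Ps * N ^ 9)" by (simp add: power_add)
        ultimately have cost: "N ^ 18 + 2 ^ (length ?Ps + 1) * N ^ 9 + 1000 \<le> solve_cost" by linarith
        have slack: "4 * solve_cost \<le> 2 * length ?Ps * solve_cost" using Ps(2) by (intro mult_right_mono) auto
        have mx: "max 1 (length W) = length W" using len by simp
        show ?thesis
          apply (simp add: prems(4))
          apply (rule call_best[OF vl, simplified])
          apply (rule Cons.prems(4)[OF dec])
           apply simp
          subgoal premises q for v t
            using q(2) prems(2,5) cost slack unfolding mx lrs lenW min.idem by linarith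
          done
      qed
      done
  qed
qed

end

section \<open>Specification of the search at a node\<close>

abbreviation "bl \<equiv> encl enc_bool"

lemma call_consall:
  assumes "\<And>v t. v = encl bl (map ((#) b) Js) \<Longrightarrow> t \<le> 20 * length Js + 20 \<Longrightarrow> Q v t"
  shows "call f_consall [enc_bool b, encl bl Js] Q"
  using assms
proof (induction Js arbitrary: Q)
  case Nil
  show ?case unfolding unfold by (auto simp: run intro!: Nil)
next
  case (Cons J Js)
  show ?case unfolding unfold by (auto simp: run intro!: Cons)
qed

lemma call_flips:
  assumes "length I \<le> n"
    and "\<And>v t. v = encl bl (flips I) \<Longrightarrow> t \<le> (length I + 1) * (20 * n + 100) \<Longrightarrow> Q v t"
  shows "call f_flips [bl I] Q"
  using assms
proof (induction I arbitrary: Q)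
  case Nil
  show ?case unfolding unfold by (auto simp: run intro!: Nil)
next
  case (Cons b I)
  show ?case unfolding unfold using Cons.prems(1)
    by (cases b) (auto simp: run algebra_simps intro!: Cons.IH Cons.prems(2)
        call_consall[where b = True, simplified] call_consall[where b = False, simplified])
qed

text \<open>Visited states are stored in a trie that branches on the bits of the state.\<close>

fun tmem :: "bool list \<Rightarrow> tree \<Rightarrow> tree" where
  "tmem [] T = T"
| "tmem (b # I) T = tmem I (if b then tail T else head T)"

fun tins :: "bool list \<Rightarrow> tree \<Rightarrow> tree" where
  "tins [] T = Node Leaf Leaf"
| "tins (b # I) T =
    (if b then Node (head T) (tins I (tail T)) else Node (tins I (head T)) (tail T))"

text \<open>Equal length matters: no stored state is then a proper prefix of another, so a nonempty
  subtree at that depth means membership.\<close>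

lemma tmem_tins:
  "length I = length J \<Longrightarrow> tmem I (tins J T) \<noteq> Leaf \<longleftrightarrow> I = J \<or> tmem I T \<noteq> Leaf"
  by (induction I J arbitrary: T rule: list_induct2) auto

lemma tmem_Leaf [simp]: "tmem I Leaf = Leaf"
  by (induction I) auto

text \<open>The cost depends on the number of bits and not on the number of stored states. Scanning
  a list of visited states would square the exponential factor.\<close>

lemma call_tmem:
  assumes "\<And>v t. v = tmem I T \<Longrightarrow> t \<le> 20 * length I + 20 \<Longrightarrow> Q v t"
  shows "call f_tmem [bl I, T] Q"
  using assms
proof (induction I arbitrary: T Q)
  case Nil
  show ?case unfolding unfold by (auto simp: run intro!: Nil)
next
  case (Cons b I)
  show ?case unfolding unfold by (auto simp: run intro!: Cons)
qed

lemma call_tins: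
  assumes "\<And>v t. v = tins I T \<Longrightarrow> t \<le> 20 * length I + 20 \<Longrightarrow> Q v t"
  shows "call f_tins [bl I, T] Q"
  using assms
proof (induction I arbitrary: T Q)
  case Nil
  show ?case unfolding unfold by (auto simp: run intro!: Nil)
next
  case (Cons b I)
  show ?case unfolding unfold by (auto simp: run intro!: Cons)
qed

lemma call_alt:
  assumes "length cs = length I" "length As = length I"
    and "\<And>v t. v = encl f (alt cs As I) \<Longrightarrow> t \<le> 30 * length I + 20 \<Longrightarrow> Q v t"
  shows "call f_alt [encl f cs, encl f As, bl I] Q"
  using assms
proof (induction cs As I arbitrary: Q rule: alt.induct)
  case (1 c cs a As b I)
  show ?case unfolding unfold using 1 by (auto simp: run intro!: "1.IH" "1.prems"(3))
qed (simp_all add: run unfold)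

lemma call_sel:
  assumes "length cs = length I" "\<And>c. c \<in> set cs \<Longrightarrow> length c \<le> n"
    and "\<And>v t. v = encl f (sel cs I B) \<Longrightarrow> t \<le> (length I + 1) * (20 * n + 100) \<Longrightarrow> Q v t"
  shows "call f_sel [encl (encl f) cs, bl I, encl f B] Q"
  using assms
proof (induction cs arbitrary: I Q)
  case Nil
  then show ?case unfolding unfold by (auto simp: run intro!: Nil)
next
  case (Cons c cs)
  obtain b I' where I: "I = b # I'" "length cs = length I'" using Cons.prems(1) by (cases I) auto
  have c: "length c \<le> n" "\<And>c'. c' \<in> set cs \<Longrightarrow> length c' \<le> n" using Cons.prems(2) by auto
  show ?case unfolding unfold using I c
    by (auto simp: run algebra_simps intro!: Cons.IH Cons.prems(3) call_app)
qed

lemma call_snds: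
  assumes "\<And>v t. v = encl nl (map snd cs) \<Longrightarrow> t \<le> 20 * length cs + 20 \<Longrightarrow> Q v t"
  shows "call f_snds [encl enc_child cs] Q"
  using assms
proof (induction cs arbitrary: Q)
  case Nil
  show ?case unfolding unfold by (auto simp: run intro!: Nil)
next
  case (Cons c cs)
  show ?case unfolding unfold by (cases c) (auto simp: run intro!: Cons)
qed

context graph_instance
begin

lemma call_current_aux:
  assumes "N ^ 5 + 100 \<le> K" "vlist S" "\<And>v a. (v, a) \<in> set cs \<Longrightarrow> vlist v"
    and "\<And>v t. v = encl nl (current S cs) \<Longrightarrow> t \<le> (length cs + 1) * K \<Longrightarrow> Q v t"
  shows "call f_current [nl S, encl enc_child cs] Q"
  using assms(3,4)
proof (induction cs arbitrary: Q)
  case Nil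
  show ?case unfolding unfold using assms(1) by (auto simp: run current_def intro!: Nil)
next
  case (Cons c cs)
  obtain v a where c: "c = (v, a)" by (cases c)
  have v: "vlist v" "\<And>v a. (v, a) \<in> set cs \<Longrightarrow> vlist v" using Cons.prems(1) c by auto
  show ?case unfolding unfold using assms(1,2) v
    by (auto simp: run c current_def Let_def intro!: Cons.IH[unfolded current_def Let_def] Cons.prems(2) call_inter)
qed

lemma call_current:
  assumes "vlist S" "\<And>v a. (v, a) \<in> set cs \<Longrightarrow> vlist v" "length cs < N"
    and "\<And>v t. v = encl nl (current S cs) \<Longrightarrow> t \<le> N ^ 7 \<Longrightarrow> Q v t"
  shows "call f_current [nl S, encl enc_child cs] Q"
proof -
  have "(length cs + 1) * (N ^ 5 + 100) \<le> N ^ (5 + 2)" by (intro loop_cost small_cost assms(3)) simp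
  then show ?thesis using assms by (intro call_current_aux[OF order.refl]) auto
qed

lemma call_supp_aux:
  assumes "N ^ 5 + 100 \<le> K" "vlist S" "\<And>v a. (v, a) \<in> set cs \<Longrightarrow> vlist v"
    and "\<And>v t. v = bl (supp (set S) cs) \<Longrightarrow> t \<le> (length cs + 1) * K \<Longrightarrow> Q v t"
  shows "call f_supp [nl S, encl enc_child cs] Q"
  using assms(3,4)
proof (induction cs arbitrary: Q)
  case Nil
  show ?case unfolding unfold using assms(1) by (auto simp: run supp_def intro!: Nil)
next
  case (Cons c cs)
  obtain v a where c: "c = (v, a)" by (cases c)
  have v: "vlist v" "\<And>v a. (v, a) \<in> set cs \<Longrightarrow> vlist v" using Cons.prems(1) c by auto
  have iff: "filter (\<lambda>x. x \<in> set v) S = [] \<longleftrightarrow> set S \<inter> set v = {}" by (auto simp: filter_empty_conv)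
  show ?case unfolding unfold
    apply (simp add: run c)
    apply (rule call_inter[OF assms(2) v(1)])
    apply (cases "set S \<inter> set v = {}")
     apply (simp add: iff)
     apply (rule Cons.IH[OF v(2)], assumption)
     apply (rule Cons.prems(2))
      apply (simp add: c supp_def)
    using assms(1) apply simp
    apply (simp add: iff)
    apply (rule Cons.IH[OF v(2)], assumption)
    apply (rule Cons.prems(2))
     apply (simp add: c supp_def)
    using assms(1) apply simp
    done
qed

lemma call_supp:
  assumes "vlist S" "\<And>v a. (v, a) \<in> set cs \<Longrightarrow> vlist v" "length cs < N"
    and "\<And>v t. v = bl (supp (set S) cs) \<Longrightarrow> t \<le> N ^ 7 \<Longrightarrow> Q v t"
  shows "call f_supp [nl S, encl enc_child cs] Q"
proof -
  have "(length cs + 1) * (N ^ 5 + 100) \<le> N ^ (5 + 2)" by (intro loop_cost small_cost assms(3)) simp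
  then show ?thesis using assms by (intro call_supp_aux[OF order.refl]) auto
qed

lemma linear_loop:
  assumes "m < N" "n < N"
  shows "(m + 1) * (20 * n + 100) \<le> N ^ 3"
  using loop_cost[of m "20 * n + 100" 1] assms N_ge by simp

lemma call_sel_cost:
  assumes "length I = length cs" "length cs < N" "\<And>c. c \<in> set cs \<Longrightarrow> vlist c"
    and "\<And>v t. v = nl (sel cs I B) \<Longrightarrow> t \<le> N ^ 3 \<Longrightarrow> Q v t"
  shows "call f_sel [encl nl cs, bl I, nl B] Q"
  by (rule call_sel[where n = "N - 1"])
    (use assms vlist_length N_ge linear_loop[of "length I" "N - 1"] in \<open>force+\<close>)

lemma call_maps:
  assumes "\<And>I. I \<in> set p \<Longrightarrow> length I = length cs" "length cs < N" "\<And>c. c \<in> set cs \<Longrightarrow> vlist c"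
    and "\<And>v t. v = encl nl (map (\<lambda>I. sel cs I B) p @ acc) \<Longrightarrow> t \<le> (length p + 1) * N ^ 4 \<Longrightarrow> Q v t"
  shows "call f_maps [nl B, encl nl cs, encl bl p, encl nl acc] Q"
  using assms(1,4)
proof (induction p arbitrary: Q)
  case Nil
  show ?case unfolding unfold using pow_ge[of 4] by (auto simp: run intro!: Nil)
next
  case (Cons I p)
  have I: "length I = length cs" "\<And>I. I \<in> set p \<Longrightarrow> length I = length cs" using Cons.prems(1) by auto
  have K: "N ^ 3 + 100 \<le> N ^ 4" using pow_Suc[of 3] pow_ge[of 3] by simp
  show ?case unfolding unfold using I K
    by (auto simp: run intro!: Cons.IH Cons.prems(2) call_sel_cost assms(2,3))
qed

lemma call_mapsrev:
  assumes "\<And>I. I \<in> set p \<Longrightarrow> length I = length cs" "length cs < N" "\<And>c. c \<in> set cs \<Longrightarrow> vlist c"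
    and "\<And>v t. v = encl nl (rev (map (\<lambda>I. sel cs I B) p) @ acc) \<Longrightarrow> t \<le> (length p + 1) * N ^ 4 \<Longrightarrow> Q v t"
  shows "call f_mapsrev [nl B, encl nl cs, encl bl p, encl nl acc] Q"
  using assms(1,4)
proof (induction p arbitrary: acc Q)
  case Nil
  show ?case unfolding unfold using pow_ge[of 4] by (auto simp: run intro!: Nil)
next
  case (Cons I p)
  have I: "length I = length cs" "\<And>I. I \<in> set p \<Longrightarrow> length I = length cs" using Cons.prems(1) by auto
  have K: "N ^ 3 + 100 \<le> N ^ 4" using pow_Suc[of 3] pow_ge[of 3] by simp
  have IH: "call f_mapsrev [nl B, encl nl cs, encl bl p, Node (nl x) (encl nl acc)] R"
    if "\<And>v t. v = encl nl (rev (map (\<lambda>I. sel cs I B) p) @ x # acc) \<Longrightarrow> t \<le> (length p + 1) * N ^ 4 \<Longrightarrow> R v t" for x R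
    using Cons.IH[OF I(2), of "x # acc" R] that by simp
  show ?case unfolding unfold using I K
    by (auto simp: run intro!: IH Cons.prems(2) call_sel_cost assms(2,3))
qed

text \<open>Only validity is tested. A state may be stacked several times, and duplicates are
  discarded when popped. As \<open>J # p\<close> shares \<open>p\<close>, a stacked path costs one
  new cell.\<close>

lemma call_push_aux:
  assumes "N ^ 9 \<le> K" "\<And>J. J \<in> set Js \<Longrightarrow> length J = length cs \<and> vlist (sel cs J B)"
    and "length cs < N" "\<And>c. c \<in> set cs \<Longrightarrow> vlist c" "length ks < N"
    and "\<And>v t. v = encl (encl bl) (rev (map (\<lambda>J. J # p) (filter (valid E (length ks) cs B) Js)) @ st) \<Longrightarrow>
      t \<le> (length Js + 1) * K \<Longrightarrow> Q v t"
  shows "call f_push [xE, nl ks, nl B, encl nl cs, encl bl Js, encl bl p, encl (encl bl) st] Q"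
  using assms(2,6)
proof (induction Js arbitrary: st Q)
  case Nil
  show ?case unfolding unfold using pow_ge[of 9] assms(1) by (auto simp: run intro!: Nil)
next
  case (Cons J Js)
  have J: "length J = length cs" "vlist (sel cs J B)" "\<And>J. J \<in> set Js \<Longrightarrow> length J = length cs \<and> vlist (sel cs J B)"
    using Cons.prems(1) by auto
  have lin: "20 * length ks + 20 \<le> N ^ 3" using linear_loop[of 0 "length ks"] assms(5) N_ge by simp
  have "N ^ 3 \<le> N ^ 8" by (rule pow_mono) simp
  then have K: "N ^ 3 + N ^ 3 + N ^ 8 + 100 \<le> K" using pow_Suc[of 8] pow_ge[of 8] assms(1) by simp
  have IH1: "call f_push [xE, nl ks, nl B, encl nl cs, encl bl Js, encl bl p, encl (encl bl) st] R"
    if "\<And>v t. v = encl (encl bl) (rev (map (\<lambda>J. J # p) (filter (valid E (length ks) cs B) Js)) @ st) \<Longrightarrow>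
      t \<le> (length Js + 1) * K \<Longrightarrow> R v t" for R
    using Cons.IH[OF J(3)] that by blast
  have IH2: "call f_push [xE, nl ks, nl B, encl nl cs, encl bl Js, encl bl p,
      Node (Node (bl J) (encl bl p)) (encl (encl bl) st)] R"
    if "\<And>v t. v = encl (encl bl) (rev (map (\<lambda>J. J # p) (filter (valid E (length ks) cs B) Js)) @ (J # p) # st) \<Longrightarrow>
      t \<le> (length Js + 1) * K \<Longrightarrow> R v t" for R
    using Cons.IH[OF J(3), of "(J # p) # st" R] that by simp
  show ?case unfolding unfold using J K lin
    by (auto simp: run valid_def not_less intro!: IH1[unfolded valid_def] IH2[unfolded valid_def]
        Cons.prems(2) call_sel_cost call_shorter call_indep assms(3,4))
qed

lemma call_push:
  assumes "\<And>J. J \<in> set Js \<Longrightarrow> length J = length cs \<and> vlist (sel cs J B)"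
    and "length cs < N" "\<And>c. c \<in> set cs \<Longrightarrow> vlist c" "length ks < N" "length Js < N"
    and "\<And>v t. v = encl (encl bl) (rev (map (\<lambda>J. J # p) (filter (valid E (length ks) cs B) Js)) @ st) \<Longrightarrow>
      t \<le> N ^ 11 \<Longrightarrow> Q v t"
  shows "call f_push [xE, nl ks, nl B, encl nl cs, encl bl Js, encl bl p, encl (encl bl) st] Q"
proof -
  have "(length Js + 1) * N ^ 9 \<le> N ^ (9 + 2)" by (intro loop_cost assms(5)) simp
  then show ?thesis using assms by (intro call_push_aux[OF order.refl]) auto
qed

end

definition visited :: "nat \<Rightarrow> tree \<Rightarrow> bool list set" where
  "visited n T = {I. length I = n \<and> tmem I T \<noteq> Leaf}"

lemma visited_tins: assumes "length I = n" shows "visited n (tins I T) = insert I (visited n T)"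
proof (intro set_eqI)
  fix J
  from assms show "J \<in> visited n (tins I T) \<longleftrightarrow> J \<in> insert I (visited n T)"
    using tmem_tins[of J I T] by (auto simp: visited_def)
qed

lemma finite_bit_lists: "finite {I :: bool list. length I = n}" "card {I :: bool list. length I = n} = 2 ^ n"
  using finite_lists_length_eq[of "UNIV :: bool set" n] card_lists_length_eq[of "UNIV :: bool set" n] by simp_all

lemma finite_visited: "finite (visited n T)" and card_visited: "card (visited n T) \<le> 2 ^ n"
proof -
  have "visited n T \<subseteq> {I. length I = n}" by (auto simp: visited_def)
  then show "finite (visited n T)" "card (visited n T) \<le> 2 ^ n"
    using finite_bit_lists[of n] card_mono finite_subset by metis+
qed

context graph_instance
begin

text \<open>The factor 2 stands for the way out and back; a path has at most
  \<open>2 ^ length cs + 1\<close> states.\<close>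

definition search_result ::
    "nat list \<Rightarrow> nat \<Rightarrow> nat list list \<Rightarrow> nat list \<Rightarrow> (nat list \<times> nat list) list \<Rightarrow> tree \<Rightarrow> bool" where
  "search_result S0 kk acc W cs v \<longleftrightarrow>
     v = Leaf \<and> stable E kk (hd acc) W cs \<or>
     (\<exists>acc'. v = encl nl acc' \<and> coarse V E kk S0 acc' \<and> length (hd acc) < length (hd acc') \<and>
        length acc' \<le> length acc + 2 * (2 ^ length cs + 1))"

text \<open>An unvisited state has potential \<open>s + 1\<close>, enough for visiting it and for
  the at most \<open>s\<close> neighbours then stacked. A path is extended only when its head
  becomes visited, whence the bound on its length. Visited states are stable and their valid
  neighbours are visited or waiting.\<close>

lemma call_search_aux:
  fixes S W :: "nat list" and cs ks S0 acc
  assumes node: "node_search V E S W cs (length ks)"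
    and acc: "coarse V E (length ks) S0 acc" "hd acc = S"
    and len: "length cs < N" "length ks < N"
  defines "s \<equiv> length cs" and "C \<equiv> current S cs" and "B \<equiv> filter (\<lambda>x. x \<notin> set W) S"
    and "As \<equiv> map snd cs" and "I0 \<equiv> supp (set S) cs"
  assumes path: "\<And>p. p \<in> set st \<Longrightarrow> node_search.path E S W cs (length ks) p \<and> length p \<le> card (visited s T) + 1"
    and start: "I0 \<in> visited s T \<or> (\<exists>p\<in>set st. hd p = I0)"
    and vis: "\<And>I. I \<in> visited s T \<Longrightarrow> node_search.stable_reach S W cs I"
      "\<And>I J. I \<in> visited s T \<Longrightarrow> J \<in> set (flips I) \<Longrightarrow> valid E (length ks) C B J \<Longrightarrow>
        J \<in> visited s T \<or> (\<exists>p\<in>set st. hd p = J)"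
    and Q: "\<And>v t. search_result S0 (length ks) acc W cs v \<Longrightarrow>
      t \<le> ((s + 1) * (2 ^ s - card (visited s T)) + length st + 1) * N ^ 12 + 2 * (2 ^ s + 2) * N ^ 4 \<Longrightarrow> Q v t"
  shows "call f_search [xE, nl ks, nl B, encl nl C, encl nl As, bl I0, encl nl acc, encl (encl bl) st, T] Q"
  using path start vis Q
proof (induction "(s + 1) * (2 ^ s - card (visited s T)) + length st" arbitrary: st T Q rule: less_induct)
  case less
  interpret ns: node_search V E S W cs "length ks" by fact
  have defs: "ns.C = C" "ns.B = B" "ns.As = As" "ns.I0 = I0"
    unfolding ns.C_def ns.B_def ns.As_def ns.I0_def C_def B_def As_def I0_def by simp_all
  have lens: "length C = s" "length As = s" "length I0 = s"
    using ns.lengths unfolding defs s_def by simp_all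
  have s: "s < N" using len by (simp add: s_def)
  have vS: "vlist S" using ns.S' by (simp add: vlist_def)
  have accne: "acc \<noteq> []" using acc by (simp add: coarse_def)
  have sub: "set (A) \<subseteq> V" if "set A \<subseteq> ns.v i" "i < s" for A :: "nat list" and i
    using that is_module_subset[OF ns.child(3)] by (auto simp: s_def)
  have vC: "vlist c" if "c \<in> set C" for c
    using that ns.C_props sub lens unfolding defs vlist_def in_set_conv_nth s_def by metis
  have vAs: "vlist c" if c: "c \<in> set As" for c
  proof -
    obtain i where "i < s" "c = ns.A i" using c ns.As_nth lens unfolding defs in_set_conv_nth s_def by metis
    then show ?thesis using ns.A_props[of i] sub[of c i] by (simp add: vlist_def s_def)
  qed
  have vselC: "vlist (sel C I B)" if "length I = s" for I
    using ns.sel_C_props that unfolding defs vlist_def s_def by simp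
  show ?case
  proof (cases st)
    case Nil
    \<comment> \<open>With an empty stack the invariant says that the visited states contain the
      start and are closed under valid flips.\<close>
    have "I \<in> visited s T" if "reach E (length ks) C B I0 I" for I
      using that by (induction rule: reach.induct) (use less.prems(2,4) Nil in auto)
    then have "stable E (length ks) S W cs"
      using less.prems(3) unfolding ns.stable_iff defs by blast
    moreover have "3 \<le> ((s + 1) * (2 ^ s - card (visited s T)) + length st + 1) * N ^ 12 + 2 * (2 ^ s + 2) * N ^ 4"
    proof -
      have "1 * N ^ 12 \<le> ((s + 1) * (2 ^ s - card (visited s T)) + length st + 1) * N ^ 12"
        by (intro mult_right_mono) auto
      then show ?thesis using pow_ge[of 12] by linarith
    qed
    ultimately show ?thesis unfolding unfold Nil
      using less.prems(5)[of Leaf 3] acc(2) by (simp add: run search_result_def Nil)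
  next
    case (Cons p st')
    let ?M = "(s + 1) * (2 ^ s - card (visited s T)) + length st"
    let ?I = "hd p"
    let ?D = "alt C As ?I"
    have p: "ns.path p" "length p \<le> card (visited s T) + 1" using less.prems(1)[of p] Cons by auto
    then have pne: "p \<noteq> []" and lp: "\<And>I. I \<in> set p \<Longrightarrow> length I = s" and lastp: "last p = I0"
      unfolding ns.path_def defs s_def by auto
    then have lI: "length ?I = s" by simp
    have lD: "length ?D = s" using lI lens by simp
    have vD: "vlist c" if c: "c \<in> set ?D" for c
    proof -
      obtain i where "i < s" "c = ?D ! i" using c lD unfolding in_set_conv_nth by metis
      then have "c = C ! i \<or> c = As ! i" "i < s" using lI lens by (auto simp: nth_alt)
      then show ?thesis using vC vAs lens by (metis nth_mem)
    qed
    have vselD: "vlist (sel ?D I B)" if "length I = s" for I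
      using ns.family_props[of ?D I] ns.alt_props[of ?I] that lI lD unfolding defs vlist_def s_def by simp
    have p_le: "length p \<le> 2 ^ s + 1" using p(2) card_visited[of s T] by linarith
    have base: "1 * N ^ 12 \<le> (?M + 1) * N ^ 12" by (intro mult_right_mono) auto
    have lin: "20 * n + 100 \<le> N ^ 3" if "n < N" for n
      using linear_loop[of 0 n] that N_ge by simp
    have "30 * s + 20 \<le> N ^ 3" using s N_ge linear_loop[of s 0] by simp
    moreover have "20 * s + 100 \<le> N ^ 3" by (rule lin[OF s])
    moreover have "20 * length (sel C ?I B) + 100 \<le> N ^ 3"
      by (rule lin[OF vlist_length[OF vselC[OF lI]]])
    moreover have "20 * length (sel ?D I0 B) + 100 \<le> N ^ 3"
      by (rule lin[OF vlist_length[OF vselD[OF lens(3)]]])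
    moreover have "N ^ 3 \<le> N ^ 11" by (rule pow_mono) simp
    ultimately have lins: "30 * s + 20 \<le> N ^ 11" "20 * s + 100 \<le> N ^ 11" "N ^ 3 \<le> N ^ 11"
      "20 * length (sel C ?I B) + 100 \<le> N ^ 11" "20 * length (sel ?D I0 B) + 100 \<le> N ^ 11" by linarith+
    have K: "20 * N ^ 11 + 200 \<le> N ^ 12" using pow_Suc[of 11] pow_ge[of 11] by simp
    have maps_cost: "(length p + 1) * N ^ 4 \<le> (2 ^ s + 2) * N ^ 4" using p_le by (intro mult_right_mono) auto
    have tl_step: "(?M + 1) * N ^ 12 = N ^ 12 + ((s + 1) * (2 ^ s - card (visited s T)) + length st' + 1) * N ^ 12"
      by (simp add: Cons)
    show ?thesis
    proof (cases "?I \<in> visited s T")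
      case True
      then have mem: "tmem ?I T \<noteq> Leaf" by (simp add: visited_def)
      have start': "I0 \<in> visited s T \<or> (\<exists>p\<in>set st'. hd p = I0)"
        using less.prems(2) True Cons by auto
      have vis': "J \<in> visited s T \<or> (\<exists>p\<in>set st'. hd p = J)"
        if "I \<in> visited s T" "J \<in> set (flips I)" "valid E (length ks) C B J" for I J
        using less.prems(4)[OF that] True Cons by auto
      have IH: "call f_search [xE, nl ks, nl B, encl nl C, encl nl As, bl I0, encl nl acc, encl (encl bl) st', T] R"
        if "\<And>v t. search_result S0 (length ks) acc W cs v \<Longrightarrow>
          t \<le> ((s + 1) * (2 ^ s - card (visited s T)) + length st' + 1) * N ^ 12 + 2 * (2 ^ s + 2) * N ^ 4 \<Longrightarrow> R v t" for R
      proof (rule less.hyps)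
        show "I0 \<in> visited s T \<or> (\<exists>p\<in>set st'. hd p = I0)" by (fact start')
        show "ns.stable_reach I" if "I \<in> visited s T" for I using that by (rule less.prems(3))
        show "J \<in> visited s T \<or> (\<exists>p\<in>set st'. hd p = J)"
          if "I \<in> visited s T" "J \<in> set (flips I)" "valid E (length ks) C B J" for I J
          using that by (rule vis')
        show "(s + 1) * (2 ^ s - card (visited s T)) + length st' < ?M" by (simp add: Cons)
        show "ns.path p \<and> length p \<le> card (visited s T) + 1" if "p \<in> set st'" for p
          using less.prems(1) that Cons by simp
      qed (rule that)
      show ?thesis unfolding unfold
        apply (simp add: run Cons pne)
        apply (rule call_tmem)
        apply (simp add: mem)
        apply (rule IH)
        apply (rule less.prems(5), assumption)
        subgoal premises q for v t v' t'
          using q(2,4) tl_step K lins lI by linarith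
        done
    next
      case False
      then have nmem: "tmem ?I T = Leaf" using lI by (simp add: visited_def)
      let ?T = "tins ?I T"
      let ?st = "rev (map (\<lambda>J. J # p) (filter (valid E (length ks) C B) (flips ?I))) @ st'"
      have visI: "visited s ?T = insert ?I (visited s T)" by (rule visited_tins[OF lI])
      then have cardI: "card (visited s ?T) = card (visited s T) + 1"
        using False finite_visited[of s T] by simp
      have less_M: "(s + 1) * (2 ^ s - card (visited s ?T)) + length ?st + 1 \<le> ?M"
      proof -
        have "length (filter (valid E (length ks) C B) (flips ?I)) \<le> s"
          using length_filter_le[of "valid E (length ks) C B" "flips ?I"] lI by simp
        moreover have "2 ^ s - card (visited s T) = Suc (2 ^ s - card (visited s ?T))"
          using card_visited[of s ?T] cardI by simp
        ultimately show ?thesis by (simp add: Cons)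
      qed
      have IH: "call f_search [xE, nl ks, nl B, encl nl C, encl nl As, bl I0, encl nl acc, encl (encl bl) ?st, ?T] R"
        if st: "ns.stable_reach ?I"
        and R: "\<And>v t. search_result S0 (length ks) acc W cs v \<Longrightarrow>
          t \<le> ((s + 1) * (2 ^ s - card (visited s ?T)) + length ?st + 1) * N ^ 12 + 2 * (2 ^ s + 2) * N ^ 4 \<Longrightarrow> R v t" for R
      proof (rule less.hyps)
        show "(s + 1) * (2 ^ s - card (visited s ?T)) + length ?st < ?M" using less_M by linarith
        show "ns.path q \<and> length q \<le> card (visited s ?T) + 1" if q: "q \<in> set ?st" for q
        proof -
          consider "q \<in> set st'" | J where "q = J # p" "J \<in> set (flips ?I)" "valid E (length ks) C B J"
            using q by auto
          then show ?thesis
          proof cases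
            case 1
            then show ?thesis using less.prems(1)[of q] cardI Cons by simp
          next
            case 2
            have "length J = s" using flips_length[OF 2(2)] lI by simp
            then have "ns.path q"
              using p(1) 2 unfolding ns.path_def defs s_def by (cases p) auto
            then show ?thesis using 2(1) p(2) cardI by simp
          qed
        qed
        show "I0 \<in> visited s ?T \<or> (\<exists>p\<in>set ?st. hd p = I0)"
          using less.prems(2) visI Cons by auto
        show "ns.stable_reach I" if "I \<in> visited s ?T" for I
          using that less.prems(3) st visI by auto
        show "J \<in> visited s ?T \<or> (\<exists>p\<in>set ?st. hd p = J)"
          if J: "I \<in> visited s ?T" "J \<in> set (flips I)" "valid E (length ks) C B J" for I J
        proof (cases "I = ?I")
          case True
          then have "J # p \<in> set ?st" using J by simp
          then show ?thesis by (intro disjI2 bexI[of _ "J # p"]) auto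
        next
          case False
          then show ?thesis using less.prems(4)[OF _ J(2,3)] J(1) visI Cons by auto
        qed
      qed (rule R)
      have res1: "search_result S0 (length ks) acc W cs (encl nl (map (\<lambda>I. sel C I B) p @ acc))"
        if "length S < length (sel C ?I B)"
        using ns.path_coarse[OF p(1) acc] that pne p_le acc(2) unfolding defs
        by (auto simp: search_result_def hd_append hd_map s_def intro!: exI[of _ "map (\<lambda>I. sel C I B) p @ acc"])
      let ?acc2 = "rev (map (\<lambda>I. sel ?D I B) p) @ map (\<lambda>I. sel C I B) p @ acc"
      have "hd ?acc2 = sel ?D I0 B" using pne lastp by (simp add: hd_append hd_rev last_map)
      then have res2: "search_result S0 (length ks) acc W cs (encl nl ?acc2)"
        if "length S < length (sel ?D I0 B)"
        using ns.path_coarse_return[OF p(1) acc] that p_le acc(2) unfolding defs search_result_def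
        by (intro disjI2 exI[of _ ?acc2]) (auto simp: s_def)
      have le1: "N ^ 12 + (length p + 1) * N ^ 4 + (length p + 1) * N ^ 4
          \<le> (?M + 1) * N ^ 12 + 2 * (2 ^ s + 2) * N ^ 4"
        using base maps_cost by linarith
      have flips_cost: "(length ?I + 1) * (20 * s + 100) \<le> N ^ 3" using linear_loop[OF s s] lI by simp
      have st: "ns.stable_reach ?I"
        if "\<not> length S < length (sel C ?I B)" "\<not> length S < length (sel ?D I0 B)"
        using that unfolding ns.stable_reach_def defs by simp
      have IH_cost: "N ^ 12 + ((s + 1) * (2 ^ s - card (visited s ?T)) + length ?st + 1) * N ^ 12 \<le> (?M + 1) * N ^ 12"
      proof -
        have "(1 + ((s + 1) * (2 ^ s - card (visited s ?T)) + length ?st + 1)) * N ^ 12 \<le> (?M + 1) * N ^ 12"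
          using less_M by (intro mult_right_mono) linarith+
        then show ?thesis unfolding distrib_right by simp
      qed
      show ?thesis unfolding unfold
        apply (simp add: run Cons pne)
        apply (rule call_tmem)
        apply (simp add: nmem accne acc(2))
        apply (rule call_sel_cost)
           apply (simp add: lI lens)
          apply (simp add: lens s)
         apply (erule vC)
        apply simp
        apply (rule call_shorter)
        apply (cases "length S < length (sel C ?I B)")
         apply simp
         apply (rule call_maps)
            apply (simp add: lp lens)
           apply (simp add: lens s)
          apply (erule vC)
         apply (rule less.prems(5))
          apply (simp add: res1 del: map_append)
        subgoal premises q using q lI le1 K lins by linarith
        apply simp
        apply (rule call_alt)
          apply (simp add: lI lens)
         apply (simp add: lI lens)
        apply simp
        apply (rule call_sel_cost)
           apply (simp add: lD lens)
          apply (simp add: lD s)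
         apply (erule vD)
        apply simp
        apply (rule call_shorter)
        apply (cases "length S < length (sel ?D I0 B)")
         apply simp
         apply (rule call_maps)
            apply (simp add: lp lens)
           apply (simp add: lens s)
          apply (erule vC)
         apply simp
         apply (rule call_mapsrev)
            apply (simp add: lp lD)
           apply (simp add: lD s)
          apply (erule vD)
         apply (rule less.prems(5))
          apply (simp add: res2 del: map_append)
        subgoal premises q using q lI le1 K lins by linarith
        apply simp
        apply (rule call_flips[where n = s])
         apply (simp add: lI)
        apply simp
        apply (rule call_push)
             apply (simp add: flips_length lI lens vselC)
            apply (simp add: lens s)
           apply (erule vC)
          apply (rule len(2))
         apply (simp add: lI s)
        apply simp
        apply (rule call_tins)
        apply simp
        apply (rule IH[OF st])
          apply simp
         apply simp
        apply (rule less.prems(5), assumption)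
        subgoal premises q using q lI IH_cost flips_cost K lins by linarith
        done
    qed
  qed
qed

lemma call_search:
  assumes node: "node_search V E S W cs (length ks)"
    and acc: "coarse V E (length ks) S0 acc" "hd acc = S"
    and len: "length cs < N" "length ks < N"
    and Q: "\<And>v t. search_result S0 (length ks) acc W cs v \<Longrightarrow> t \<le> 2 ^ length cs * N ^ 14 \<Longrightarrow> Q v t"
  shows "call f_search [xE, nl ks, nl (filter (\<lambda>x. x \<notin> set W) S), encl nl (current S cs),
    encl nl (map snd cs), bl (supp (set S) cs), encl nl acc,
    Node (Node (bl (supp (set S) cs)) Leaf) Leaf, Leaf] Q"
proof -
  interpret ns: node_search V E S W cs "length ks" by fact
  let ?s = "length cs"
  have empty: "visited ?s Leaf = {}" by (simp add: visited_def)
  have path: "ns.path [ns.I0]"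
    using ns.reach_props[OF reach.start] by (simp add: ns.path_def)
  have cost: "((?s + 1) * (2 ^ ?s - card (visited ?s Leaf)) + length [[supp (set S) cs]] + 1) * N ^ 12 + 2 * (2 ^ ?s + 2) * N ^ 4 \<le> 2 ^ ?s * N ^ 14"
  proof -
    have eq: "(?s + 1) * (2 ^ ?s - card (visited ?s Leaf)) + length [[supp (set S) cs]] + 1 =
        (?s + 1) * 2 ^ ?s + 2" by (simp add: empty)
    have "((?s + 1) * 2 ^ ?s + 2) * N ^ 12 \<le> (2 ^ ?s * (?s + 3)) * N ^ 12"
      by (intro mult_right_mono) (auto simp: algebra_simps)
    moreover have "2 * (2 ^ ?s + 2) * N ^ 4 \<le> (2 ^ ?s * 6) * N ^ 4"
      by (intro mult_right_mono) (auto simp: algebra_simps)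
    ultimately have "((?s + 1) * 2 ^ ?s + 2) * N ^ 12 + 2 * (2 ^ ?s + 2) * N ^ 4
        \<le> (2 ^ ?s * (?s + 3)) * N ^ 12 + (2 ^ ?s * 6) * N ^ 4" by (rule add_mono)
    also have "\<dots> = 2 ^ ?s * ((?s + 3) * N ^ 12 + 6 * N ^ 4)" by (simp add: algebra_simps)
    also have "2 ^ ?s * ((?s + 3) * N ^ 12 + 6 * N ^ 4) \<le> 2 ^ ?s * N ^ 14"
    proof (intro mult_left_mono)
      have "(?s + 3) * N ^ 12 \<le> (2 * N) * N ^ 12" using len(1) N_ge by (intro mult_right_mono) auto
      moreover have "N ^ 4 \<le> N ^ 13" by (rule pow_mono) simp
      moreover have "N * N ^ 12 = N ^ 13" by (simp flip: power_Suc)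
      ultimately have "(?s + 3) * N ^ 12 + 6 * N ^ 4 \<le> 8 * N ^ 13" by (simp add: mult.assoc)
      then show "(?s + 3) * N ^ 12 + 6 * N ^ 4 \<le> N ^ 14" using pow_Suc[of 13] by simp
    qed simp
    finally show ?thesis unfolding eq .
  qed
  have "call f_search [xE, nl ks, nl (filter (\<lambda>x. x \<notin> set W) S), encl nl (current S cs),
    encl nl (map snd cs), bl (supp (set S) cs), encl nl acc,
    encl (encl bl) [[supp (set S) cs]], Leaf] Q"
  proof (rule call_search_aux[OF node acc len])
    show "ns.path p \<and> length p \<le> card (visited ?s Leaf) + 1" if "p \<in> set [[supp (set S) cs]]" for p
      using path that by (simp add: ns.I0_def)
  next
    fix v t assume "search_result S0 (length ks) acc W cs v"
      "t \<le> ((?s + 1) * (2 ^ ?s - card (visited ?s Leaf)) + length [[supp (set S) cs]] + 1) * N ^ 12 +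
        2 * (2 ^ ?s + 2) * N ^ 4"
    then show "Q v t" using cost by (intro Q) linarith+
  qed (auto simp: empty)
  then show ?thesis by simp
qed

end

section \<open>Specification of the local search\<close>

lemma call_down:
  assumes "length B \<le> n" "length D \<le> n"
    and "\<And>v t. v = encl (encl f) (downs B D out) \<Longrightarrow> t \<le> (length D + 1) * (20 * n + 100) \<Longrightarrow> Q v t"
  shows "call f_down [encl f B, encl f D, encl (encl f) out] Q"
  using assms(2,3)
proof (induction D arbitrary: Q)
  case Nil
  show ?case unfolding unfold by (auto simp: run intro!: Nil)
next
  case (Cons d D)
  have app: "call f_app [encl f B, Node (f d) (encl f D)] R"
    if "\<And>v t. v = encl f (B @ d # D) \<Longrightarrow> t \<le> 20 * length B + 20 \<Longrightarrow> R v t" for R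
    using call_app[of f B "d # D" R] that by simp
  show ?case unfolding unfold using assms(1) Cons.prems(1)
    by (auto simp: run algebra_simps intro!: Cons.IH Cons.prems(2) app)
qed

lemma call_up:
  assumes "length B \<le> n" "length D \<le> n"
    and "\<And>v t. v = encl (encl f) (ups B D out) \<Longrightarrow> t \<le> (length D + 1) * (20 * n + 100) \<Longrightarrow> Q v t"
  shows "call f_up [encl f B, encl f D, encl (encl f) out] Q"
  using assms(2,3)
proof (induction D arbitrary: out Q)
  case Nil
  show ?case unfolding unfold by (auto simp: run intro!: Nil)
next
  case (Cons d D)
  have app: "call f_app [encl f B, Node (f d) (encl f D)] R"
    if "\<And>v t. v = encl f (B @ d # D) \<Longrightarrow> t \<le> 20 * length B + 20 \<Longrightarrow> R v t" for R
    using call_app[of f B "d # D" R] that by simp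
  have IH: "call f_up [encl f B, encl f D, Node (encl f x) (encl (encl f) out)] R"
    if "\<And>v t. v = encl (encl f) (ups B D (x # out)) \<Longrightarrow> t \<le> (length D + 1) * (20 * n + 100) \<Longrightarrow> R v t" for x R
    using Cons.IH[of "x # out" R] Cons.prems(1) that by simp
  show ?case unfolding unfold using assms(1) Cons.prems(1)
    by (auto simp: run algebra_simps intro!: IH Cons.prems(2) app)
qed

text \<open>Linear in the value and not only in the number of bits; this is enough for counting list
  lengths.\<close>

lemma call_inc:
  assumes "\<And>v t. v = enc_nat (n + 1) \<Longrightarrow> t \<le> 30 * n + 30 \<Longrightarrow> Q v t"
  shows "call f_inc [enc_nat n] Q"
  using assms
proof (induction n arbitrary: Q rule: less_induct)
  case (less n)
  show ?case
  proof (cases "n = 0")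
    case True
    have "enc_nat (0 + 1) = Node (Node Leaf Leaf) Leaf"
      by (simp add: enc_nat.simps[of 1] enc_nat.simps[of 0])
    then show ?thesis unfolding unfold True
      using less.prems[unfolded True] by (simp add: run enc_nat.simps[of 0])
  next
    case False
    then have n: "enc_nat n = Node (enc_bool (odd n)) (enc_nat (n div 2))" and lt: "n div 2 < n"
      by (auto simp: enc_nat.simps[of n])
    have n1: "enc_nat (n + 1) = Node (enc_bool (even n)) (enc_nat ((n + 1) div 2))"
      by (simp add: enc_nat.simps[of "n + 1"])
    show ?thesis
    proof (cases "odd n")
      case True
      then have "(n + 1) div 2 = n div 2 + 1" by presburger
      then show ?thesis unfolding unfold n
        using less.prems True lt n1 by (auto simp: run intro!: less.IH)
    next
      case even: False
      then have "(n + 1) div 2 = n div 2" by presburger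
      then show ?thesis unfolding unfold n
        using less.prems even n1 False by (auto simp: run)
    qed
  qed
qed

lemma call_binlen:
  assumes "length xs \<le> n"
    and "\<And>v t. v = enc_nat (length xs) \<Longrightarrow> t \<le> (length xs + 1) * (30 * n + 100) \<Longrightarrow> Q v t"
  shows "call f_binlen [encl f xs] Q"
  using assms
proof (induction xs arbitrary: Q)
  case Nil
  show ?case unfolding unfold by (auto simp: run enc_nat.simps[of 0] intro!: Nil)
next
  case (Cons x xs)
  show ?case unfolding unfold using Cons.prems(1)
    by (auto simp: run algebra_simps intro!: Cons.IH call_inc Cons.prems(2))
qed

context graph_instance
begin

text \<open>Without arithmetic, sizes are compared by walking along two lists, so the binary
  threshold is converted to unary: a suffix of \<open>S\<close> of the required length. It is
  wrapped in a cell so that the empty suffix, for threshold 0, differs from failure.\<close>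

lemma call_thresh_aux:
  assumes "N ^ 4 \<le> K" "size (enc_nat j) \<le> N" "length xs < N"
    and "\<And>v t. j \<le> length xs \<Longrightarrow> v = Node (encl f (drop (length xs - j) xs)) Leaf \<Longrightarrow>
      t \<le> (length xs + 1) * K \<Longrightarrow> Q v t"
    and "\<And>t. length xs < j \<Longrightarrow> t \<le> (length xs + 1) * K \<Longrightarrow> Q Leaf t"
  shows "call f_thresh [enc_nat j, encl f xs] Q"
  using assms(3-)
proof (induction xs arbitrary: Q)
  case Nil
  have bl: "call f_binlen [Leaf] R"
    if "\<And>v t. v = enc_nat 0 \<Longrightarrow> t \<le> 100 \<Longrightarrow> R v t" for R
    using call_binlen[of "[]" 0 R f] that by simp
  have K: "40 * N + 500 \<le> K"
    using assms(1) linear_cost[of 1] pow_Suc[of 3] pow_ge[of 3] by simp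
  show ?case unfolding unfold
    apply (simp add: run)
    apply (rule bl)
    apply simp
    apply (rule call_eq)
    apply (cases "j = 0")
     apply simp
     apply (rule Nil.prems(2))
       apply simp
      apply simp
    using assms(2) K apply simp
    apply simp
    apply (rule Nil.prems(3))
     apply simp
    using assms(2) K apply simp
    done
next
  case (Cons x xs)
  let ?l = "length (x # xs)"
  have bl: "call f_binlen [Node (f x) (encl f xs)] R"
    if "\<And>v t. v = enc_nat ?l \<Longrightarrow> t \<le> N ^ 3 \<Longrightarrow> R v t" for R
  proof -
    have "(?l + 1) * (30 * ?l + 100) \<le> N ^ (1 + 2)" using Cons.prems(1) N_ge by (intro loop_cost) auto
    then show ?thesis using call_binlen[of "x # xs" ?l R f] that by simp
  qed
  have K: "N ^ 3 + 40 * N + 500 \<le> K"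
    using assms(1) linear_cost[of 1] pow_Suc[of 3] pow_ge[of 3] by simp
  have dr: "drop (Suc (length xs) - j) (x # xs) = drop (length xs - j) xs" if "j \<le> length xs"
    using that by (simp add: Suc_diff_le)
  show ?case unfolding unfold
    apply (simp add: run)
    apply (rule bl)
    apply simp
    apply (rule call_eq)
    apply (cases "j = ?l")
     apply simp
     apply (rule Cons.prems(2))
       apply simp
      apply simp
    using assms(2) K apply simp
    apply simp
    apply (rule Cons.IH)
    using Cons.prems(1) apply simp
     apply (rule Cons.prems(2))
       apply simp
      apply (simp add: dr)
    using assms(2) K apply simp
    apply (rule Cons.prems(3))
     apply simp
    using assms(2) K apply simp
    done
qed

lemma call_thresh:
  assumes "size (enc_nat j) \<le> N" "vlist S"
    and "\<And>v t ks. j \<le> length S \<Longrightarrow> length ks = j \<Longrightarrow> v = Node (nl ks) Leaf \<Longrightarrow> t \<le> N ^ 6 \<Longrightarrow> Q v t"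
    and "\<And>t. length S < j \<Longrightarrow> t \<le> N ^ 6 \<Longrightarrow> Q Leaf t"
  shows "call f_thresh [enc_nat j, nl S] Q"
proof -
  have "(length S + 1) * N ^ 4 \<le> N ^ (4 + 2)" by (intro loop_cost vlist_length assms(2)) simp
  then show ?thesis
    using assms(1,2) vlist_length
    by (intro call_thresh_aux[OF order.refl]) (auto intro!: assms(3)[of "drop (length S - j) S"] assms(4))
qed

lemma call_interp:
  assumes "\<And>X. X \<in> set acc \<Longrightarrow> vlist X"
    and "\<And>v t. v = encl nl (interp acc out) \<Longrightarrow> t \<le> (length acc + 1) * N ^ 6 \<Longrightarrow> Q v t"
  shows "call f_interp [encl nl acc, encl nl out] Q"
  using assms
proof (induction acc out arbitrary: Q rule: interp.induct)
  case (1 X Y acc out)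
  let ?B = "filter (\<lambda>x. x \<in> set Y) X"
  let ?D1 = "filter (\<lambda>x. x \<notin> set X) Y" and ?D2 = "filter (\<lambda>x. x \<notin> set Y) X"
  have X: "vlist X" and Y: "vlist Y" and acc: "\<And>Z. Z \<in> set (Y # acc) \<Longrightarrow> vlist Z" using "1.prems"(1) by auto
  let ?n = "N - 1"
  have lens: "length ?B \<le> ?n" "length ?D1 \<le> ?n" "length ?D2 \<le> ?n"
    using vlist_length[of ?B] vlist_length[of ?D1] vlist_length[of ?D2] X Y by auto
  have c1: "(length ?D1 + 1) * (20 * ?n + 100) \<le> N ^ 3" and c2: "(length ?D2 + 1) * (20 * ?n + 100) \<le> N ^ 3"
    using lens N_ge by (auto intro!: linear_loop)
  have "N ^ 3 \<le> N ^ 5" by (rule pow_mono) simp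
  then have K: "3 * N ^ 5 + 2 * N ^ 3 + 200 \<le> N ^ 6" using pow_Suc[of 5] pow_ge[of 5] by simp
  have IH: "call f_interp [Node (nl Y) (encl nl acc), encl nl (downs ?B ?D1 (ups ?B ?D2 out))] R"
    if "\<And>v t. v = encl nl (interp (Y # acc) (downs ?B ?D1 (ups ?B ?D2 out))) \<Longrightarrow>
      t \<le> (length (Y # acc) + 1) * N ^ 6 \<Longrightarrow> R v t" for R
    using "1.IH"[OF refl acc, of R] that by simp
  show ?case unfolding unfold
    apply (simp add: run)
    apply (rule call_inter[OF X Y])
    apply simp
    apply (rule call_diff[OF Y X])
    apply simp
    apply (rule call_diff[OF X Y])
    apply simp
    apply (rule call_up[OF lens(1,3)])
    apply simp
    apply (rule call_down[OF lens(1,2)])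
    apply simp
    apply (rule IH)
    apply (rule "1.prems"(2))
     apply (simp add: Let_def)
    subgoal premises q using q c1 c2 K by simp
    done
next
  case ("2_1" out)
  show ?case unfolding unfold using pow_ge[of 6] by (auto simp: run intro!: "2_1.prems"(2)[of Leaf, simplified] "2_1.prems"(2))
next
  case ("2_2" X out)
  show ?case unfolding unfold using pow_ge[of 6] by (auto simp: run intro!: "2_2.prems"(2))
qed

text \<open>The inner factor 2 comes from the bound \<open>width + 1\<close> on the number of parts,
  the outer one from the way out and back.\<close>

definition growth :: nat where "growth = 2 * (2 * 2 ^ width + 1)"

definition nodes_ok :: "(nat list \<times> (nat list \<times> nat list) list) list \<Rightarrow> bool" where
  "nodes_ok ns \<longleftrightarrow> (\<forall>(W, cs)\<in>set ns. node_ok V E W cs \<and> length cs \<le> width + 1 \<and> length cs < N)"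

definition all_stable :: "nat \<Rightarrow> nat list \<Rightarrow> (nat list \<times> (nat list \<times> nat list) list) list \<Rightarrow> bool" where
  "all_stable kk S ns \<longleftrightarrow> (\<forall>(W, cs)\<in>set ns. stable E kk S W cs)"

definition improve_result where
  "improve_result S0 kk acc ns v \<longleftrightarrow>
     v = Leaf \<and> all_stable kk (hd acc) ns \<or>
     (\<exists>acc'. v = encl nl acc' \<and> coarse V E kk S0 acc' \<and> length (hd acc) < length (hd acc') \<and>
        length acc' \<le> length acc + growth)"

lemma coarse_vlist: "coarse V E kk S0 acc \<Longrightarrow> X \<in> set acc \<Longrightarrow> vlist X"
  by (auto simp: coarse_def coarse_set_def vlist_def)

text \<open>The current set does not change while the nodes are scanned, so a scan without success
  certifies all of them for the same set.\<close>

lemma call_improve: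
  assumes acc: "coarse V E (length ks) S0 acc" and ks: "length ks < N"
    and ns: "nodes_ok ns"
    and Q: "\<And>v t. improve_result S0 (length ks) acc ns v \<Longrightarrow> t \<le> (length ns + 1) * (2 ^ width * N ^ 15) \<Longrightarrow> Q v t"
  shows "call f_improve [xE, nl ks, encl enc_node ns, encl nl acc] Q"
  using ns Q
proof (induction ns arbitrary: Q)
  case Nil
  have "3 \<le> 2 ^ width * N ^ 15" using pow_ge[of 15] mult_le_mono[of 1 "2 ^ width" 3 "N ^ 15"] by simp
  then show ?case unfolding unfold
    using Nil.prems(2)[of Leaf 3] by (simp add: run improve_result_def all_stable_def)
next
  case (Cons nd ns)
  obtain W cs where nd: "nd = (W, cs)" by (cases nd)
  let ?S = "hd acc"
  have accne: "acc \<noteq> []" using acc by (simp add: coarse_def)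
  have S: "coarse_set V E (length ks) ?S" using acc accne by (simp add: coarse_def)
  have ok: "node_ok V E W cs" "length cs \<le> width + 1" "length cs < N" "nodes_ok ns"
    using Cons.prems(1) by (auto simp: nodes_ok_def nd)
  have vS: "vlist ?S" using acc accne by (auto intro: coarse_vlist)
  have vW: "vlist W" using ok(1) is_module_subset[of V E "set W"] by (auto simp: node_ok_def vlist_def)
  have vv: "vlist v" if "(v, a) \<in> set cs" for v a
  proof -
    have "v \<in> set (map fst cs)" using that by force
    moreover have "distinct (concat (map fst cs))" using ok(1) by (simp add: node_ok_def)
    ultimately have "distinct v" unfolding distinct_concat_iff by blast
    moreover have "set v \<subseteq> set W" using ok(1) that by (auto simp: node_ok_def is_module_def)
    ultimately show ?thesis using vW by (auto simp: vlist_def)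
  qed
  have node: "node_search V E ?S W cs (length ks)" using S ok(1) by (simp add: node_search_def)
  have pw: "(2::nat) ^ length cs \<le> 2 * 2 ^ width"
    using power_increasing[OF ok(2), of "2::nat"] by (simp add: power_add)
  then have cost: "2 ^ length cs * N ^ 14 \<le> 2 * (2 ^ width * N ^ 14)"
    using mult_right_mono[OF pw, of "N ^ 14"] by simp
  have K: "2 * (2 ^ width * N ^ 14) + N ^ 5 + 2 * N ^ 7 + (20 * length cs + 20) + 200 \<le> 2 ^ width * N ^ 15"
  proof -
    have "N ^ 5 \<le> N ^ 14" "N ^ 7 \<le> N ^ 14" by (rule pow_mono; simp)+
    then have "N ^ 5 + 2 * N ^ 7 + (20 * length cs + 20) + 200 \<le> 4 * N ^ 14"
      using ok(3) linear_cost[of 12] by simp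
    also have "\<dots> \<le> 4 * (2 ^ width * N ^ 14)" by simp
    finally have "2 * (2 ^ width * N ^ 14) + N ^ 5 + 2 * N ^ 7 + (20 * length cs + 20) + 200 \<le> 6 * (2 ^ width * N ^ 14)"
      by linarith
    also have "\<dots> = 2 ^ width * (6 * N ^ 14)" by simp
    also have "\<dots> \<le> 2 ^ width * N ^ 15" using pow_Suc[of 14] by (intro mult_left_mono) auto
    finally show ?thesis .
  qed
  have lenE: "(length (nd # ns) + 1) * (2 ^ width * N ^ 15) =
      2 ^ width * N ^ 15 + (length ns + 1) * (2 ^ width * N ^ 15)" by simp
  show ?case unfolding unfold
    apply (simp add: run nd accne)
    apply (rule call_supp[OF vS vv ok(3)], assumption)
    apply (simp add: accne)
    apply (rule call_diff[OF vS vW])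
    apply (simp add: accne)
    apply (rule call_current[OF vS vv ok(3)], assumption)
    apply simp
    apply (rule call_snds)
    apply simp
    apply (rule call_search[OF node acc refl ok(3) ks])
    subgoal premises q for v1 t1 v2 t2 v3 t3 v4 t4 v5 t5
    proof (cases "v5 = Leaf")
      case True
      then have st: "stable E (length ks) ?S W cs"
        using q(9) acc by (auto simp: search_result_def coarse_def)
      show ?thesis
        apply (simp add: True)
        apply (rule Cons.IH[OF ok(4)])
        apply (rule Cons.prems(2))
        subgoal using st by (auto simp: improve_result_def all_stable_def nd)
        subgoal premises r using q r K cost lenE by linarith
        done
    next
      case False
      then have "improve_result S0 (length ks) acc (nd # ns) v5"
        using q(9) pw by (auto simp: search_result_def improve_result_def growth_def)
      then show ?thesis
        apply (simp add: False)
        apply (rule Cons.prems(2), assumption)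
        using q K cost lenE by linarith
    qed
    done
qed

definition climb_cost :: nat where "climb_cost = 2 ^ width * N ^ 18"

text \<open>Every success enlarges the current set, so there are at most \<open>card V\<close> of
  them; this bounds the time as well as the length of the recorded sequence.\<close>

lemma call_climb:
  assumes acc: "coarse V E (length ks) S0 acc" and ks: "length ks < N"
    and ns: "nodes_ok ns" "length ns \<le> 2 * N"
    and Q: "\<And>v t acc'. coarse V E (length ks) S0 acc' \<Longrightarrow> all_stable (length ks) (hd acc') ns \<Longrightarrow>
      length acc' \<le> length acc + (card V - length (hd acc)) * growth \<Longrightarrow> v = encl nl acc' \<Longrightarrow>
      t \<le> (card V - length (hd acc) + 1) * climb_cost \<Longrightarrow> Q v t"
  shows "call f_climb [xE, nl ks, encl enc_node ns, encl nl acc] Q"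
  using acc Q
proof (induction "card V - length (hd acc)" arbitrary: acc Q rule: less_induct)
  case less
  have cost: "(length ns + 1) * (2 ^ width * N ^ 15) + 100 \<le> climb_cost"
  proof -
    have "(length ns + 1) * (2 ^ width * N ^ 15) \<le> (3 * N) * (2 ^ width * N ^ 15)"
      using ns(2) N_ge by (intro mult_right_mono) auto
    also have "\<dots> = 2 ^ width * (3 * N ^ 16)" by (simp flip: power_Suc add: algebra_simps)
    finally have "(length ns + 1) * (2 ^ width * N ^ 15) \<le> 2 ^ width * (3 * N ^ 16)" .
    moreover have "2 ^ width * (3 * N ^ 16 + 100) = 2 ^ width * (3 * N ^ 16) + 2 ^ width * 100"
      by (rule distrib_left)
    moreover have "100 \<le> (2 :: nat) ^ width * 100" by simp
    ultimately have "(length ns + 1) * (2 ^ width * N ^ 15) + 100 \<le> 2 ^ width * (3 * N ^ 16 + 100)"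
      by linarith
    also have "\<dots> \<le> 2 ^ width * N ^ 18"
      using pow_Suc[of 16] pow_Suc[of 17] pow_ge[of 16] by (intro mult_left_mono) auto
    finally show ?thesis by (simp add: climb_cost_def)
  qed
  have one: "1 * climb_cost \<le> (card V - length (hd acc) + 1) * climb_cost" by (intro mult_right_mono) auto
  show ?case unfolding unfold
    apply (simp add: run)
    apply (rule call_improve[OF less.prems(1) ks ns(1)])
    subgoal premises q for v t
    proof (cases "v = Leaf")
      case True
      then have "all_stable (length ks) (hd acc) ns"
        using q(1) by (auto simp: improve_result_def coarse_def)
      then show ?thesis
        apply (simp add: True)
        apply (rule less.prems(2)[OF less.prems(1)], assumption)
          apply simp
         apply simp
        using q(2) cost one by linarith
    next
      case False
      then obtain acc' where acc': "v = encl nl acc'" "coarse V E (length ks) S0 acc'"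
          "length (hd acc) < length (hd acc')" "length acc' \<le> length acc + growth"
        using q(1) by (auto simp: improve_result_def)
      have "vlist (hd acc')" using acc'(2) by (auto intro!: coarse_vlist simp: coarse_def)
      then have "length (hd acc') \<le> card V"
        using card_mono[OF fin_V, of "set (hd acc')"] by (simp add: vlist_def distinct_card)
      then have m: "card V - length (hd acc) \<ge> Suc (card V - length (hd acc'))" using acc'(3) by simp
      have ms: "(card V - length (hd acc') + 1) * climb_cost + climb_cost \<le> (card V - length (hd acc) + 1) * climb_cost"
        using mult_right_mono[of "card V - length (hd acc') + 1 + 1" "card V - length (hd acc) + 1" climb_cost] m
        by (simp add: algebra_simps)
      have mg: "(card V - length (hd acc')) * growth + growth \<le> (card V - length (hd acc)) * growth"
        using mult_right_mono[OF m, of growth] by simp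
      show ?thesis
        apply (simp add: False)
        apply (subst acc'(1))
        apply (rule less.hyps[OF _ acc'(2)])
        using m apply simp
        apply (rule less.prems(2), assumption, assumption)
          apply (use acc'(4) mg in linarith)
         apply assumption
        subgoal premises r using r(5) q(2) ms cost by linarith
        done
    qed
    done
qed

end

section \<open>The main program\<close>

lemma encodes_vertices: "encodes_set encodes_vertex A x \<longleftrightarrow> (\<exists>xs. distinct xs \<and> set xs = A \<and> x = nl xs)"
proof -
  have "list_all2 encodes_vertex xs ys \<longleftrightarrow> ys = map enc_nat xs" for xs ys
    by (auto simp: list_all2_conv_all_nth encodes_vertex_def intro: nth_equalityI)
  then show ?thesis by (auto simp: encodes_set_def encodes_list_def encl_eq)
qed

lemma length_le_size: "length xs \<le> size (enc_list xs)"
  by (induction xs) auto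

lemma size_elem: "x \<in> set xs \<Longrightarrow> size x \<le> size (enc_list xs)"
  by (induction xs) auto

lemma decomp_length_Suc: "decomp V E m W A ns \<Longrightarrow> length ns \<le> 2 * length W + 1"
proof (cases "W = []")
  case True
  assume "decomp V E m W A ns"
  then show ?thesis
  proof cases
    case (split Ps rs)
    then show ?thesis using True by (cases Ps) auto
  qed auto
next
  case False
  assume "decomp V E m W A ns"
  from decomp_length[OF this False] show ?thesis by simp
qed

context graph_instance
begin

definition correct_output :: "nat list \<Rightarrow> int \<Rightarrow> tree \<Rightarrow> bool" where
  "correct_output S k v \<longleftrightarrow> (\<exists>S' Ss. encodes_output S' Ss v \<and> independent_set V E S' \<and>
     card S' = tar_lambda V E (set S) k \<and> tar_sequence V E k (set S) S' Ss)"

lemma encodes_output_lists: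
  assumes "distinct X" "\<forall>Y\<in>set Ys. distinct Y"
  shows "encodes_output (set X) (map set Ys) (Node (nl X) (encl nl Ys))"
proof -
  have "list_all2 (encodes_set encodes_vertex) (map set Ys) (map nl Ys)"
    using assms(2) by (auto simp: list_all2_conv_all_nth encodes_vertices)
  then have "encodes_list (encodes_set encodes_vertex) (map set Ys) (encl nl Ys)"
    by (auto simp: encodes_list_def encl_eq[of nl])
  then show ?thesis using assms(1) by (auto simp: encodes_output_def encodes_vertices)
qed

lemma call_finish:
  assumes acc: "coarse V E kk S acc" and k: "k \<le> int kk" "k \<le> int (length S)" "kk = nat k"
    and opt: "opt E kk (set (hd acc)) V" and S: "distinct S"
    and Q: "\<And>v t. correct_output S k v \<Longrightarrow> t \<le> (length acc + 2) * N ^ 6 \<Longrightarrow> Q v t"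
  shows "call f_finish [encl nl acc] Q"
proof -
  let ?X = "hd acc"
  have ne: "acc \<noteq> []" using acc by (simp add: coarse_def)
  have X: "coarse_set V E kk ?X" using acc ne by (simp add: coarse_def)
  then have iX: "independent_set V E (set ?X)" by (simp add: coarse_set_def independent_set_iff)
  \<comment> \<open>The one-element sequence at the final set is the seed that \<open>interp\<close>
    extends backwards to \<open>S\<close>.\<close>
  then have "tar_sequence V E k (set ?X) (set ?X) (map set [?X])" by (simp add: tar_sequence_def)
  note ic = interp_correct[OF acc k(1) this]
  have dX: "distinct ?X" using X by (simp add: coarse_set_def)
  have seq: "tar_sequence V E k (set S) (set ?X) (map set (interp acc [?X]))"
    and dI: "\<forall>Y\<in>set (interp acc [?X]). distinct Y" using ic dX by auto
  have "card (set ?X) = tar_lambda V E (set S) k"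
    using opt k iX S by (intro tar_lambda_opt[OF fin_V _ seq]) (auto simp: distinct_card independent_set_def)
  then have out: "correct_output S k (Node (nl ?X) (encl nl (interp acc [?X])))"
    using seq iX encodes_output_lists[OF dX dI] unfolding correct_output_def by blast
  have it: "call f_interp [encl nl acc, Node (nl ?X) Leaf] R"
    if "\<And>v t. v = encl nl (interp acc [?X]) \<Longrightarrow> t \<le> (length acc + 1) * N ^ 6 \<Longrightarrow> R v t" for R
    using call_interp[of acc "[?X]" R] that coarse_vlist[OF acc] by simp
  have len: "(length acc + 2) * N ^ 6 = N ^ 6 + (length acc + 1) * N ^ 6" by (simp add: algebra_simps)
  show ?thesis unfolding unfold
    apply (simp add: run ne)
    apply (rule it)
    apply (rule Q)
     apply (simp add: out)
    using len pow_ge[of 6] by linarith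
qed

text \<open>The nested postconditions mirror the nested calls in \<open>main_body\<close>;
  \<open>c\<close> stands for the constant cost of the constructs around them.\<close>

lemma call_core:
  assumes Vl: "distinct Vl" "set Vl = V" and S: "vlist S" "indep E (set S)"
    and k: "kk = nat k" "kk \<le> length S" and ks: "length ks = kk"
    and Q: "\<And>v t. correct_output S k v \<Longrightarrow> t \<le> 2 ^ width * N ^ 21 \<Longrightarrow> Q v t"
  shows "call f_solve [nl Vl, xE, nl Vl] (\<lambda>v1 t1. call f_climb [xE, nl ks, tail v1, Node (nl S) Leaf]
    (\<lambda>v2 t2. call f_finish [v2] (\<lambda>v t. \<forall>c\<le>1000. Q v (c + (t1 + (t2 + t))))))"
proof -
  have vV: "vlist Vl" using Vl by (simp add: vlist_def)
  have mV: "is_module V E (set Vl)" using Vl by (simp add: is_module_def)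
  have cV: "card V = length Vl" using Vl distinct_card by metis
  show ?thesis
  proof (rule call_solve[OF vV mV order.refl])
    fix v1 t1 A ns
    assume d: "decomp V E width Vl A ns" and v1: "v1 = Node (nl A) (encl enc_node ns)"
      and t1: "t1 + 3 * solve_cost \<le> 4 * max 1 (length Vl) * solve_cost"
    have ns: "nodes_ok ns"
    proof -
      have "node_ok V E W cs \<and> length cs \<le> width + 1 \<and> length cs < N" if "(W, cs) \<in> set ns" for W cs
        using decomp_nodes[OF d no_loop that] vlist_length_Suc[OF vV] by linarith
      then show ?thesis by (auto simp: nodes_ok_def)
    qed
    have lns: "length ns \<le> 2 * N" using decomp_length_Suc[OF d] vlist_length[OF vV] by linarith
    have acc: "coarse V E (length ks) S [S]"
      using S k ks by (simp add: coarse_def coarse_set_def vlist_def)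
    have ksN: "length ks < N" using ks k(2) vlist_length[OF S(1)] by simp
    have "call f_climb [xE, nl ks, encl enc_node ns, encl nl [S]]
      (\<lambda>v2 t2. call f_finish [v2] (\<lambda>v t. \<forall>c\<le>1000. Q v (c + (t1 + (t2 + t)))))"
    proof (rule call_climb[OF acc ksN ns lns])
      fix v2 t2 acc'
      assume acc': "coarse V E (length ks) S acc'" and st: "all_stable (length ks) (hd acc') ns"
        and len: "length acc' \<le> length [S] + (card V - length (hd [S])) * growth"
        and v2: "v2 = encl nl acc'" and t2: "t2 \<le> (card V - length (hd [S]) + 1) * climb_cost"
      have cs: "coarse_set V E (length ks) (hd acc')" using acc' by (simp add: coarse_def)
      have opt: "opt E (length ks) (set (hd acc')) V"
      proof -
        \<comment> \<open>At the root every token lies in \<open>W\<close>, so the current set meets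
          it or is empty.\<close>
        have "set (hd acc') \<inter> set Vl \<noteq> {} \<or> hd acc' = []"
          using cs Vl(2) by (cases "hd acc'") (auto simp: coarse_set_def)
        from decomp_opt[OF d no_loop cs _ this] show ?thesis using st Vl(2) by (auto simp: all_stable_def)
      qed
      have cost: "1000 + t1 + t2 + (length acc' + 2) * N ^ 6 \<le> 2 ^ width * N ^ 21"
      proof -
        let ?w = "2 ^ width :: nat"
        have "t1 \<le> 4 * max 1 (length Vl) * solve_cost" using t1 by linarith
        also have "\<dots> \<le> (4 * N) * solve_cost" using vlist_length[OF vV] N_ge by (intro mult_right_mono) auto
        also have "\<dots> = ?w * (4 * N ^ 20)" by (simp add: solve_cost_def flip: power_Suc)
        finally have b1: "t1 \<le> ?w * (4 * N ^ 20)" .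
        note t2
        also have "(card V - length (hd [S]) + 1) * climb_cost \<le> N * climb_cost"
          using card_V by (intro mult_right_mono) auto
        also have "\<dots> = ?w * N ^ 19" by (simp add: climb_cost_def flip: power_Suc)
        also have "\<dots> \<le> ?w * N ^ 20" by (intro mult_left_mono pow_mono) auto
        finally have b2: "t2 \<le> ?w * N ^ 20" .
        have "(card V - length (hd [S])) * growth \<le> N * growth"
          using card_V by (intro mult_right_mono) auto
        moreover have "length [S] = 1" by simp
        ultimately have "length acc' \<le> 1 + N * growth" using len by linarith
        also have "growth \<le> 6 * ?w" by (simp add: growth_def)
        finally have "length acc' \<le> 1 + N * (6 * ?w)" by simp
        moreover have "1 * 1 \<le> N * ?w" using N_ge by (intro mult_le_mono) auto
        ultimately have "length acc' + 2 \<le> 9 * (N * ?w)" by linarith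
        then have "(length acc' + 2) * N ^ 6 \<le> (9 * (N * ?w)) * N ^ 6" by (rule mult_right_mono) simp
        also have "\<dots> = ?w * (9 * N ^ 7)" by (simp flip: power_Suc)
        also have "\<dots> \<le> ?w * (9 * N ^ 20)" by (intro mult_left_mono mult_left_mono pow_mono) auto
        finally have b3: "(length acc' + 2) * N ^ 6 \<le> ?w * (9 * N ^ 20)" .
        have "N ^ 20 \<le> ?w * N ^ 20" by simp
        then have b4: "1000 \<le> ?w * N ^ 20" using pow_ge[of 20] by linarith
        have "?w * (1000 * N ^ 20) \<le> ?w * N ^ 21" using pow_Suc[of 20] by (intro mult_left_mono) auto
        moreover have e: "?w * (c * N ^ 20) = c * (?w * N ^ 20)" for c by simp
        ultimately show ?thesis using b1 b2 b3 b4 e[of 4] e[of 9] e[of 1000] by linarith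
      qed
      show "call f_finish [v2] (\<lambda>v t. \<forall>c\<le>1000. Q v (c + (t1 + (t2 + t))))"
        unfolding v2
      proof (rule call_finish[OF acc' _ _ _ opt])
        show "k \<le> int (length ks)" "k \<le> int (length S)" "length ks = nat k" "distinct S"
          using k ks S by (auto simp: vlist_def)
        show "\<forall>c\<le>1000. Q v (c + (t1 + (t2 + t)))"
          if "correct_output S k v" "t \<le> (length acc' + 2) * N ^ 6" for v t
          using Q[OF that(1)] that(2) cost by auto
      qed
    qed
    then show "call f_climb [xE, nl ks, tail v1, Node (nl S) Leaf]
      (\<lambda>v2 t2. call f_finish [v2] (\<lambda>v t. \<forall>c\<le>1000. Q v (c + (t1 + (t2 + t)))))"
      by (simp add: v1)
  qed
qed

lemma call_mono: "call f vs Q \<Longrightarrow> (\<And>v t. Q v t \<Longrightarrow> R v t) \<Longrightarrow> call f vs R"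
  by (auto simp: call_def wp_def)

lemma call_main:
  assumes Vl: "distinct Vl" "set Vl = V" and S: "distinct S" "independent_set V E (set S)"
    and size: "size (enc_nat (nat \<bar>k\<bar>)) \<le> N"
    and Q: "\<And>v t. correct_output S k v \<Longrightarrow> t \<le> 2 ^ width * N ^ 22 \<Longrightarrow> Q v t"
  shows "call f_main [Node (Node (nl Vl) xE) (Node (nl S) (enc_int k))] Q"
proof -
  have vS: "vlist S" "indep E (set S)" using S by (auto simp: vlist_def independent_set_iff)
  have core: "call f_solve [nl Vl, xE, nl Vl] (\<lambda>v1 t1. call f_climb [xE, nl ks, tail v1, Node (nl S) Leaf]
      (\<lambda>v2 t2. call f_finish [v2] (\<lambda>v t. \<forall>c\<le>1000. Q v (c + (c' + (t1 + (t2 + t)))))))"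
    if "nat k \<le> length S" "length ks = nat k" "c' \<le> N ^ 6" for ks c'
  proof -
    have "N ^ 6 \<le> N ^ 21" by (rule pow_mono) simp
    also have "\<dots> \<le> 2 ^ width * N ^ 21" by simp
    finally have "N ^ 6 \<le> 2 ^ width * N ^ 21" .
    moreover have "2 ^ width * (1000 * N ^ 21) \<le> 2 ^ width * N ^ 22"
      using pow_Suc[of 21] by (intro mult_left_mono) auto
    moreover have "2 ^ width * (1000 * N ^ 21) = 1000 * (2 ^ width * N ^ 21)" by simp
    ultimately have "c' + t \<le> 2 ^ width * N ^ 22" if "t \<le> 2 ^ width * N ^ 21" for t
      using that \<open>c' \<le> N ^ 6\<close> by linarith
    then have "call f_solve [nl Vl, xE, nl Vl] (\<lambda>v1 t1. call f_climb [xE, nl ks, tail v1, Node (nl S) Leaf]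
      (\<lambda>v2 t2. call f_finish [v2] (\<lambda>v t. \<forall>c\<le>1000. Q v (c' + (c + (t1 + (t2 + t)))))))"
      by (intro call_core[OF Vl vS refl that(1,2), where Q = "\<lambda>v t. Q v (c' + t)"] Q)
    then show ?thesis by (simp add: add.left_commute)
  qed
  show ?thesis
  proof (cases "k < 0")
    case True
    \<comment> \<open>A negative threshold acts like 0, which is the empty list in unary.\<close>
    have neg: "call f_solve [nl Vl, xE, nl Vl] (\<lambda>v1 t1. call f_climb [xE, Leaf, tail v1, Node (nl S) Leaf]
      (\<lambda>v2 t2. call f_finish [v2] (\<lambda>v t. \<forall>c\<le>1000. Q v (c + (0 + (t1 + (t2 + t)))))))"
      using core[of "[]" 0] True by simp
    show ?thesis unfolding unfold
      apply (simp add: run enc_int_def True)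
      apply (rule call_mono[OF neg])
      apply (erule call_mono)+
      apply simp
      done
  next
    case False
    then have j: "nat \<bar>k\<bar> = nat k" by simp
    show ?thesis unfolding unfold
      apply (simp add: run enc_int_def False)
      apply (rule call_thresh[OF size vS(1)])
      subgoal premises q for v t ks
        using q j
        apply simp
        apply (rule call_mono[OF core[of ks t]]; simp?)
        apply (erule call_mono)+
        apply (simp add: add.assoc)
        done
      \<comment> \<open>No suffix was found, so \<open>k\<close> exceeds the size of
        \<open>S\<close>: no step is possible and \<open>S\<close> itself is the answer.\<close>
      subgoal premises q for t
      proof -
        have "\<not> k \<le> int (card (set S))" using q(1) j S(1) by (simp add: distinct_card)
        note triv = tar_lambda_trivial[OF this S(2)]
        have "correct_output S k (Node (nl S) (encl nl [S]))"
          using encodes_output_lists[of S "[S]"] triv S unfolding correct_output_def by (intro exI[of _ "set S"] exI[of _ "[set S]"]) auto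
        moreover have "1000 + t \<le> 2 ^ width * N ^ 22"
        proof -
          have "N ^ 6 \<le> N ^ 21" by (rule pow_mono) simp
          then have "1000 + t \<le> N ^ 22" using q(2) pow_Suc[of 21] pow_ge[of 21] by simp
          also have "\<dots> \<le> 2 ^ width * N ^ 22" by simp
          finally show ?thesis .
        qed
        ultimately show ?thesis by (auto intro!: Q)
      qed
      done
  qed
qed

end

theorem theorem2:
  shows "\<exists>(A :: prog) (p :: nat poly).
    \<forall>(V :: nat set) (E :: nat set set) (S :: nat set) (k :: int) (x :: tree).
      finite_graph V E \<longrightarrow> independent_set V E S \<longrightarrow> encodes_input V E S k x \<longrightarrow>
      (\<exists>y t S' Ss.
         runs A x y t \<and> t \<le> 2 ^ modular_width V E * poly p (size x) \<and>
         encodes_output S' Ss y \<and>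
         independent_set V E S' \<and> card S' = tar_lambda V E S k \<and>
         tar_sequence V E k S S' Ss)"
proof (intro exI[of _ prog] exI[of _ "[:1000, 1:] ^ 22"] allI impI)
  fix V :: "nat set" and E :: "nat set set" and S :: "nat set" and k :: int and x :: tree
  assume fg: "finite_graph V E" and ind: "independent_set V E S" and enc: "encodes_input V E S k x"
  obtain Vl xE Sl where Vl: "distinct Vl" "set Vl = V" and Sl: "distinct Sl" "set Sl = S"
    and xE: "encodes_set encodes_edge E xE"
    and x: "x = Node (Node (nl Vl) xE) (Node (nl Sl) (enc_int k))"
    using enc by (auto simp: encodes_input_def encodes_vertices)
  \<comment> \<open>The summand 1000 provides \<open>N_ge\<close>, by which each further power of
    \<open>N\<close> absorbs a constant factor. The polynomial takes the value \<open>N\<close> to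
    the power 22 at \<open>size x\<close>.\<close>
  define N where "N = size x + 1000"
  interpret graph_instance V E xE N
  proof
    show "size (enc_nat v) \<le> N" if "v \<in> V" for v
      using size_elem[of "enc_nat v" "map enc_nat Vl"] that Vl(2) by (simp add: N_def x encl_eq)
    show "card V + 1 < N"
      using distinct_card[OF Vl(1)] Vl(2) length_le_size[of "map enc_nat Vl"] by (simp add: N_def x encl_eq)
    obtain es ys where "distinct es" "set es = E" "list_all2 encodes_edge es ys" "xE = enc_list ys"
      using xE by (auto simp: encodes_set_def encodes_list_def)
    then have "card E \<le> size xE" using length_le_size[of ys] by (metis distinct_card list_all2_lengthD)
    then show "card E < N" by (simp add: N_def x)
  qed (simp_all add: fg xE N_def)
  have "call f_main [x] (\<lambda>v t. correct_output Sl k v \<and> t \<le> 2 ^ width * N ^ 22)"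
    unfolding x using Vl Sl ind
    by (intro call_main) (auto simp: N_def x enc_int_def)
  then obtain v t where "runs prog x v t" "correct_output Sl k v" "t \<le> 2 ^ width * N ^ 22"
    by (auto simp: call_def wp_def runs_def)
  then show "\<exists>y t S' Ss.
         runs prog x y t \<and> t \<le> 2 ^ modular_width V E * poly ([:1000, 1:] ^ 22) (size x) \<and>
         encodes_output S' Ss y \<and>
         independent_set V E S' \<and> card S' = tar_lambda V E S k \<and>
         tar_sequence V E k S S' Ss"
    unfolding correct_output_def width_def Sl(2)
    by (auto simp: poly_power N_def add.commute)
qed

end
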